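(* Let $J$ be an $\mathcal F$-measurable random variable with values in a Lusin space $(E,\mathcal B_E)$ and law $\gamma$, satisfying Jacod's density hypothesis (J), let $\mathbf G$ be the initial enlargement of $\mathbf F$ with respect to $J$, and let $p^x$, $\eta^x$ ($x\in E$) be as in the context. Let $X:E\times\Omega\times\mathbb R_+\to\mathbb R_+$ be $\mathcal B_E\otimes\mathcal O(\mathbf F)$-measurable and such that $X^x$ is càdlàg for every $x\in E$. Then the following statements hold. (1) If $X^x$ is a supermartingale on $(\Omega,\mathbf F,\mathbb P)$ for $\gamma$-a.e. $x\in E$, then $X^J/p^J$ is a supermartingale on $(\Omega,\mathbf G,\mathbb P)$. (2) If, for $\gamma$-a.e. $x\in E$, $X^x$ is a local martingale on $(\Omega,\mathbf F,\mathbb P)$ and $[[\eta^x,\infty[[\,\subseteq\{X^x=0\}$ (modulo evanescence), then $X^J/p^J$ is a local martingale on $(\Omega,\mathbf G,\mathbb P)$.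
   Context: Let $(\Omega,\mathcal F,\mathbf F,\mathbb P)$ be a filtered probability space, where $\mathbf F=(\mathcal F_t)_{t\in\mathbb R_+}$ satisfies the usual hypotheses (right-continuity and saturation by $\mathbb P$-null sets); $\mathcal F_\infty\subseteq\mathcal F$, possibly strictly. $\mathcal O(\mathbf F)$ is the $\mathbf F$-optional $\sigma$-field on $\Omega\times\mathbb R_+$. Initial enlargement. $J:\Omega\to E$ is $\mathcal F$-measurable, with $(E,\mathcal B_E)$ a Lusin space with its Borel $\sigma$-field. $\mathbf G=(\mathcal G_t)_{t\in\mathbb R_+}$ is the right-continuous augmentation of $\mathbf G^0=(\mathcal G^0_t)_{t\in\mathbb R_+}$, $\mathcal G^0_t=\mathcal F_t\vee\sigma(J)$. $\gamma$ is the law of $J$, and $\gamma_t:\Omega\times\mathcal B_E\to[0,1]$ is a regular version of the $\mathcal F_t$-conditional law of $J$. Hypothesis (J): for all $t\in\mathbb R_+$, $\gamma_t\ll\gamma$ holds $\mathbb P$-a.s. Densities and stopping times. Under (J) there is a $\mathcal B_E\otimes\mathcal O(\mathbf F)$-measurable function $(x,\omega,t)\mapsto p^x_t(\omega)\in[0,\infty)$, càdlàg in $t$, such that (i) for every $t$, $\gamma_t(\mathrm dx)=p^x_t\,\gamma(\mathrm dx)$ $\mathbb P$-a.s., and (ii) for every $x\in E$, $p^x=(p^x_t)_{t\in\mathbb R_+}$ is a martingale on $(\Omega,\mathbf F,\mathbb P)$. Fix such a version. For $x\in E$ put $\zeta^x=\inf\{t\in\mathbb R_+:p^x_t=0\}$,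 $\Lambda^x=\{\zeta^x<\infty,\ p^x_{\zeta^x-}>0\}$ (with $p^x_{0-}=p^x_0$), and $\eta^x=\zeta^x\,\mathbb I_{\Lambda^x}+\infty\,\mathbb I_{\Omega\setminus\Lambda^x}$, an $\mathbf F$-stopping time (the time at which $p^x$ jumps to zero). For a function $X$ on $E\times\Omega\times\mathbb R_+$, $X^x=(X^x_t)_{t\in\mathbb R_+}$ is the process $(\omega,t)\mapsto X(x,\omega,t)$ and $X^J$ is the process $(\omega,t)\mapsto X^{J(\omega)}_t(\omega)$; likewise $p^J$ and $\zeta^J$. It is known that $\mathbb P[\zeta^J=\infty]=1$, so $1/p^J$ is well defined.
   Formalization: "Supermartingale" for nonnegative processes means adapted with E[X_t|F_s] ≤ X_s, integrability not required, and local martingales may have a non-integrable initial value; otherwise J independent of F with no mean, p=1, X^x=|x| is a counterexample. *)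

theory Defs
  imports "HOL-Probability.Probability"
begin

text \<open>
  The time axis is the half-line \<open>t \<ge> 0\<close> inside \<^typ>\<open>real\<close>; indices \<open>t < 0\<close> are never looked at.
  Random times take values in \<^typ>\<open>ennreal\<close>.  A process is a function of \<open>\<omega>\<close> and \<open>t\<close>, so that
  \<open>X x\<close> is the process \<open>X\<^sup>x\<close> for a family \<open>X\<close> indexed by \<open>x\<close>.  In a filtration
  \<open>F :: real \<Rightarrow> 'a measure\<close> only the \<open>\<sigma>\<close>-fields of the \<open>F t\<close> matter.
\<close>

type_synonym 'a process = "'a \<Rightarrow> real \<Rightarrow> real"

section \<open>Filtrations, processes and stopping times\<close>

definition filtration_on :: "'a measure \<Rightarrow> (real \<Rightarrow> 'a measure) \<Rightarrow> bool" where
  "filtration_on M F \<longleftrightarrow>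
     (\<forall>t\<ge>0. subalgebra M (F t)) \<and> (\<forall>s\<ge>0. \<forall>t\<ge>s. sets (F s) \<subseteq> sets (F t))"

definition usual_hypotheses :: "'a measure \<Rightarrow> (real \<Rightarrow> 'a measure) \<Rightarrow> bool" where
  "usual_hypotheses M F \<longleftrightarrow>
     (\<forall>t\<ge>0. sets (F t) = (\<Inter>s\<in>{t<..}. sets (F s))) \<and> null_sets M \<subseteq> sets (F 0)"

definition adapted :: "(real \<Rightarrow> 'a measure) \<Rightarrow> 'a process \<Rightarrow> bool" where
  "adapted F X \<longleftrightarrow> (\<forall>t\<ge>0. (\<lambda>\<omega>. X \<omega> t) \<in> borel_measurable (F t))"

definition cadlag :: "(real \<Rightarrow> real) \<Rightarrow> bool" where
  "cadlag f \<longleftrightarrow>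
     (\<forall>t\<ge>0. continuous (at_right t) f) \<and> (\<forall>t>0. \<exists>l. (f \<longlongrightarrow> l) (at_left t))"

definition left_limit :: "(real \<Rightarrow> real) \<Rightarrow> real \<Rightarrow> real" where
  "left_limit f t = (if t = 0 then f 0 else Lim (at_left t) f)"

definition optional_sigma :: "'a measure \<Rightarrow> (real \<Rightarrow> 'a measure) \<Rightarrow> ('a \<times> real) measure" where
  "optional_sigma M F = sigma (space M \<times> {0..})
     {{(\<omega>, t) \<in> space M \<times> {0..}. Y \<omega> t \<in> B} | Y B.
        adapted F Y \<and> (\<forall>\<omega>\<in>space M. cadlag (Y \<omega>)) \<and> B \<in> sets (borel :: real measure)}"

definition extended_stopping_time ::
    "'a measure \<Rightarrow> (real \<Rightarrow> 'a measure) \<Rightarrow> ('a \<Rightarrow> ennreal) \<Rightarrow> bool" where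
  "extended_stopping_time M F T \<longleftrightarrow>
     (\<forall>t\<ge>0. {\<omega> \<in> space M. T \<omega> \<le> ennreal t} \<in> sets (F t))"

definition stopped :: "'a process \<Rightarrow> ('a \<Rightarrow> ennreal) \<Rightarrow> 'a process" where
  "stopped X T = (\<lambda>\<omega> t. X \<omega> (enn2real (min (ennreal t) (T \<omega>))))"

section \<open>Martingales, local martingales and nonnegative supermartingales\<close>

definition martingale :: "'a measure \<Rightarrow> (real \<Rightarrow> 'a measure) \<Rightarrow> 'a process \<Rightarrow> bool" where
  "martingale M F X \<longleftrightarrow>
     filtration_on M F \<and> adapted F X \<and> (\<forall>t\<ge>0. integrable M (\<lambda>\<omega>. X \<omega> t)) \<and>
     (\<forall>s\<ge>0. \<forall>t\<ge>s. AE \<omega> in M. real_cond_exp M (F s) (\<lambda>\<omega>. X \<omega> t) \<omega> = X \<omega> s)"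

text \<open>
  As usual, \<open>T n\<close> localizes \<open>X\<close> if \<open>X\<close> stopped at \<open>T n\<close> is a martingale after multiplication with
  the indicator of \<open>T n > 0\<close>.  The indicator allows an initial value that is not integrable.
  Integrability of the initial value cannot be asked for in an initial enlargement: if
  \<open>X\<^sup>x = f x\<close> is constant in \<open>(\<omega>, t)\<close> and \<open>J\<close> is independent of \<open>F\<close>, so that \<open>p = 1\<close>, then
  \<open>X\<^sup>J / p\<^sup>J = f J\<close>.
\<close>

definition local_martingale :: "'a measure \<Rightarrow> (real \<Rightarrow> 'a measure) \<Rightarrow> 'a process \<Rightarrow> bool" where
  "local_martingale M F X \<longleftrightarrow>
     filtration_on M F \<and> adapted F X \<and> (AE \<omega> in M. cadlag (X \<omega>)) \<and>
     (\<exists>T :: nat \<Rightarrow> 'a \<Rightarrow> ennreal.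
        (\<forall>n. extended_stopping_time M F (T n)) \<and>
        (AE \<omega> in M. incseq (\<lambda>n. T n \<omega>) \<and> (\<lambda>n. T n \<omega>) \<longlonglongrightarrow> \<infinity>) \<and>
        (\<forall>n. martingale M F (\<lambda>\<omega> t. if 0 < T n \<omega> then stopped X (T n) \<omega> t else 0)))"

text \<open>
  For nonnegative processes the inequality \<open>E[X\<^sub>t | F\<^sub>s] \<le> X\<^sub>s\<close> makes sense without integrability,
  and the example above shows that integrability cannot be part of the notion here either.
  The lemmas below give the relation with the textbook notion.
\<close>

definition nonneg_supermartingale :: "'a measure \<Rightarrow> (real \<Rightarrow> 'a measure) \<Rightarrow> 'a process \<Rightarrow> bool" where
  "nonneg_supermartingale M F X \<longleftrightarrow>
     filtration_on M F \<and> adapted F X \<and> (\<forall>\<omega>\<in>space M. \<forall>t\<ge>0. 0 \<le> X \<omega> t) \<and>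
     (\<forall>s\<ge>0. \<forall>t\<ge>s. AE \<omega> in M.
        nn_cond_exp M (F s) (\<lambda>\<omega>. ennreal (X \<omega> t)) \<omega> \<le> ennreal (X \<omega> s))"

section \<open>Lusin spaces\<close>

definition lusin_space :: "'e topology \<Rightarrow> bool" where
  "lusin_space E \<longleftrightarrow> Hausdorff_space E \<and>
     (\<exists>P. topspace P = topspace E \<and> completely_metrizable_space P \<and> second_countable P \<and>
          continuous_map P E (\<lambda>x. x))"

definition borel_sets_of :: "'e topology \<Rightarrow> 'e measure" where
  "borel_sets_of E = sigma (topspace E) {U. openin E U}"

section \<open>Initial enlargement\<close>

definition law :: "'a measure \<Rightarrow> 'e topology \<Rightarrow> ('a \<Rightarrow> 'e) \<Rightarrow> 'e measure" where
  "law M E J = distr M (borel_sets_of E) J"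

definition initial_enlargement0 ::
    "'a measure \<Rightarrow> (real \<Rightarrow> 'a measure) \<Rightarrow> 'e topology \<Rightarrow> ('a \<Rightarrow> 'e) \<Rightarrow> real \<Rightarrow> 'a measure" where
  "initial_enlargement0 M F E J t =
     sigma (space M) (sets (F t) \<union> sets (vimage_algebra (space M) J (borel_sets_of E)))"

definition initial_enlargement ::
    "'a measure \<Rightarrow> (real \<Rightarrow> 'a measure) \<Rightarrow> 'e topology \<Rightarrow> ('a \<Rightarrow> 'e) \<Rightarrow> real \<Rightarrow> 'a measure" where
  "initial_enlargement M F E J t =
     sigma (space M) (\<Inter>s\<in>{t<..}. sets (initial_enlargement0 M F E J s))"

definition regular_conditional_law ::
    "'a measure \<Rightarrow> 'a measure \<Rightarrow> 'e topology \<Rightarrow> ('a \<Rightarrow> 'e) \<Rightarrow> ('a \<Rightarrow> 'e measure) \<Rightarrow> bool" where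
  "regular_conditional_law M A E J \<kappa> \<longleftrightarrow>
     \<kappa> \<in> A \<rightarrow>\<^sub>M prob_algebra (borel_sets_of E) \<and>
     (\<forall>B\<in>sets (borel_sets_of E). AE \<omega> in M.
        measure (\<kappa> \<omega>) B = real_cond_exp M A (\<lambda>\<omega>. indicator B (J \<omega>)) \<omega>)"

text \<open>The value is \<open>\<infinity>\<close> if \<open>f\<close> has no zero in \<open>[0, \<infinity>)\<close>.\<close>

definition first_zero :: "(real \<Rightarrow> real) \<Rightarrow> ennreal" where
  "first_zero f = (INF t\<in>{t. 0 \<le> t \<and> f t = 0}. ennreal t)"

definition jump_to_zero :: "(real \<Rightarrow> real) \<Rightarrow> ennreal" where
  "jump_to_zero f =
     (if first_zero f < \<infinity> \<and> 0 < left_limit f (enn2real (first_zero f)) then first_zero f else \<infinity>)"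

text \<open>The measure \<open>\<gamma> t \<omega>\<close> is the conditional law \<open>\<gamma>\<^sub>t(\<omega>, dx)\<close>.\<close>

locale jacod_enlargement = prob_space M
  for M :: "'a measure" and F :: "real \<Rightarrow> 'a measure" and E :: "'e topology" and J :: "'a \<Rightarrow> 'e"
    and \<gamma> :: "real \<Rightarrow> 'a \<Rightarrow> 'e measure" and p :: "'e \<Rightarrow> 'a process" +
  assumes filtration: "filtration_on M F"
    and usual: "usual_hypotheses M F"
    and lusin: "lusin_space E"
    and J_measurable: "J \<in> M \<rightarrow>\<^sub>M borel_sets_of E"
    and conditional_law: "\<And>t. 0 \<le> t \<Longrightarrow> regular_conditional_law M (F t) E J (\<gamma> t)"
    and hypothesis_J: "\<And>t. 0 \<le> t \<Longrightarrow> AE \<omega> in M. absolutely_continuous (law M E J) (\<gamma> t \<omega>)"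
    and p_measurable: "(\<lambda>(x, \<omega>, t). p x \<omega> t)
          \<in> borel_measurable (borel_sets_of E \<Otimes>\<^sub>M optional_sigma M F)"
    and p_nonneg: "\<And>x \<omega> t. x \<in> topspace E \<Longrightarrow> \<omega> \<in> space M \<Longrightarrow> 0 \<le> t \<Longrightarrow> 0 \<le> p x \<omega> t"
    and p_cadlag: "\<And>x \<omega>. x \<in> topspace E \<Longrightarrow> \<omega> \<in> space M \<Longrightarrow> cadlag (p x \<omega>)"
    and p_density: "\<And>t. 0 \<le> t \<Longrightarrow>
          AE \<omega> in M. \<gamma> t \<omega> = density (law M E J) (\<lambda>x. ennreal (p x \<omega> t))"
    and p_martingale: "\<And>x. x \<in> topspace E \<Longrightarrow> martingale M F (p x)"

section \<open>Nonnegative supermartingales and integrability\<close>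

lemma nonneg_supermartingale_integrable:
  assumes "prob_space M" and X: "nonneg_supermartingale M F X"
    and X0: "integrable M (\<lambda>\<omega>. X \<omega> 0)" and t: "0 \<le> t"
  shows "integrable M (\<lambda>\<omega>. X \<omega> t)"
proof -
  interpret prob_space M by fact
  have sub: "subalgebra M (F s)" if "0 \<le> s" for s
    using X that by (auto simp: nonneg_supermartingale_def filtration_on_def)
  interpret finite_measure_subalgebra M "F 0"
    by unfold_locales (rule sub, simp)
  have "(\<lambda>\<omega>. X \<omega> t) \<in> borel_measurable (F t)"
    using X t by (auto simp: nonneg_supermartingale_def adapted_def)
  then have [measurable]: "(\<lambda>\<omega>. X \<omega> t) \<in> borel_measurable M"
    using measurable_from_subalg sub t by blast
  have "(\<integral>\<^sup>+ \<omega>. ennreal (X \<omega> t) \<partial>M)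
      = (\<integral>\<^sup>+ \<omega>. nn_cond_exp M (F 0) (\<lambda>\<omega>. ennreal (X \<omega> t)) \<omega> \<partial>M)"
    using nn_cond_exp_intg[of "\<lambda>_. 1" "\<lambda>\<omega>. ennreal (X \<omega> t)"] by simp
  also have "\<dots> \<le> (\<integral>\<^sup>+ \<omega>. ennreal (X \<omega> 0) \<partial>M)"
    using X t by (intro nn_integral_mono_AE) (auto simp: nonneg_supermartingale_def)
  also have "\<dots> \<le> (\<integral>\<^sup>+ \<omega>. ennreal (norm (X \<omega> 0)) \<partial>M)"
    by (intro nn_integral_mono ennreal_leI) auto
  also have "\<dots> < \<infinity>"
    using X0 by (simp add: integrable_iff_bounded)
  finally have "(\<integral>\<^sup>+ \<omega>. ennreal (X \<omega> t) \<partial>M) < \<infinity>" .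
  moreover have "(\<integral>\<^sup>+ \<omega>. ennreal (norm (X \<omega> t)) \<partial>M) = (\<integral>\<^sup>+ \<omega>. ennreal (X \<omega> t) \<partial>M)"
    using X t by (intro nn_integral_cong) (auto simp: nonneg_supermartingale_def)
  ultimately show ?thesis
    by (simp add: integrable_iff_bounded)
qed

lemma nonneg_supermartingale_iff:
  assumes "prob_space M" and F: "filtration_on M F"
    and nonneg: "\<And>\<omega> t. \<omega> \<in> space M \<Longrightarrow> 0 \<le> t \<Longrightarrow> 0 \<le> X \<omega> t"
    and int: "\<And>t. 0 \<le> t \<Longrightarrow> integrable M (\<lambda>\<omega>. X \<omega> t)"
  shows "nonneg_supermartingale M F X \<longleftrightarrow> adapted F X \<and>
    (\<forall>s\<ge>0. \<forall>t\<ge>s. AE \<omega> in M. real_cond_exp M (F s) (\<lambda>\<omega>. X \<omega> t) \<omega> \<le> X \<omega> s)"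
proof -
  interpret prob_space M by fact
  have key: "(AE \<omega> in M. nn_cond_exp M (F s) (\<lambda>\<omega>. ennreal (X \<omega> t)) \<omega> \<le> ennreal (X \<omega> s))
      \<longleftrightarrow> (AE \<omega> in M. real_cond_exp M (F s) (\<lambda>\<omega>. X \<omega> t) \<omega> \<le> X \<omega> s)"
    if s: "0 \<le> s" and st: "s \<le> t" for s t
  proof -
    interpret finite_measure_subalgebra M "F s"
      by unfold_locales (use F s in \<open>simp add: filtration_on_def\<close>)
    have t: "0 \<le> t" using s st by simp
    have [measurable]: "(\<lambda>\<omega>. X \<omega> t) \<in> borel_measurable M"
      using int[OF t] by simp
    have "(\<integral>\<^sup>+ \<omega>. nn_cond_exp M (F s) (\<lambda>\<omega>. ennreal (X \<omega> t)) \<omega> \<partial>M)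
        = (\<integral>\<^sup>+ \<omega>. ennreal (X \<omega> t) \<partial>M)"
      using nn_cond_exp_intg[of "\<lambda>_. 1" "\<lambda>\<omega>. ennreal (X \<omega> t)"] by simp
    also have "\<dots> \<le> (\<integral>\<^sup>+ \<omega>. ennreal (norm (X \<omega> t)) \<partial>M)"
      by (intro nn_integral_mono ennreal_leI) auto
    also have "\<dots> < \<infinity>"
      using int[OF t] by (simp add: integrable_iff_bounded)
    finally have fin: "AE \<omega> in M. nn_cond_exp M (F s) (\<lambda>\<omega>. ennreal (X \<omega> t)) \<omega> \<noteq> \<infinity>"
      by (intro nn_integral_PInf_AE) (auto simp: less_top)
    have "AE \<omega> in M. ennreal (- X \<omega> t) = 0"
      using nonneg t by (intro AE_I2) (auto simp: ennreal_eq_0_iff)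
    then have "AE \<omega> in M. nn_cond_exp M (F s) (\<lambda>\<omega>. ennreal (- X \<omega> t)) \<omega> = nn_cond_exp M (F s) (\<lambda>_. 0) \<omega>"
      by (intro nn_cond_exp_cong) auto
    moreover have "AE \<omega> in M. nn_cond_exp M (F s) (\<lambda>_. 0) \<omega> = 0"
      using nn_cond_exp_F_meas[of "\<lambda>_. 0"] by auto
    ultimately have "AE \<omega> in M.
        nn_cond_exp M (F s) (\<lambda>\<omega>. ennreal (X \<omega> t)) \<omega> = ennreal (real_cond_exp M (F s) (\<lambda>\<omega>. X \<omega> t) \<omega>)"
      using fin unfolding real_cond_exp_def by eventually_elim (auto simp: less_top)
    then have "AE \<omega> in M.
        nn_cond_exp M (F s) (\<lambda>\<omega>. ennreal (X \<omega> t)) \<omega> \<le> ennreal (X \<omega> s)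
          \<longleftrightarrow> real_cond_exp M (F s) (\<lambda>\<omega>. X \<omega> t) \<omega> \<le> X \<omega> s"
      using AE_space by eventually_elim (use nonneg s in \<open>auto simp: ennreal_le_iff\<close>)
    then show ?thesis
      by (intro eventually_subst) auto
  qed
  show ?thesis
    using F nonneg key by (auto simp: nonneg_supermartingale_def)
qed

end

theory Submission
  imports Defs
begin

text \<open>
  The conditional density gives \<open>E[H(J, \<cdot>)] = \<integral> E[H(x, \<cdot>) p\<^sup>x\<^sub>t] \<gamma>(dx)\<close> for \<open>H\<close> measurable at
  time \<open>t\<close>, so that statements about \<open>X\<^sup>J / p\<^sup>J\<close> in the enlargement \<open>G\<^sup>0\<close> reduce to statements about
  \<open>X\<^sup>x 1{p\<^sup>x > 0}\<close> for fixed \<open>x\<close>.  For supermartingales this suffices because zero is absorbing for \<open>p\<^sup>x\<close>; the passage to the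
  right-continuous \<open>G\<close> is by truncation and dominated convergence.  For local martingales, stop at
  the first time \<open>T\<close> at which \<open>X > n\<close> or \<open>p < 1/n\<close>, a hitting time of an open set and hence jointly measurable in \<open>x\<close>:
  before \<open>T\<close> everything is bounded, and \<open>p\<close> can vanish at \<open>T\<close> only by a jump, where \<open>X\<close> vanishes
  by assumption, so optional sampling of \<open>X\<^sup>x\<close> and \<open>p\<^sup>x\<close> applies.  These times tend to infinity along \<open>J\<close> because
  sampling \<open>p\<^sup>x\<close> when it falls below \<open>1/n\<close> bounds the probability that \<open>p\<^sup>J\<close> does so by \<open>1/n\<close>.
\<close>

section \<open>Right-continuous paths\<close>

text \<open>The obstacle is that \<open>1 / p\<close> cancels the density \<open>p\<close> only
  where \<open>p\<close> is positive: for a fixed \<open>x\<close>, the mass that \<open>X x\<close>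
  carries where \<open>p x\<close> has reached zero is lost. A supermartingale inequality tolerates
  the loss, a martingale equality does not. The level \<open>1/n\<close> is there for this reason: a
  continuous descent of \<open>p x\<close> to zero must pass below the level earlier, so up to
  \<open>T\<close> only the jump that \<open>jump_to_zero\<close> singles out can make
  \<open>p x\<close> vanish. The notions used do not make \<open>X x\<close> or the ratio
  integrable, hence integrals of nonnegative functions against events or weights are used
  throughout, and finiteness is established just where something has to be subtracted or dominated.
  Right-continuity is assumed for \<open>F\<close> and built into \<open>G\<close>, but it is not
  given for the product of the parameter space with \<open>F t\<close>. In the product only strict
  events \<open>T < u\<close>, which are countable unions over rational times, are handled at time
  \<open>u\<close>; non-strict events are used at later times, in sections at a fixed
  \<open>x\<close>, or along \<open>J\<close>.\<close>

lemma cadlag_right_continuous: "cadlag f \<Longrightarrow> 0 \<le> t \<Longrightarrow> continuous (at_right t) f"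
  by (simp add: cadlag_def)

text \<open>Cells of width \<open>1 / Suc m\<close>: \<open>grid_index\<close> numbers the cell of
  \<open>u\<close>, and \<open>grid_point\<close> is the right end of cell \<open>k\<close>, cut off
  at the horizon \<open>t\<close>. Right ends approximate from above, the side on which the paths
  are continuous; the cut-off keeps everything measurable at time \<open>t\<close>.\<close>

definition grid_index :: "nat \<Rightarrow> real \<Rightarrow> nat" where
  "grid_index m u = nat \<lfloor>real (Suc m) * u\<rfloor>"

definition grid_point :: "real \<Rightarrow> nat \<Rightarrow> nat \<Rightarrow> real" where
  "grid_point t m k = min t (real (Suc k) / real (Suc m))"

lemma grid_index_eq_iff:
  assumes "0 \<le> u"
  shows "grid_index m u = k \<longleftrightarrow> real k \<le> real (Suc m) * u \<and> real (Suc m) * u < real (Suc k)"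
proof -
  have "0 \<le> real (Suc m) * u"
    using assms by simp
  then have "grid_index m u = k \<longleftrightarrow> \<lfloor>real (Suc m) * u\<rfloor> = int k"
    unfolding grid_index_def by (metis int_nat_eq nat_int zero_le_floor)
  then show ?thesis
    by (simp add: floor_eq_iff add.commute)
qed

lemma grid_point_bounds: "0 \<le> t \<Longrightarrow> 0 \<le> grid_point t m k \<and> grid_point t m k \<le> t"
  by (simp add: grid_point_def)

lemma grid_point_ge:
  assumes "0 \<le> u" "u \<le> t"
  shows "u \<le> grid_point t m (grid_index m u)"
proof -
  have "real (Suc m) * u < real (Suc (grid_index m u))"
    using grid_index_eq_iff[OF assms(1)] by blast
  then have "u < real (Suc (grid_index m u)) / real (Suc m)"
    by (simp only: mult.commute pos_less_divide_eq of_nat_0_less_iff zero_less_Suc)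
  then show ?thesis
    using assms by (simp add: grid_point_def)
qed

text \<open>Membership in cell \<open>k\<close> can be decided from \<open>u\<close> stopped at the
  right end of that cell: beyond the end both sides are false, since the end belongs to the next
  cell. For a stopping time this places the event in the \<open>\<sigma>\<close>-field at the grid
  point.\<close>

lemma grid_index_min:
  assumes "0 \<le> u" "u \<le> t"
  shows "grid_index m (min u (grid_point t m k)) = k \<longleftrightarrow> grid_index m u = k"
proof (cases "u \<le> grid_point t m k")
  case False
  then have d: "grid_point t m k = real (Suc k) / real (Suc m)" "real (Suc k) / real (Suc m) < u"
    using assms by (auto simp: grid_point_def min_def split: if_splits)
  have "real (Suc m) * (real (Suc k) / real (Suc m)) = real (Suc k)"
    by (simp del: of_nat_Suc)
  moreover have "real (Suc k) < real (Suc m) * u"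
    using d(2) by (simp only: mult.commute pos_divide_less_eq of_nat_0_less_iff zero_less_Suc)
  ultimately show ?thesis
    using d assms by (subst (1 2) grid_index_eq_iff) (auto simp: min_def)
qed (simp add: min_def)

lemma grid_point_tendsto:
  assumes "0 \<le> u"
  shows "(\<lambda>m. real (Suc (grid_index m u)) / real (Suc m)) \<longlonglongrightarrow> u"
proof (rule tendsto_sandwich)
  show "(\<lambda>m. u) \<longlonglongrightarrow> u" by simp
  show "(\<lambda>m. u + inverse (real (Suc m))) \<longlonglongrightarrow> u"
    by (rule LIMSEQ_inverse_real_of_nat_add)
  have *: "real (grid_index m u) \<le> real (Suc m) * u \<and> real (Suc m) * u < real (Suc (grid_index m u))" for m
    using grid_index_eq_iff[OF assms] by blast
  have "u \<le> real (Suc (grid_index m u)) / real (Suc m)" for m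
    using *[of m] by (simp only: mult.commute pos_le_divide_eq of_nat_0_less_iff zero_less_Suc) simp
  then show "\<forall>\<^sub>F m in sequentially. u \<le> real (Suc (grid_index m u)) / real (Suc m)"
    by simp
  have "real (Suc (grid_index m u)) / real (Suc m) \<le> u + inverse (real (Suc m))" for m
  proof -
    have "real (Suc (grid_index m u)) \<le> (u + inverse (real (Suc m))) * real (Suc m)"
    proof -
      have "inverse (real (Suc m)) * real (Suc m) = 1" by simp
      then show ?thesis using *[of m] unfolding distrib_right mult.commute[of u] by simp
    qed
    then show ?thesis
      by (simp only: pos_divide_le_eq of_nat_0_less_iff zero_less_Suc)
  qed
  then show "\<forall>\<^sub>F m in sequentially. real (Suc (grid_index m u)) / real (Suc m) \<le> u + inverse (real (Suc m))"
    by simp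
qed

text \<open>For \<open>u < t\<close> the points stay strictly to the right of \<open>u\<close>,
  where right-continuity applies. For \<open>u = t\<close> the cut-off makes them constant, so
  nothing is asked of \<open>f\<close> beyond the horizon.\<close>

lemma tendsto_grid_point:
  fixes f :: "real \<Rightarrow> 'b::topological_space"
  assumes u: "0 \<le> u" "u \<le> t" and f: "u < t \<Longrightarrow> continuous (at_right u) f"
  shows "(\<lambda>m. f (grid_point t m (grid_index m u))) \<longlonglongrightarrow> f u"
proof (cases "u < t")
  case True
  let ?v = "\<lambda>m. real (Suc (grid_index m u)) / real (Suc m)"
  have "(\<lambda>m. grid_point t m (grid_index m u)) \<longlonglongrightarrow> min t u"
    unfolding grid_point_def by (intro tendsto_min tendsto_const grid_point_tendsto u)
  then have lim: "(\<lambda>m. grid_point t m (grid_index m u)) \<longlonglongrightarrow> u"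
    using True by simp
  have "u < grid_point t m (grid_index m u)" for m
  proof -
    have "real (Suc m) * u < real (Suc (grid_index m u))"
      using grid_index_eq_iff[OF u(1)] by blast
    then have "u < ?v m"
      by (simp only: mult.commute pos_less_divide_eq of_nat_0_less_iff zero_less_Suc)
    with True show ?thesis by (simp add: grid_point_def)
  qed
  then have "filterlim (\<lambda>m. grid_point t m (grid_index m u)) (at_right u) sequentially"
    using lim by (intro filterlim_at_withinI) (auto simp: less_imp_neq[THEN not_sym])
  moreover have "(f \<longlongrightarrow> f u) (at_right u)"
    using f[OF True] by (simp add: continuous_within)
  ultimately show ?thesis
    by (rule filterlim_compose[rotated])
next
  case False
  then have "grid_point t m (grid_index m u) = u" for m
    using grid_point_ge[OF u, of m] grid_point_bounds[of t m "grid_index m u"] u by auto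
  then show ?thesis by simp
qed

text \<open>Each approximation of \<open>\<sigma>\<close> takes countably many values, all at most
  \<open>t\<close>, and the paths converge along them. \<open>A\<close> is a single
  \<open>\<sigma>\<close>-field, so the lemma serves both \<open>F t\<close> and its product with
  the parameter space.\<close>

lemma borel_measurable_at_time:
  fixes f :: "'a \<Rightarrow> real \<Rightarrow> real"
  assumes t: "0 \<le> t"
    and f: "\<And>u. 0 \<le> u \<Longrightarrow> u \<le> t \<Longrightarrow> (\<lambda>\<omega>. f \<omega> u) \<in> borel_measurable A"
    and rc: "\<And>\<omega> u. \<omega> \<in> space A \<Longrightarrow> 0 \<le> u \<Longrightarrow> u < t \<Longrightarrow> continuous (at_right u) (f \<omega>)"
    and \<sigma>[measurable]: "\<sigma> \<in> borel_measurable A"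
    and \<sigma>_bounds: "\<And>\<omega>. \<omega> \<in> space A \<Longrightarrow> 0 \<le> \<sigma> \<omega> \<and> \<sigma> \<omega> \<le> t"
  shows "(\<lambda>\<omega>. f \<omega> (\<sigma> \<omega>)) \<in> borel_measurable A"
proof (rule borel_measurable_LIMSEQ_real)
  fix m
  have [measurable]: "(\<lambda>\<omega>. grid_index m (\<sigma> \<omega>)) \<in> measurable A (count_space UNIV)"
    unfolding grid_index_def by measurable
  show "(\<lambda>\<omega>. f \<omega> (grid_point t m (grid_index m (\<sigma> \<omega>)))) \<in> borel_measurable A"
    by (rule measurable_compose_countable[where f="\<lambda>k \<omega>. f \<omega> (grid_point t m k)"])
       (use f grid_point_bounds[OF t] in auto)
next
  fix \<omega> assume "\<omega> \<in> space A"
  then show "(\<lambda>m. f \<omega> (grid_point t m (grid_index m (\<sigma> \<omega>)))) \<longlonglongrightarrow> f \<omega> (\<sigma> \<omega>)"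
    using rc \<sigma>_bounds by (intro tendsto_grid_point) auto
qed

text \<open>One-sided limits bound \<open>f\<close> above near every point, and compactness of
  \<open>[0, t]\<close> turns the local bounds into one.\<close>

lemma cadlag_bounded:
  assumes f: "cadlag f" and t: "0 \<le> t"
  obtains c where "\<And>u. 0 \<le> u \<Longrightarrow> u \<le> t \<Longrightarrow> f u \<le> c"
proof -
  have "\<exists>e>0. \<exists>c. \<forall>u. 0 \<le> u \<and> \<bar>u - v\<bar> < e \<longrightarrow> f u \<le> c" if v: "0 \<le> v" for v
  proof -
    have "(f \<longlongrightarrow> f v) (at_right v)"
      using f v by (simp add: cadlag_def continuous_within)
    then have "eventually (\<lambda>u. f u < f v + 1) (at_right v)"
      by (rule order_tendstoD) simp
    then obtain b where b: "b > v" "\<And>u. v < u \<Longrightarrow> u < b \<Longrightarrow> f u < f v + 1"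
      by (auto simp: eventually_at_right[of v "v + 1"])
    have "\<exists>a<v. \<exists>c. \<forall>u. a < u \<and> 0 \<le> u \<and> u < v \<longrightarrow> f u \<le> c"
    proof (cases "v = 0")
      case True
      \<comment> \<open>The witness is arbitrary: no \<open>u\<close> satisfies
        \<open>0 \<le> u\<close> and \<open>u < 0\<close>.\<close>
      then show ?thesis by (intro exI[of _ "-1"]) auto
    next
      case False
      then obtain l where "(f \<longlongrightarrow> l) (at_left v)"
        using f v unfolding cadlag_def by (metis order_le_less)
      then have "eventually (\<lambda>u. f u < l + 1) (at_left v)"
        by (rule order_tendstoD) simp
      then obtain a where "a < v" "\<And>u. a < u \<Longrightarrow> u < v \<Longrightarrow> f u < l + 1"
        by (auto simp: eventually_at_left[of "v - 1" v])
      then show ?thesis by (meson less_imp_le)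
    qed
    then obtain a c where a: "a < v" "\<And>u. a < u \<Longrightarrow> 0 \<le> u \<Longrightarrow> u < v \<Longrightarrow> f u \<le> c"
      by blast
    show ?thesis
    proof (intro exI conjI allI impI)
      show "0 < min (v - a) (b - v)" using a b by simp
      fix u assume u: "0 \<le> u \<and> \<bar>u - v\<bar> < min (v - a) (b - v)"
      show "f u \<le> max c (f v + 1)"
      proof (cases u v rule: linorder_cases)
        case less
        then show ?thesis using u a(2)[of u] by auto
      next
        case greater
        then show ?thesis using u b(2)[of u] by auto
      qed simp
    qed
  qed
  then obtain e c where e: "\<And>v. 0 \<le> v \<Longrightarrow> 0 < e v"
    and c: "\<And>v u. 0 \<le> v \<Longrightarrow> 0 \<le> u \<Longrightarrow> \<bar>u - v\<bar> < e v \<Longrightarrow> f u \<le> c v"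
    by metis
  obtain D where D: "D \<subseteq> {0..t}" "finite D" "{0..t} \<subseteq> (\<Union>v\<in>D. ball v (e v))"
  proof (rule compactE_image[of "{0..t}" "{0..t}" "\<lambda>v. ball v (e v)"])
    show "{0..t} \<subseteq> (\<Union>v\<in>{0..t}. ball v (e v))"
      using e by force
  qed auto
  show ?thesis
  proof
    fix u assume u: "0 \<le> u" "u \<le> t"
    then obtain v where v: "v \<in> D" "u \<in> ball v (e v)"
      using D(3) by force
    then have "f u \<le> c v"
      using D(1) u by (intro c) (auto simp: dist_real_def abs_minus_commute)
    also have "\<dots> \<le> Max (c ` D)"
      using v D(2) by simp
    finally show "f u \<le> Max (c ` D)" .
  qed
qed

section \<open>Integral inequalities over sub-sigma-fields\<close>

text \<open>Jensen's inequality for the concave function \<open>min K\<close>, by hand. On the event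
  \<open>g \<le> K\<close>, which lies in \<open>A\<close>, bound \<open>min K f\<close> by
  \<open>f\<close> and use the hypothesis; off it bound by \<open>K\<close>, which is the value of
  \<open>min K g\<close> there.\<close>

lemma nn_integral_min_le:
  fixes f g :: "'a \<Rightarrow> ennreal"
  assumes sub: "subalgebra M A"
    and f[measurable]: "f \<in> borel_measurable M" and g: "g \<in> borel_measurable A"
    and le: "\<And>D. D \<in> sets A \<Longrightarrow> (\<integral>\<^sup>+\<omega>. indicator D \<omega> * f \<omega> \<partial>M) \<le> (\<integral>\<^sup>+\<omega>. indicator D \<omega> * g \<omega> \<partial>M)"
  shows "(\<integral>\<^sup>+\<omega>. min K (f \<omega>) \<partial>M) \<le> (\<integral>\<^sup>+\<omega>. min K (g \<omega>) \<partial>M)"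
proof -
  define D where "D = {\<omega> \<in> space A. g \<omega> \<le> K}"
  have D: "D \<in> sets A" unfolding D_def using g by measurable
  have [measurable]: "D \<in> sets M" "g \<in> borel_measurable M"
    using D sub measurable_from_subalg[OF sub g] by (auto simp: subalgebra_def)
  have sp: "space A = space M" using sub by (simp add: subalgebra_def)
  have "(\<integral>\<^sup>+\<omega>. min K (f \<omega>) \<partial>M) \<le> (\<integral>\<^sup>+\<omega>. indicator D \<omega> * f \<omega> + indicator (space M - D) \<omega> * K \<partial>M)"
    by (intro nn_integral_mono) (auto simp: indicator_def)
  also have "\<dots> = (\<integral>\<^sup>+\<omega>. indicator D \<omega> * f \<omega> \<partial>M) + (\<integral>\<^sup>+\<omega>. indicator (space M - D) \<omega> * K \<partial>M)"
    by (intro nn_integral_add) auto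
  also have "\<dots> \<le> (\<integral>\<^sup>+\<omega>. indicator D \<omega> * g \<omega> \<partial>M) + (\<integral>\<^sup>+\<omega>. indicator (space M - D) \<omega> * K \<partial>M)"
    by (intro add_right_mono le D)
  also have "\<dots> = (\<integral>\<^sup>+\<omega>. indicator D \<omega> * g \<omega> + indicator (space M - D) \<omega> * K \<partial>M)"
    by (intro nn_integral_add[symmetric]) auto
  also have "\<dots> = (\<integral>\<^sup>+\<omega>. min K (g \<omega>) \<partial>M)"
    by (intro nn_integral_cong) (auto simp: indicator_def D_def sp min_def)
  finally show ?thesis .
qed

lemma nn_integral_le_truncated:
  fixes f :: "'a \<Rightarrow> ennreal"
  assumes [measurable]: "f \<in> borel_measurable M"
    and le: "\<And>k::nat. (\<integral>\<^sup>+\<omega>. min (of_nat k) (f \<omega>) \<partial>M) \<le> c"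
  shows "(\<integral>\<^sup>+\<omega>. f \<omega> \<partial>M) \<le> c"
proof -
  have "f \<omega> = (SUP k::nat. min (of_nat k) (f \<omega>))" for \<omega>
  proof -
    have "(SUP k::nat. min (of_nat k) (f \<omega>)) = min (SUP k::nat. of_nat k) (f \<omega>)"
      unfolding inf_min[symmetric] by (simp add: SUP_inf)
    then show ?thesis by (simp add: ennreal_SUP_of_nat_eq_top)
  qed
  then have "(\<integral>\<^sup>+\<omega>. f \<omega> \<partial>M) = (\<integral>\<^sup>+\<omega>. (SUP k::nat. min (of_nat k) (f \<omega>)) \<partial>M)"
    by (intro nn_integral_cong)
  also have "\<dots> = (SUP k::nat. \<integral>\<^sup>+\<omega>. min (of_nat k) (f \<omega>) \<partial>M)"
    by (intro nn_integral_monotone_convergence_SUP) (auto simp: incseq_def le_fun_def min_le_iff_disj)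
  also have "\<dots> \<le> c"
    by (intro SUP_least le)
  finally show ?thesis .
qed

lemma nn_integral_index:
  fixes f :: "nat \<Rightarrow> 'a \<Rightarrow> ennreal"
  assumes [measurable]: "\<kappa> \<in> measurable M (count_space UNIV)" "\<And>k. f k \<in> borel_measurable M"
  shows "(\<integral>\<^sup>+\<omega>. f (\<kappa> \<omega>) \<omega> \<partial>M) = (\<Sum>k. \<integral>\<^sup>+\<omega>. indicator {k} (\<kappa> \<omega>) * f k \<omega> \<partial>M)"
proof -
  have "(\<integral>\<^sup>+\<omega>. f (\<kappa> \<omega>) \<omega> \<partial>M) = (\<integral>\<^sup>+\<omega>. (\<Sum>k. indicator {k} (\<kappa> \<omega>) * f k \<omega>) \<partial>M)"
  proof (intro nn_integral_cong)
    fix \<omega>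
    show "f (\<kappa> \<omega>) \<omega> = (\<Sum>k. indicator {k} (\<kappa> \<omega>) * f k \<omega>)"
      by (subst suminf_finite[of "{\<kappa> \<omega>}"]) auto
  qed
  also have "\<dots> = (\<Sum>k. \<integral>\<^sup>+\<omega>. indicator {k} (\<kappa> \<omega>) * f k \<omega> \<partial>M)"
    by (intro nn_integral_suminf) (auto intro!: borel_measurable_times_ennreal assms(2) measurable_compose[OF assms(1)])
  finally show ?thesis .
qed

lemma nn_integral_index_le:
  fixes f g :: "nat \<Rightarrow> 'a \<Rightarrow> ennreal"
  assumes "\<kappa> \<in> measurable M (count_space UNIV)"
    and "\<And>k. f k \<in> borel_measurable M" "\<And>k. g k \<in> borel_measurable M"
    and "\<And>k. (\<integral>\<^sup>+\<omega>. indicator {k} (\<kappa> \<omega>) * f k \<omega> \<partial>M) \<le> (\<integral>\<^sup>+\<omega>. indicator {k} (\<kappa> \<omega>) * g k \<omega> \<partial>M)"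
  shows "(\<integral>\<^sup>+\<omega>. f (\<kappa> \<omega>) \<omega> \<partial>M) \<le> (\<integral>\<^sup>+\<omega>. g (\<kappa> \<omega>) \<omega> \<partial>M)"
proof -
  have "(\<integral>\<^sup>+\<omega>. f (\<kappa> \<omega>) \<omega> \<partial>M) = (\<Sum>k. \<integral>\<^sup>+\<omega>. indicator {k} (\<kappa> \<omega>) * f k \<omega> \<partial>M)"
    by (rule nn_integral_index) (use assms in auto)
  also have "\<dots> \<le> (\<Sum>k. \<integral>\<^sup>+\<omega>. indicator {k} (\<kappa> \<omega>) * g k \<omega> \<partial>M)"
    by (intro suminf_le assms(4) summableI)
  also have "\<dots> = (\<integral>\<^sup>+\<omega>. g (\<kappa> \<omega>) \<omega> \<partial>M)"
    by (rule nn_integral_index[symmetric]) (use assms in auto)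
  finally show ?thesis .
qed

text \<open>Test the hypothesis on the event where \<open>g\<close> is below the conditional
  expectation and \<open>g \<le> n\<close>. The bound \<open>n\<close> makes the integral of
  \<open>g\<close> finite, so that it can be subtracted; the events exhaust everything as
  \<open>n\<close> grows because \<open>g\<close> is finite.\<close>

lemma nn_cond_exp_leI:
  assumes "prob_space M" and sub: "subalgebra M A"
    and f[measurable]: "f \<in> borel_measurable M" and g: "g \<in> borel_measurable A"
    and fin: "\<And>\<omega>. g \<omega> \<noteq> \<infinity>"
    and le: "\<And>D. D \<in> sets A \<Longrightarrow> (\<integral>\<^sup>+\<omega>. indicator D \<omega> * f \<omega> \<partial>M) \<le> (\<integral>\<^sup>+\<omega>. indicator D \<omega> * g \<omega> \<partial>M)"
  shows "AE \<omega> in M. nn_cond_exp M A f \<omega> \<le> g \<omega>"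
proof -
  interpret prob_space M by fact
  interpret finite_measure_subalgebra M A by unfold_locales (rule sub)
  define h where "h = nn_cond_exp M A f"
  have h: "h \<in> borel_measurable A" unfolding h_def by simp
  have [measurable]: "h \<in> borel_measurable M" "g \<in> borel_measurable M"
    using measurable_from_subalg[OF sub] h g by auto
  have sp: "space A = space M" using sub by (simp add: subalgebra_def)
  have "AE \<omega> in M. \<not> (g \<omega> < h \<omega> \<and> g \<omega> \<le> of_nat n)" for n :: nat
  proof -
    define D where "D = {\<omega> \<in> space A. g \<omega> < h \<omega> \<and> g \<omega> \<le> of_nat n}"
    have D: "D \<in> sets A" unfolding D_def using g h by measurable
    then have [measurable]: "D \<in> sets M" using sub by (auto simp: subalgebra_def)
    have "(\<integral>\<^sup>+\<omega>. indicator D \<omega> * g \<omega> \<partial>M) \<le> (\<integral>\<^sup>+\<omega>. of_nat n \<partial>M)"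
      by (intro nn_integral_mono) (auto simp: indicator_def D_def)
    also have "\<dots> < \<infinity>" by (simp add: emeasure_space_1 of_nat_less_top)
    finally have gfin: "(\<integral>\<^sup>+\<omega>. indicator D \<omega> * g \<omega> \<partial>M) \<noteq> \<infinity>" by simp
    have "(\<integral>\<^sup>+\<omega>. indicator D \<omega> * h \<omega> - indicator D \<omega> * g \<omega> \<partial>M)
        = (\<integral>\<^sup>+\<omega>. indicator D \<omega> * h \<omega> \<partial>M) - (\<integral>\<^sup>+\<omega>. indicator D \<omega> * g \<omega> \<partial>M)"
    proof (intro nn_integral_diff AE_I2)
      show "indicator D \<omega> * g \<omega> \<le> indicator D \<omega> * h \<omega>" for \<omega>
        by (auto simp: D_def split: split_indicator)
    qed (use gfin in auto)
    also have "(\<integral>\<^sup>+\<omega>. indicator D \<omega> * h \<omega> \<partial>M) = (\<integral>\<^sup>+\<omega>. indicator D \<omega> * f \<omega> \<partial>M)"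
      unfolding h_def using D by (intro nn_cond_exp_intg) auto
    also have "\<dots> - (\<integral>\<^sup>+\<omega>. indicator D \<omega> * g \<omega> \<partial>M) = 0"
      using le[OF D] gfin by (intro diff_eq_0_ennreal) (auto simp: less_top)
    finally have "AE \<omega> in M. indicator D \<omega> * h \<omega> - indicator D \<omega> * g \<omega> = 0"
      by (subst (asm) nn_integral_0_iff_AE) auto
    then show ?thesis
      using AE_space
    proof eventually_elim
      case (elim \<omega>)
      show ?case
      proof
        assume *: "g \<omega> < h \<omega> \<and> g \<omega> \<le> of_nat n"
        then have "h \<omega> - g \<omega> = 0"
          using elim by (auto simp: D_def indicator_def sp)
        then show False using * fin[of \<omega>] diff_gr0_ennreal[of "g \<omega>" "h \<omega>"] by (auto simp: less_top)
      qed
    qed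
  qed
  then have "AE \<omega> in M. \<forall>n::nat. \<not> (g \<omega> < h \<omega> \<and> g \<omega> \<le> of_nat n)"
    by (subst AE_all_countable) blast
  then show ?thesis
    unfolding h_def[symmetric]
  proof eventually_elim
    case (elim \<omega>)
    obtain n :: nat where "g \<omega> < of_nat n"
      using fin[of \<omega>] ennreal_Ex_less_of_nat[of "g \<omega>"] by (auto simp: less_top)
    with elim show ?case by (meson less_imp_le not_less)
  qed
qed

section \<open>Optional sampling\<close>

lemma nn_integral_limit_le:
  fixes f :: "nat \<Rightarrow> 'a \<Rightarrow> ennreal"
  assumes [measurable]: "\<And>m. f m \<in> borel_measurable M"
    and lim: "AE \<omega> in M. (\<lambda>m. f m \<omega>) \<longlonglongrightarrow> g \<omega>"
    and le: "\<And>m. (\<integral>\<^sup>+\<omega>. f m \<omega> \<partial>M) \<le> c"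
  shows "(\<integral>\<^sup>+\<omega>. g \<omega> \<partial>M) \<le> c"
proof -
  have "(\<integral>\<^sup>+\<omega>. g \<omega> \<partial>M) = (\<integral>\<^sup>+\<omega>. liminf (\<lambda>m. f m \<omega>) \<partial>M)"
    using lim by (intro nn_integral_cong_AE, eventually_elim)
      (rule lim_imp_Liminf[symmetric], simp_all)
  also have "\<dots> \<le> liminf (\<lambda>m. \<integral>\<^sup>+\<omega>. f m \<omega> \<partial>M)"
    by (intro nn_integral_liminf) simp
  also have "\<dots> \<le> c"
    using le by (metis (mono_tags) Liminf_le eventually_sequentiallyI sequentially_bot)
  finally show ?thesis .
qed

lemma borel_measurable_filtration:
  "filtration_on M F \<Longrightarrow> 0 \<le> s \<Longrightarrow> f \<in> borel_measurable (F s) \<Longrightarrow> f \<in> borel_measurable M"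
  by (auto simp: filtration_on_def intro: measurable_from_subalg)

lemma space_filtration: "filtration_on M F \<Longrightarrow> 0 \<le> s \<Longrightarrow> space (F s) = space M"
  by (auto simp: filtration_on_def subalgebra_def)

lemma sets_filtration_mono: "filtration_on M F \<Longrightarrow> 0 \<le> s \<Longrightarrow> s \<le> t \<Longrightarrow> sets (F s) \<subseteq> sets (F t)"
  by (auto simp: filtration_on_def)

lemma measurable_filtration_mono:
  assumes "filtration_on M F" "0 \<le> s" "s \<le> t" "f \<in> measurable (F s) N"
  shows "f \<in> measurable (F t) N"
proof -
  have "subalgebra (F t) (F s)"
    using assms by (auto simp: filtration_on_def subalgebra_def)
  then show ?thesis using assms(4) by (rule measurable_from_subalg)
qed

text \<open>
  The hypothesis on \<open>W\<close> says that \<open>W\<close> is measurable for the stopped \<open>\<sigma>\<close>-field at \<open>\<sigma>\<close>.  Approximating \<open>\<sigma>\<close> from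
  the right by grid points, Fatou's lemma gives one inequality; the other comes from truncating both
  integrands, which replaces uniform integrability.
\<close>

lemma optional_sampling:
  fixes N :: "'a process" and W :: "'a \<Rightarrow> ennreal"
  assumes "prob_space M" and F: "filtration_on M F" and N: "adapted F N"
    and rc: "\<And>\<omega> u. \<omega> \<in> space M \<Longrightarrow> 0 \<le> u \<Longrightarrow> continuous (at_right u) (N \<omega>)"
    and mart: "\<And>s u V. 0 \<le> s \<Longrightarrow> s \<le> u \<Longrightarrow> V \<in> borel_measurable (F s) \<Longrightarrow>
      (\<integral>\<^sup>+\<omega>. V \<omega> * ennreal (N \<omega> u) \<partial>M) = (\<integral>\<^sup>+\<omega>. V \<omega> * ennreal (N \<omega> s) \<partial>M)"
    and t: "0 \<le> t"
    and \<sigma>_bounds: "\<And>\<omega>. \<omega> \<in> space M \<Longrightarrow> 0 \<le> \<sigma> \<omega> \<and> \<sigma> \<omega> \<le> t"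
    and \<sigma>: "\<And>u. 0 \<le> u \<Longrightarrow> u \<le> t \<Longrightarrow> {\<omega> \<in> space M. \<sigma> \<omega> \<le> u} \<in> sets (F u)"
    and W: "\<And>u. 0 \<le> u \<Longrightarrow> u \<le> t \<Longrightarrow> (\<lambda>\<omega>. W \<omega> * indicator {\<omega>. \<sigma> \<omega> \<le> u} \<omega>) \<in> borel_measurable (F u)"
    and W_fin: "\<And>\<omega>. W \<omega> \<noteq> \<infinity>"
  shows "(\<integral>\<^sup>+\<omega>. W \<omega> * ennreal (N \<omega> t) \<partial>M) = (\<integral>\<^sup>+\<omega>. W \<omega> * ennreal (N \<omega> (\<sigma> \<omega>)) \<partial>M)"
proof -
  interpret prob_space M by fact
  have sp: "space (F u) = space M" if "0 \<le> u" for u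
    using F that by (rule space_filtration)
  have sub: "subalgebra M (F u)" if "0 \<le> u" for u
    using F that by (simp add: filtration_on_def)
  have NF: "(\<lambda>\<omega>. N \<omega> u) \<in> borel_measurable (F u)" if "0 \<le> u" for u
    using N that by (simp add: adapted_def)
  have NM: "(\<lambda>\<omega>. N \<omega> u) \<in> borel_measurable M" if "0 \<le> u" for u
    using NF[OF that] F that by (blast intro: borel_measurable_filtration)
  have \<sigma>F: "(\<lambda>\<omega>. min (\<sigma> \<omega>) d) \<in> borel_measurable (F d)" if d: "0 \<le> d" "d \<le> t" for d
  proof (rule borel_measurableI_le)
    fix y
    show "{\<omega> \<in> space (F d). min (\<sigma> \<omega>) d \<le> y} \<in> sets (F d)"
    proof (cases "0 \<le> y \<and> y < d")
      case True
      then have "{\<omega> \<in> space (F d). min (\<sigma> \<omega>) d \<le> y} = {\<omega> \<in> space M. \<sigma> \<omega> \<le> y}"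
        using sp d by auto
      also have "\<dots> \<in> sets (F d)"
        using \<sigma>[of y] sets_filtration_mono[OF F, of y d] True d by auto
      finally show ?thesis .
    next
      case False
      show ?thesis
      proof (cases "y < 0")
        case True
        then have "{\<omega> \<in> space (F d). min (\<sigma> \<omega>) d \<le> y} = {}"
          using \<sigma>_bounds d sp by fastforce
        then show ?thesis by (simp only: sets.empty_sets)
      next
        case False
        then have "{\<omega> \<in> space (F d). min (\<sigma> \<omega>) d \<le> y} = space (F d)"
          using \<open>\<not> (0 \<le> y \<and> y < d)\<close> by (auto simp: min_le_iff_disj)
        then show ?thesis by simp
      qed
    qed
  qed
  have "\<sigma> \<in> borel_measurable (F t)"
    using \<sigma>F[OF t order_refl] by (rule measurable_cong[THEN iffD1, rotated]) (use \<sigma>_bounds sp t in auto)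
  then have \<sigma>M[measurable]: "\<sigma> \<in> borel_measurable M"
    by (rule borel_measurable_filtration[OF F t])
  have "W \<in> borel_measurable (F t)"
    using W[OF t order_refl] by (rule measurable_cong[THEN iffD1, rotated]) (use \<sigma>_bounds sp t in \<open>auto simp: indicator_def\<close>)
  then have WM[measurable]: "W \<in> borel_measurable M"
    by (rule borel_measurable_filtration[OF F t])
  define d where "d = grid_point t"
  have d: "0 \<le> d m k" "d m k \<le> t" for m k
    using grid_point_bounds[OF t] by (auto simp: d_def)
  define \<kappa> where "\<kappa> = (\<lambda>m \<omega>. grid_index m (\<sigma> \<omega>))"
  have \<kappa>[measurable]: "\<kappa> m \<in> measurable M (count_space UNIV)" for m
    unfolding \<kappa>_def grid_index_def by measurable
  \<comment> \<open>On the atom \<open>\<kappa> m \<omega> = k\<close> the time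
    \<open>\<sigma>\<close> is at most \<open>d m k\<close>, so hypothesis \<open>W\<close> applies
    at that grid point; the atom itself is recognised from \<open>\<sigma>\<close> stopped at
    \<open>d m k\<close>.\<close>
  have atom: "(\<lambda>\<omega>. indicator {k} (\<kappa> m \<omega>) * W \<omega>) \<in> borel_measurable (F (d m k))" for m k
  proof -
    note [measurable] = \<sigma>F[OF d, of m k]
    have grid: "(\<lambda>\<omega>. grid_index m (min (\<sigma> \<omega>) (d m k))) \<in> measurable (F (d m k)) (count_space UNIV)"
      unfolding grid_index_def by measurable
    have *: "(\<lambda>\<omega>. indicator {k} (grid_index m (min (\<sigma> \<omega>) (d m k))) * (W \<omega> * indicator {\<omega>. \<sigma> \<omega> \<le> d m k} \<omega>))
        \<in> borel_measurable (F (d m k))"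
      by (intro borel_measurable_times_ennreal W d measurable_compose[OF grid]) simp
    show ?thesis
    proof (rule measurable_cong[THEN iffD1, OF _ *])
      fix \<omega> assume "\<omega> \<in> space (F (d m k))"
      then have b: "0 \<le> \<sigma> \<omega>" "\<sigma> \<omega> \<le> t" using \<sigma>_bounds sp[OF d(1)] by auto
      have "grid_index m (min (\<sigma> \<omega>) (d m k)) = k \<longleftrightarrow> \<kappa> m \<omega> = k"
        unfolding \<kappa>_def d_def by (rule grid_index_min[OF b])
      moreover have "\<sigma> \<omega> \<le> d m k" if "\<kappa> m \<omega> = k"
        using grid_point_ge[OF b, of m] that by (simp add: \<kappa>_def d_def)
      ultimately show "indicator {k} (grid_index m (min (\<sigma> \<omega>) (d m k))) * (W \<omega> * indicator {\<omega>. \<sigma> \<omega> \<le> d m k} \<omega>)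
          = indicator {k} (\<kappa> m \<omega>) * W \<omega>"
        by (auto simp: indicator_def)
    qed
  qed
  have NdM: "(\<lambda>\<omega>. ennreal (N \<omega> (d m k))) \<in> borel_measurable M" for m k
    using NM[OF d(1)] by measurable
  have NtM: "(\<lambda>\<omega>. ennreal (N \<omega> t)) \<in> borel_measurable M"
    using NM[OF t] by measurable
  have sampled[measurable]: "(\<lambda>\<omega>. N \<omega> (d m (\<kappa> m \<omega>))) \<in> borel_measurable M" for m
    by (rule measurable_compose_countable[OF NM[OF d(1)] \<kappa>])
  have sampledW: "(\<lambda>\<omega>. W \<omega> * ennreal (N \<omega> (d m (\<kappa> m \<omega>)))) \<in> borel_measurable M" for m
    by measurable
  have lim: "(\<lambda>m. W \<omega> * ennreal (N \<omega> (d m (\<kappa> m \<omega>)))) \<longlonglongrightarrow> W \<omega> * ennreal (N \<omega> (\<sigma> \<omega>))"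
    if "\<omega> \<in> space M" for \<omega>
    unfolding d_def \<kappa>_def using W_fin[of \<omega>] \<sigma>_bounds[OF that] rc[OF that]
    by (intro ennreal_tendsto_cmult tendsto_ennrealI tendsto_grid_point) (auto simp: less_top)
  have "(\<lambda>\<omega>. N \<omega> (\<sigma> \<omega>)) \<in> borel_measurable (F t)"
  proof (rule borel_measurable_at_time[OF t, where f=N and \<sigma>=\<sigma>])
    show "(\<lambda>\<omega>. N \<omega> u) \<in> borel_measurable (F t)" if "0 \<le> u" "u \<le> t" for u
      using NF[OF that(1)] measurable_filtration_mono[OF F that] by blast
  qed (use \<open>\<sigma> \<in> borel_measurable (F t)\<close> rc \<sigma>_bounds sp[OF t] in auto)
  then have [measurable]: "(\<lambda>\<omega>. N \<omega> (\<sigma> \<omega>)) \<in> borel_measurable M"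
    by (rule borel_measurable_filtration[OF F t])
  show ?thesis
  proof (rule antisym)
    have "(\<integral>\<^sup>+\<omega>. W \<omega> * ennreal (N \<omega> (d m (\<kappa> m \<omega>))) \<partial>M) = (\<integral>\<^sup>+\<omega>. W \<omega> * ennreal (N \<omega> t) \<partial>M)" for m
    proof -
      have "(\<integral>\<^sup>+\<omega>. W \<omega> * ennreal (N \<omega> (d m (\<kappa> m \<omega>))) \<partial>M)
          = (\<Sum>k. \<integral>\<^sup>+\<omega>. indicator {k} (\<kappa> m \<omega>) * (W \<omega> * ennreal (N \<omega> (d m k))) \<partial>M)"
        by (rule nn_integral_index[OF \<kappa>]) (intro borel_measurable_times_ennreal WM NdM)
      also have "\<dots> = (\<Sum>k. \<integral>\<^sup>+\<omega>. indicator {k} (\<kappa> m \<omega>) * (W \<omega> * ennreal (N \<omega> t)) \<partial>M)"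
        using mart[OF d atom] by (simp add: mult.assoc)
      also have "\<dots> = (\<integral>\<^sup>+\<omega>. W \<omega> * ennreal (N \<omega> t) \<partial>M)"
        by (rule nn_integral_index[OF \<kappa>, symmetric]) (intro borel_measurable_times_ennreal WM NtM)
      finally show ?thesis .
    qed
    then have sampled_eq: "(\<integral>\<^sup>+\<omega>. W \<omega> * ennreal (N \<omega> (d m (\<kappa> m \<omega>))) \<partial>M) \<le> (\<integral>\<^sup>+\<omega>. W \<omega> * ennreal (N \<omega> t) \<partial>M)" for m
      by (rule eq_refl)
    show "(\<integral>\<^sup>+\<omega>. W \<omega> * ennreal (N \<omega> (\<sigma> \<omega>)) \<partial>M) \<le> (\<integral>\<^sup>+\<omega>. W \<omega> * ennreal (N \<omega> t) \<partial>M)"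
      by (rule nn_integral_limit_le[OF sampledW AE_I2[OF lim] sampled_eq])
  next
    show "(\<integral>\<^sup>+\<omega>. W \<omega> * ennreal (N \<omega> t) \<partial>M) \<le> (\<integral>\<^sup>+\<omega>. W \<omega> * ennreal (N \<omega> (\<sigma> \<omega>)) \<partial>M)"
    proof (rule nn_integral_le_truncated)
      show "(\<lambda>\<omega>. W \<omega> * ennreal (N \<omega> t)) \<in> borel_measurable M"
        by (intro borel_measurable_times_ennreal WM NtM)
      fix K :: nat
      have "(\<integral>\<^sup>+\<omega>. min (of_nat K) (W \<omega> * ennreal (N \<omega> t)) \<partial>M)
          \<le> (\<integral>\<^sup>+\<omega>. min (of_nat K) (W \<omega> * ennreal (N \<omega> (d m (\<kappa> m \<omega>)))) \<partial>M)" for m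
      proof (rule nn_integral_index_le[OF \<kappa>])
        fix k
        show "(\<lambda>\<omega>. min (of_nat K) (W \<omega> * ennreal (N \<omega> t))) \<in> borel_measurable M"
          "(\<lambda>\<omega>. min (of_nat K) (W \<omega> * ennreal (N \<omega> (d m k)))) \<in> borel_measurable M"
          by (intro borel_measurable_min borel_measurable_const borel_measurable_times_ennreal WM NtM NdM)+
        \<comment> \<open>Truncation commutes with an indicator since \<open>min K 0 = 0\<close>.
          This moves the atom into the weight, where it is measurable at the grid point.\<close>
        have pull: "indicator {k} (\<kappa> m \<omega>) * min (of_nat K) (W \<omega> * x)
            = min (of_nat K) ((indicator {k} (\<kappa> m \<omega>) * W \<omega>) * x)" for \<omega> x
          by (auto simp: indicator_def)
        show "(\<integral>\<^sup>+\<omega>. indicator {k} (\<kappa> m \<omega>) * min (of_nat K) (W \<omega> * ennreal (N \<omega> t)) \<partial>M)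
            \<le> (\<integral>\<^sup>+\<omega>. indicator {k} (\<kappa> m \<omega>) * min (of_nat K) (W \<omega> * ennreal (N \<omega> (d m k))) \<partial>M)"
          unfolding pull
        proof (rule nn_integral_min_le[OF sub[OF d(1)]])
          show "(\<lambda>\<omega>. indicator {k} (\<kappa> m \<omega>) * W \<omega> * ennreal (N \<omega> t)) \<in> borel_measurable M"
            by (intro borel_measurable_times_ennreal NtM borel_measurable_filtration[OF F d(1) atom])
          show "(\<lambda>\<omega>. indicator {k} (\<kappa> m \<omega>) * W \<omega> * ennreal (N \<omega> (d m k))) \<in> borel_measurable (F (d m k))"
            using NF[OF d(1)] by (intro borel_measurable_times_ennreal atom) measurable
          fix D assume D: "D \<in> sets (F (d m k))"
          have "(\<lambda>\<omega>. indicator D \<omega> * (indicator {k} (\<kappa> m \<omega>) * W \<omega>)) \<in> borel_measurable (F (d m k))"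
            by (rule borel_measurable_times_ennreal[OF borel_measurable_indicator[OF D] atom])
          from mart[OF d this]
          show "(\<integral>\<^sup>+\<omega>. indicator D \<omega> * (indicator {k} (\<kappa> m \<omega>) * W \<omega> * ennreal (N \<omega> t)) \<partial>M)
             \<le> (\<integral>\<^sup>+\<omega>. indicator D \<omega> * (indicator {k} (\<kappa> m \<omega>) * W \<omega> * ennreal (N \<omega> (d m k))) \<partial>M)"
            by (simp add: mult.assoc)
        qed
      qed
      moreover have "(\<lambda>m. \<integral>\<^sup>+\<omega>. min (of_nat K) (W \<omega> * ennreal (N \<omega> (d m (\<kappa> m \<omega>)))) \<partial>M)
          \<longlonglongrightarrow> (\<integral>\<^sup>+\<omega>. min (of_nat K) (W \<omega> * ennreal (N \<omega> (\<sigma> \<omega>))) \<partial>M)"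
      proof (rule nn_integral_dominated_convergence[where w="\<lambda>_. of_nat K"])
        show "(\<lambda>\<omega>. min (of_nat K) (W \<omega> * ennreal (N \<omega> (d m (\<kappa> m \<omega>))))) \<in> borel_measurable M" for m
          by (intro borel_measurable_min borel_measurable_const sampledW)
        show "(\<lambda>\<omega>. min (of_nat K) (W \<omega> * ennreal (N \<omega> (\<sigma> \<omega>)))) \<in> borel_measurable M"
          by (intro borel_measurable_min borel_measurable_const) measurable
        show "AE \<omega> in M. (\<lambda>m. min (of_nat K) (W \<omega> * ennreal (N \<omega> (d m (\<kappa> m \<omega>)))))
            \<longlonglongrightarrow> min (of_nat K) (W \<omega> * ennreal (N \<omega> (\<sigma> \<omega>)))"
          by (intro AE_I2 tendsto_min tendsto_const lim)
      qed (auto simp: emeasure_space_1 of_nat_less_top)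
      ultimately have "(\<integral>\<^sup>+\<omega>. min (of_nat K) (W \<omega> * ennreal (N \<omega> t)) \<partial>M)
          \<le> (\<integral>\<^sup>+\<omega>. min (of_nat K) (W \<omega> * ennreal (N \<omega> (\<sigma> \<omega>))) \<partial>M)"
        by (intro LIMSEQ_le_const) auto
      also have "\<dots> \<le> (\<integral>\<^sup>+\<omega>. W \<omega> * ennreal (N \<omega> (\<sigma> \<omega>)) \<partial>M)"
        by (intro nn_integral_mono) simp
      finally show "(\<integral>\<^sup>+\<omega>. min (of_nat K) (W \<omega> * ennreal (N \<omega> t)) \<partial>M)
          \<le> (\<integral>\<^sup>+\<omega>. W \<omega> * ennreal (N \<omega> (\<sigma> \<omega>)) \<partial>M)" .
    qed
  qed
qed

text \<open>\<open>N \<omega> s\<close> is a version of the nonnegative conditional expectation of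
  \<open>N \<omega> t\<close>, identified by set integrals. In that form every nonnegative weight
  measurable at \<open>s\<close> is admissible, even if the products have infinite integral.\<close>

lemma martingale_nn_integral:
  assumes "prob_space M" and N: "martingale M F N"
    and nonneg: "\<And>\<omega> u. \<omega> \<in> space M \<Longrightarrow> 0 \<le> u \<Longrightarrow> 0 \<le> N \<omega> u"
    and s: "0 \<le> s" "s \<le> t" and W: "W \<in> borel_measurable (F s)"
  shows "(\<integral>\<^sup>+\<omega>. W \<omega> * ennreal (N \<omega> t) \<partial>M) = (\<integral>\<^sup>+\<omega>. W \<omega> * ennreal (N \<omega> s) \<partial>M)"
proof -
  interpret prob_space M by fact
  have sub: "subalgebra M (F s)"
    using N s by (auto simp: martingale_def filtration_on_def)
  interpret finite_measure_subalgebra M "F s" by unfold_locales (rule sub)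
  have int: "integrable M (\<lambda>\<omega>. N \<omega> u)" if "0 \<le> u" for u
    using N that by (simp add: martingale_def)
  have [measurable]: "(\<lambda>\<omega>. N \<omega> s) \<in> borel_measurable (F s)"
    using N s by (simp add: martingale_def adapted_def)
  have ce: "AE \<omega> in M. real_cond_exp M (F s) (\<lambda>\<omega>. N \<omega> t) \<omega> = N \<omega> s"
    using N s by (simp add: martingale_def)
  have t: "0 \<le> t" using s by simp
  have set_int: "(\<integral>\<^sup>+\<omega>\<in>A. ennreal (N \<omega> u) \<partial>M) = ennreal (\<integral>\<omega>\<in>A. N \<omega> u \<partial>M)"
    if "A \<in> sets M" "0 \<le> u" for A u
  proof -
    have "(\<integral>\<^sup>+\<omega>\<in>A. ennreal (N \<omega> u) \<partial>M) = (\<integral>\<^sup>+\<omega>. ennreal (indicator A \<omega> *\<^sub>R N \<omega> u) \<partial>M)"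
      by (intro nn_integral_cong) (auto simp: indicator_def)
    also have "\<dots> = ennreal (\<integral>\<omega>\<in>A. N \<omega> u \<partial>M)"
      unfolding set_lebesgue_integral_def using that nonneg
      by (intro nn_integral_eq_integral integrable_mult_indicator int AE_I2) auto
    finally show ?thesis .
  qed
  have "AE \<omega> in M. ennreal (N \<omega> s) = nn_cond_exp M (F s) (\<lambda>\<omega>. ennreal (N \<omega> t)) \<omega>"
  proof (rule nn_cond_exp_charact)
    fix A assume A: "A \<in> sets (F s)"
    then have AM: "A \<in> sets M" using sub by (auto simp: subalgebra_def)
    have "(\<integral>\<omega>\<in>A. N \<omega> t \<partial>M) = (\<integral>\<omega>\<in>A. real_cond_exp M (F s) (\<lambda>\<omega>. N \<omega> t) \<omega> \<partial>M)"
      using int[OF t] A by (rule real_cond_exp_intA)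
    also have "\<dots> = (\<integral>\<omega>\<in>A. N \<omega> s \<partial>M)"
      using ce AM int[OF s(1)] by (intro set_lebesgue_integral_cong_AE) auto
    finally show "(\<integral>\<^sup>+\<omega>\<in>A. ennreal (N \<omega> t) \<partial>M) = (\<integral>\<^sup>+\<omega>\<in>A. ennreal (N \<omega> s) \<partial>M)"
      using AM s t by (simp add: set_int)
  qed (use int[OF t] in auto)
  then have "(\<integral>\<^sup>+\<omega>. W \<omega> * ennreal (N \<omega> s) \<partial>M)
      = (\<integral>\<^sup>+\<omega>. W \<omega> * nn_cond_exp M (F s) (\<lambda>\<omega>. ennreal (N \<omega> t)) \<omega> \<partial>M)"
    by (intro nn_integral_cong_AE) auto
  also have "\<dots> = (\<integral>\<^sup>+\<omega>. W \<omega> * ennreal (N \<omega> t) \<partial>M)"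
    using int[OF t] by (intro nn_cond_exp_intg W) auto
  finally show ?thesis by simp
qed

lemma nonneg_supermartingale_nn_integral:
  assumes "prob_space M" and N: "nonneg_supermartingale M F N"
    and s: "0 \<le> s" "s \<le> t" and W: "W \<in> borel_measurable (F s)"
  shows "(\<integral>\<^sup>+\<omega>. W \<omega> * ennreal (N \<omega> t) \<partial>M) \<le> (\<integral>\<^sup>+\<omega>. W \<omega> * ennreal (N \<omega> s) \<partial>M)"
proof -
  interpret prob_space M by fact
  have sub: "subalgebra M (F s)" and subt: "subalgebra M (F t)"
    using N s by (auto simp: nonneg_supermartingale_def filtration_on_def)
  interpret finite_measure_subalgebra M "F s" by unfold_locales (rule sub)
  have "(\<lambda>\<omega>. N \<omega> t) \<in> borel_measurable (F t)"
    using N s by (simp add: nonneg_supermartingale_def adapted_def)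
  then have [measurable]: "(\<lambda>\<omega>. N \<omega> t) \<in> borel_measurable M"
    using subt by (rule measurable_from_subalg[rotated])
  have "(\<integral>\<^sup>+\<omega>. W \<omega> * ennreal (N \<omega> t) \<partial>M)
      = (\<integral>\<^sup>+\<omega>. W \<omega> * nn_cond_exp M (F s) (\<lambda>\<omega>. ennreal (N \<omega> t)) \<omega> \<partial>M)"
    by (intro nn_cond_exp_intg[symmetric] W) auto
  also have "\<dots> \<le> (\<integral>\<^sup>+\<omega>. W \<omega> * ennreal (N \<omega> s) \<partial>M)"
  proof (rule nn_integral_mono_AE)
    have "AE \<omega> in M. nn_cond_exp M (F s) (\<lambda>\<omega>. ennreal (N \<omega> t)) \<omega> \<le> ennreal (N \<omega> s)"
      using N s by (simp add: nonneg_supermartingale_def)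
    then show "AE \<omega> in M. W \<omega> * nn_cond_exp M (F s) (\<lambda>\<omega>. ennreal (N \<omega> t)) \<omega> \<le> W \<omega> * ennreal (N \<omega> s)"
      by eventually_elim (rule mult_left_mono, simp_all)
  qed
  finally show ?thesis .
qed

section \<open>Hitting times and stopped paths\<close>

definition hitting_time :: "(real \<Rightarrow> bool) \<Rightarrow> ennreal" where
  "hitting_time P = (INF t\<in>{t. 0 \<le> t \<and> P t}. ennreal t)"

text \<open>Since \<open>P\<close> persists to the right of each of its points, a hit before
  \<open>u\<close> can be moved to a rational one. This takes the place of a debut theorem: the
  strict event becomes a countable union.\<close>

lemma hitting_time_less_iff:
  assumes P: "\<And>s. 0 \<le> s \<Longrightarrow> P s \<Longrightarrow> eventually P (at_right s)" and u: "0 \<le> u"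
  shows "hitting_time P < ennreal u \<longleftrightarrow> (\<exists>q\<in>\<rat>. 0 \<le> q \<and> q < u \<and> P q)"
proof
  assume "hitting_time P < ennreal u"
  then obtain s where s: "0 \<le> s" "P s" "s < u"
    by (auto simp: hitting_time_def INF_less_iff ennreal_less_iff)
  then obtain b where b: "b > s" "\<And>v. s < v \<Longrightarrow> v < b \<Longrightarrow> P v"
    using P[OF s(1,2)] by (auto simp: eventually_at_right[OF s(3)])
  obtain q where "q \<in> \<rat>" "s < q" "q < min b u"
    using Rats_dense_in_real[of s "min b u"] b s by auto
  with b s show "\<exists>q\<in>\<rat>. 0 \<le> q \<and> q < u \<and> P q" by (intro bexI[of _ q]) auto
next
  assume "\<exists>q\<in>\<rat>. 0 \<le> q \<and> q < u \<and> P q"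
  then obtain q where q: "0 \<le> q" "q < u" "P q" by blast
  then have "hitting_time P \<le> ennreal q"
    unfolding hitting_time_def by (intro INF_lower) simp
  also have "\<dots> < ennreal u" using q by (simp add: ennreal_less_iff)
  finally show "hitting_time P < ennreal u" .
qed

lemma not_before_hitting_time: "0 \<le> s \<Longrightarrow> ennreal s < hitting_time P \<Longrightarrow> \<not> P s"
  using INF_lower[of s "{t. 0 \<le> t \<and> P t}" ennreal] by (auto simp: hitting_time_def)

lemma hitting_time_geI: "(\<And>u. 0 \<le> u \<Longrightarrow> P u \<Longrightarrow> ennreal u \<ge> c) \<Longrightarrow> c \<le> hitting_time P"
  unfolding hitting_time_def by (rule INF_greatest) simp

text \<open>If \<open>P\<close> also failed on an interval after \<open>s\<close>, the infimum would
  be at least the right end of that interval. It serves to bound \<open>p\<close> at the time it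
  falls below a level.\<close>

lemma at_hitting_time:
  assumes s: "0 \<le> s" and hit: "hitting_time P = ennreal s" and "\<not> P s"
  shows "\<not> eventually (\<lambda>u. \<not> P u) (at_right s)"
proof
  assume "eventually (\<lambda>u. \<not> P u) (at_right s)"
  then obtain b where b: "b > s" "\<And>v. s < v \<Longrightarrow> v < b \<Longrightarrow> \<not> P v"
    by (auto simp: eventually_at_right[of s "s + 1"])
  have "ennreal b \<le> hitting_time P"
  proof (rule hitting_time_geI, rule ennreal_leI)
    fix u assume u: "0 \<le> u" "P u"
    then have "\<not> u < s"
      using not_before_hitting_time[of u P] hit by (auto simp: ennreal_less_iff)
    then show "b \<le> u"
      using b u \<open>\<not> P s\<close> by (metis linorder_not_le linorder_neqE_linordered_idom)
  qed
  then show False using hit b s by simp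
qed

lemma first_zero_eq_hitting_time: "first_zero f = hitting_time (\<lambda>t. f t = 0)"
  by (simp add: first_zero_def hitting_time_def)

text \<open>The evaluation time inside \<open>stopped\<close>, as a real number: \<open>T\<close>
  cut off at \<open>t\<close>. Being real and bounded, it is a time to which the grid approximation
  and optional sampling apply.\<close>

definition capped :: "ennreal \<Rightarrow> real \<Rightarrow> real" where
  "capped T t = enn2real (min (ennreal t) T)"

lemma stopped_eq: "stopped X T \<omega> t = X \<omega> (capped (T \<omega>) t)"
  by (simp add: stopped_def capped_def)

lemma capped_top: "0 \<le> t \<Longrightarrow> capped top t = t"
  by (simp add: capped_def)

lemma capped_ennreal: "0 \<le> r \<Longrightarrow> 0 \<le> t \<Longrightarrow> capped (ennreal r) t = min t r"
  by (simp add: capped_def min_def)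

lemma capped_bounds: "0 \<le> t \<Longrightarrow> 0 \<le> capped T t \<and> capped T t \<le> t"
  by (cases T) (auto simp: capped_top capped_ennreal)

lemma capped_eq: "0 \<le> t \<Longrightarrow> ennreal t \<le> T \<Longrightarrow> capped T t = t"
  by (cases T) (auto simp: capped_top capped_ennreal)

lemma ennreal_capped: "0 \<le> t \<Longrightarrow> T \<le> ennreal t \<Longrightarrow> ennreal (capped T t) = T"
  by (cases T) (auto simp: capped_top capped_ennreal min_def top_unique)

lemma capped_stops: "0 \<le> s \<Longrightarrow> s \<le> t \<Longrightarrow> T \<le> ennreal s \<Longrightarrow> capped T t = capped T s"
  by (cases T) (auto simp: capped_top capped_ennreal min_def top_unique)

lemma capped_less_iff: "0 \<le> u \<Longrightarrow> u \<le> t \<Longrightarrow> capped T t < u \<longleftrightarrow> T < ennreal u"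
  by (cases T) (auto simp: capped_top capped_ennreal min_less_iff_disj ennreal_less_iff)

text \<open>Here \<open>u < t\<close> has to be strict, as the left side always holds at
  \<open>u = t\<close>. For the strict comparison in \<open>capped_less_iff\<close> the value
  \<open>u = t\<close> is harmless.\<close>

lemma capped_le_iff: "0 \<le> u \<Longrightarrow> u < t \<Longrightarrow> capped T t \<le> u \<longleftrightarrow> T \<le> ennreal u"
  by (cases T) (auto simp: capped_top capped_ennreal min_le_iff_disj top_unique)

text \<open>Just to the right of \<open>u\<close> the stopped path is \<open>f\<close> itself if
  \<open>u\<close> lies before \<open>T\<close>, and constant otherwise.\<close>

lemma right_continuous_stopped_path:
  assumes f: "\<And>u. 0 \<le> u \<Longrightarrow> continuous (at_right u) f" and u: "0 \<le> u"
  shows "continuous (at_right u) (\<lambda>v. f (capped T v))"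
proof (cases "ennreal u < T")
  case True
  then obtain b where b: "u < b" "ennreal b \<le> T"
  proof (cases T)
    case (real r)
    with True u show ?thesis by (intro that[of r]) (auto simp: ennreal_less_iff)
  next
    case top
    then show ?thesis by (intro that[of "u + 1"]) auto
  qed
  have "eventually (\<lambda>v. f (capped T v) = f v) (at_right u)"
    unfolding eventually_at_right[OF b(1)]
  proof (intro exI conjI impI allI)
    fix v assume "u < v" "v < b"
    then show "f (capped T v) = f v"
      using u b by (subst capped_eq) (auto intro: order_trans[OF ennreal_leI[of v b]])
  qed (use b in auto)
  moreover have "f (capped T u) = f u" using True u by (subst capped_eq) auto
  moreover have "(f \<longlongrightarrow> f u) (at_right u)" using f[OF u] by (simp add: continuous_within)
  ultimately show ?thesis
    by (simp add: continuous_within tendsto_cong)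
next
  case False
  then have "f (capped T v) = f (capped T u)" if "u < v" for v
    using that u capped_stops[of u v T] by simp
  then have "eventually (\<lambda>v. f (capped T v) = f (capped T u)) (at_right u)"
    by (auto simp: eventually_at_right[of u "u + 1"] intro!: exI[of _ "u + 1"])
  then show ?thesis
    by (simp add: continuous_within tendsto_cong)
qed

section \<open>Stopped local martingales\<close>

lemma capped_stopping_time:
  assumes F: "filtration_on M F" and T: "extended_stopping_time M F T" and u: "0 \<le> u" "u \<le> t"
  shows "{\<omega> \<in> space M. capped (T \<omega>) t \<le> u} \<in> sets (F u)"
proof (cases "u < t")
  case True
  then show ?thesis
    using T u by (simp add: capped_le_iff extended_stopping_time_def)
next
  case False
  then have "{\<omega> \<in> space M. capped (T \<omega>) t \<le> u} = space (F u)"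
    using u capped_bounds[of t] space_filtration[OF F, of u] by auto
  then show ?thesis by simp
qed

lemma stopping_time_after_sets:
  assumes F: "filtration_on M F" and T: "extended_stopping_time M F T" and s: "0 \<le> s"
  shows "{\<omega> \<in> space M. ennreal s < T \<omega>} \<in> sets (F s)"
proof -
  have "{\<omega> \<in> space M. ennreal s < T \<omega>} = space (F s) - {\<omega> \<in> space M. T \<omega> \<le> ennreal s}"
    using space_filtration[OF F s] by auto
  then show ?thesis
    using T s by (auto simp: extended_stopping_time_def)
qed

text \<open>The hypothesis is about the strict events \<open>T < u\<close>, because these are what
  hitting times supply in the product with the parameter space.\<close>

lemma capped_borel_measurable:
  assumes less: "\<And>u. 0 \<le> u \<Longrightarrow> u \<le> t \<Longrightarrow> {\<omega> \<in> space A. T \<omega> < ennreal u} \<in> sets A" and t: "0 \<le> t"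
  shows "(\<lambda>\<omega>. capped (T \<omega>) t) \<in> borel_measurable A"
proof (rule borel_measurableI_less)
  fix y
  consider "y < 0" | "0 \<le> y" "y \<le> t" | "t < y" by linarith
  then show "{\<omega> \<in> space A. capped (T \<omega>) t < y} \<in> sets A"
  proof cases
    case 1
    have "\<not> capped (T \<omega>) t < y" for \<omega>
      using capped_bounds[OF t, of "T \<omega>"] 1 by linarith
    then have "{\<omega> \<in> space A. capped (T \<omega>) t < y} = {}"
      by simp
    then show ?thesis by (simp only: sets.empty_sets)
  next
    case 2
    then show ?thesis using less by (simp add: capped_less_iff)
  next
    case 3
    have "capped (T \<omega>) t < y" for \<omega>
      using capped_bounds[OF t, of "T \<omega>"] 3 by linarith
    then have "{\<omega> \<in> space A. capped (T \<omega>) t < y} = space A"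
      by simp
    then show ?thesis by simp
  qed
qed

lemma stopping_time_capped_measurable:
  assumes F: "filtration_on M F" and T: "extended_stopping_time M F T" and t: "0 \<le> t"
  shows "(\<lambda>\<omega>. capped (T \<omega>) t) \<in> borel_measurable (F t)"
proof (rule borel_measurableI_le)
  fix y
  consider "y < 0" | "0 \<le> y" "y \<le> t" | "t < y" by linarith
  then show "{\<omega> \<in> space (F t). capped (T \<omega>) t \<le> y} \<in> sets (F t)"
  proof cases
    case 1
    have "\<not> capped (T \<omega>) t \<le> y" for \<omega>
      using capped_bounds[OF t, of "T \<omega>"] 1 by linarith
    then have "{\<omega> \<in> space (F t). capped (T \<omega>) t \<le> y} = {}"
      by simp
    then show ?thesis by (simp only: sets.empty_sets)
  next
    case 2
    then show ?thesis
      using capped_stopping_time[OF F T 2] sets_filtration_mono[OF F 2] space_filtration[OF F t] by auto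
  next
    case 3
    have "capped (T \<omega>) t \<le> y" for \<omega>
      using capped_bounds[OF t, of "T \<omega>"] 3 by linarith
    then have "{\<omega> \<in> space (F t). capped (T \<omega>) t \<le> y} = space (F t)"
      by simp
    then show ?thesis by simp
  qed
qed

lemma stopped_measurable:
  assumes F: "filtration_on M F" and X: "adapted F X"
    and rc: "\<And>\<omega> u. \<omega> \<in> space M \<Longrightarrow> 0 \<le> u \<Longrightarrow> continuous (at_right u) (X \<omega>)"
    and T: "extended_stopping_time M F T" and t: "0 \<le> t"
  shows "(\<lambda>\<omega>. X \<omega> (capped (T \<omega>) t)) \<in> borel_measurable (F t)"
proof (rule borel_measurable_at_time[OF t, where f=X])
  show "(\<lambda>\<omega>. X \<omega> u) \<in> borel_measurable (F t)" if "0 \<le> u" "u \<le> t" for u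
    using X that measurable_filtration_mono[OF F that] by (auto simp: adapted_def)
qed (use rc stopping_time_capped_measurable[OF F T t] capped_bounds[OF t] space_filtration[OF F t] in auto)

text \<open>This is the measurability that \<open>optional_sampling\<close> asks of a weight. For
  \<open>u > s\<close> the value at the capped time may be read at cap \<open>u\<close> instead of
  \<open>t\<close>. For \<open>u \<le> s\<close> the weight is zero: a capped time at most
  \<open>u\<close> means \<open>T \<le> s\<close>, which \<open>C\<close> excludes.\<close>

lemma stopped_weight_measurable:
  fixes X :: "'a process"
  assumes F: "filtration_on M F" and X: "adapted F X"
    and rc: "\<And>\<omega> u. \<omega> \<in> space M \<Longrightarrow> 0 \<le> u \<Longrightarrow> continuous (at_right u) (X \<omega>)"
    and T: "extended_stopping_time M F T" and s: "0 \<le> s" "s < t" and C: "C \<in> sets (F s)"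
    and C_after: "\<And>\<omega>. \<omega> \<in> C \<Longrightarrow> ennreal s < T \<omega>" and u: "0 \<le> u" "u \<le> t"
  shows "(\<lambda>\<omega>. indicator C \<omega> * X \<omega> (capped (T \<omega>) t) * indicator {\<omega>. capped (T \<omega>) t \<le> u} \<omega>)
    \<in> borel_measurable (F u)"
proof (cases "s < u")
  case True
  have [measurable]: "(\<lambda>\<omega>. X \<omega> (capped (T \<omega>) u)) \<in> borel_measurable (F u)"
    using F X rc T u(1) by (rule stopped_measurable)
  have [measurable]: "C \<in> sets (F u)"
    using C sets_filtration_mono[OF F s(1), of u] True by auto
  have [measurable]: "{\<omega> \<in> space (F u). capped (T \<omega>) t \<le> u} \<in> sets (F u)"
    using capped_stopping_time[OF F T u] space_filtration[OF F u(1)] by simp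
  have "(\<lambda>\<omega>. indicator C \<omega> * X \<omega> (capped (T \<omega>) u) * indicator {\<omega> \<in> space (F u). capped (T \<omega>) t \<le> u} \<omega>)
    \<in> borel_measurable (F u)" by measurable
  then show ?thesis
  proof (rule measurable_cong[THEN iffD1, rotated])
    fix \<omega> assume "\<omega> \<in> space (F u)"
    moreover have "capped (T \<omega>) u = capped (T \<omega>) t" if "capped (T \<omega>) t \<le> u"
    proof (cases "u = t")
      case False
      then have "T \<omega> \<le> ennreal u" using that u by (simp add: capped_le_iff)
      then show ?thesis using capped_stops[of u t "T \<omega>"] u by simp
    qed simp
    ultimately show "indicator C \<omega> * X \<omega> (capped (T \<omega>) u) * indicator {\<omega> \<in> space (F u). capped (T \<omega>) t \<le> u} \<omega>
       = indicator C \<omega> * X \<omega> (capped (T \<omega>) t) * indicator {\<omega>. capped (T \<omega>) t \<le> u} \<omega>"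
      by (auto simp: indicator_def)
  qed
next
  case False
  have "indicator C \<omega> * X \<omega> (capped (T \<omega>) t) * indicator {\<omega>. capped (T \<omega>) t \<le> u} \<omega> = 0" for \<omega>
  proof (cases "\<omega> \<in> C \<and> capped (T \<omega>) t \<le> u")
    case True
    then have "T \<omega> \<le> ennreal u"
      using False s u by (simp add: capped_le_iff)
    also have "\<dots> \<le> ennreal s" using False by (simp add: ennreal_leI)
    finally show ?thesis using C_after[of \<omega>] True by auto
  qed (auto simp: indicator_def)
  then show ?thesis by (simp only: borel_measurable_const)
qed

text \<open>The localized processes are martingales and can be sampled at the capped time; the work
  is in removing the localization. Before \<open>T\<close> everything is at most \<open>c\<close>,
  but at \<open>T\<close> the value may have jumped, so its integrability has to be won from Fatou's
  lemma before dominated convergence is possible.\<close>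

lemma local_martingale_sampling:
  fixes X :: "'a process"
  assumes "prob_space M" and X: "local_martingale M F X"
    and nonneg: "\<And>\<omega> u. \<omega> \<in> space M \<Longrightarrow> 0 \<le> u \<Longrightarrow> 0 \<le> X \<omega> u"
    and rc: "\<And>\<omega> u. \<omega> \<in> space M \<Longrightarrow> 0 \<le> u \<Longrightarrow> continuous (at_right u) (X \<omega>)"
    and T: "extended_stopping_time M F T"
    and bound: "\<And>\<omega> u. \<omega> \<in> space M \<Longrightarrow> 0 \<le> u \<Longrightarrow> ennreal u < T \<omega> \<Longrightarrow> X \<omega> u \<le> c"
    and s: "0 \<le> s" "s < t" and C: "C \<in> sets (F s)"
    and C_after: "\<And>\<omega>. \<omega> \<in> C \<Longrightarrow> ennreal s < T \<omega>"
  shows "(\<integral>\<^sup>+\<omega>. indicator C \<omega> * ennreal (X \<omega> (capped (T \<omega>) t)) \<partial>M)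
    = (\<integral>\<^sup>+\<omega>. indicator C \<omega> * ennreal (X \<omega> s) \<partial>M)"
proof -
  interpret prob_space M by fact
  have F: "filtration_on M F" and Xad: "adapted F X"
    using X by (auto simp: local_martingale_def)
  obtain S where S: "\<And>n. extended_stopping_time M F (S n)"
      "AE \<omega> in M. incseq (\<lambda>n. S n \<omega>) \<and> (\<lambda>n. S n \<omega>) \<longlonglongrightarrow> \<infinity>"
      "\<And>n. martingale M F (\<lambda>\<omega> t. if 0 < S n \<omega> then stopped X (S n) \<omega> t else 0)"
    using X unfolding local_martingale_def by blast
  define N where "N = (\<lambda>n \<omega> u. if 0 < S n \<omega> then X \<omega> (capped (S n \<omega>) u) else 0)"
  have N: "martingale M F (N n)" for n
    using S(3)[of n] by (simp add: N_def stopped_eq[abs_def] cong: if_cong)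
  then have Nad: "adapted F (N n)" for n
    by (simp add: martingale_def)
  have N_nonneg: "0 \<le> N n \<omega> u" if "\<omega> \<in> space M" "0 \<le> u" for n \<omega> u
    using that nonneg capped_bounds by (simp add: N_def)
  have N_rc: "continuous (at_right u) (N n \<omega>)" if "\<omega> \<in> space M" "0 \<le> u" for n \<omega> u
    unfolding N_def using right_continuous_stopped_path[OF rc] that by (cases "0 < S n \<omega>") auto
  have t: "0 \<le> t" using s by simp
  let ?\<sigma> = "\<lambda>\<omega>. capped (T \<omega>) t"
  note \<sigma> = capped_bounds[OF t]
  \<comment> \<open>With the constant process, \<open>stopped_weight_measurable\<close> yields the
    bare indicator of \<open>C\<close> as weight.\<close>
  have one: "adapted F (\<lambda>_ _. 1)" by (simp add: adapted_def)
  have Ceq: "(\<integral>\<^sup>+\<omega>. indicator C \<omega> * ennreal (N n \<omega> (?\<sigma> \<omega>)) \<partial>M)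
      = (\<integral>\<^sup>+\<omega>. indicator C \<omega> * ennreal (N n \<omega> s) \<partial>M)" for n
  proof -
    have "(\<integral>\<^sup>+\<omega>. indicator C \<omega> * ennreal (N n \<omega> t) \<partial>M)
        = (\<integral>\<^sup>+\<omega>. indicator C \<omega> * ennreal (N n \<omega> (?\<sigma> \<omega>)) \<partial>M)"
    proof (rule optional_sampling[OF \<open>prob_space M\<close> F Nad N_rc _ t])
      show "(\<integral>\<^sup>+\<omega>. V \<omega> * ennreal (N n \<omega> v) \<partial>M) = (\<integral>\<^sup>+\<omega>. V \<omega> * ennreal (N n \<omega> r) \<partial>M)"
        if "0 \<le> r" "r \<le> v" "V \<in> borel_measurable (F r)" for r v V
        using \<open>prob_space M\<close> N N_nonneg that by (rule martingale_nn_integral)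
      fix u assume u: "0 \<le> u" "u \<le> t"
      show "{\<omega> \<in> space M. ?\<sigma> \<omega> \<le> u} \<in> sets (F u)"
        using F T u by (rule capped_stopping_time)
      have "(\<lambda>\<omega>. indicator C \<omega> * 1 * indicator {\<omega>. ?\<sigma> \<omega> \<le> u} \<omega> :: real) \<in> borel_measurable (F u)"
        by (rule stopped_weight_measurable[OF F one _ T s C C_after u]) auto
      then have "(\<lambda>\<omega>. ennreal (indicator C \<omega> * 1 * indicator {\<omega>. ?\<sigma> \<omega> \<le> u} \<omega>)) \<in> borel_measurable (F u)"
        by measurable
      then show "(\<lambda>\<omega>. indicator C \<omega> * indicator {\<omega>. ?\<sigma> \<omega> \<le> u} \<omega> :: ennreal) \<in> borel_measurable (F u)"
        by (rule measurable_cong[THEN iffD1, rotated]) (auto simp: indicator_def)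
    qed (use \<sigma> in \<open>auto simp: indicator_def\<close>)
    moreover have "(\<integral>\<^sup>+\<omega>. indicator C \<omega> * ennreal (N n \<omega> t) \<partial>M)
        = (\<integral>\<^sup>+\<omega>. indicator C \<omega> * ennreal (N n \<omega> s) \<partial>M)"
      using s C by (intro martingale_nn_integral[OF \<open>prob_space M\<close> N N_nonneg]) auto
    ultimately show ?thesis by simp
  qed
  have CM[measurable]: "C \<in> sets M"
    using C F s by (auto simp: filtration_on_def subalgebra_def)
  have Xs[measurable]: "(\<lambda>\<omega>. X \<omega> u) \<in> borel_measurable M" if "0 \<le> u" for u
    using Xad that by (intro borel_measurable_filtration[OF F that]) (simp add: adapted_def)
  have Ns: "(\<lambda>\<omega>. N n \<omega> u) \<in> borel_measurable M" if "0 \<le> u" for u n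
    using Nad[of n] that by (intro borel_measurable_filtration[OF F that]) (simp add: adapted_def)
  have [measurable]: "(\<lambda>\<omega>. X \<omega> (?\<sigma> \<omega>)) \<in> borel_measurable M"
    by (rule borel_measurable_filtration[OF F t stopped_measurable[OF F Xad rc T t]])
  have [measurable]: "(\<lambda>\<omega>. N n \<omega> (?\<sigma> \<omega>)) \<in> borel_measurable M" for n
    by (rule borel_measurable_filtration[OF F t stopped_measurable[OF F Nad N_rc T t]])
  \<comment> \<open>Once \<open>S n\<close> has passed \<open>t\<close>, the localized process
    agrees with \<open>X\<close> on all of \<open>[0, t]\<close>, hence also at any random time
    there.\<close>
  have ev: "AE \<omega> in M. eventually (\<lambda>n. \<forall>u. 0 \<le> u \<longrightarrow> u \<le> t \<longrightarrow> N n \<omega> u = X \<omega> u) sequentially"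
    using S(2)
  proof eventually_elim
    case (elim \<omega>)
    then have "eventually (\<lambda>n. ennreal t < S n \<omega>) sequentially"
      by (auto intro: order_tendstoD)
    then show ?case
    proof eventually_elim
      case (elim n)
      then have "0 < S n \<omega>" by (meson le_less_trans zero_le)
      moreover have "capped (S n \<omega>) u = u" if "0 \<le> u" "u \<le> t" for u
        using that elim by (intro capped_eq) (auto intro: order_trans[OF ennreal_leI[of u t]] less_imp_le)
      ultimately show ?case by (simp add: N_def)
    qed
  qed
  have lim_s: "AE \<omega> in M. (\<lambda>n. indicator C \<omega> * ennreal (N n \<omega> s)) \<longlonglongrightarrow> indicator C \<omega> * ennreal (X \<omega> s)"
    using ev
  proof eventually_elim
    case (elim \<omega>)
    show ?case
      by (rule tendsto_eventually, use elim in eventually_elim) (use s in auto)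
  qed
  have lim_t: "AE \<omega> in M. (\<lambda>n. indicator C \<omega> * ennreal (N n \<omega> (?\<sigma> \<omega>))) \<longlonglongrightarrow> indicator C \<omega> * ennreal (X \<omega> (?\<sigma> \<omega>))"
    using ev
  proof eventually_elim
    case (elim \<omega>)
    show ?case
      by (rule tendsto_eventually, use elim in eventually_elim) (use \<sigma> in auto)
  qed
  have Csub: "\<omega> \<in> space M" if "\<omega> \<in> C" for \<omega>
    using that sets.sets_into_space[OF CM] by auto
  have Nle: "indicator C \<omega> * ennreal (N n \<omega> u) \<le> ennreal c" if "0 \<le> u" "ennreal u < T \<omega>" for u n \<omega>
  proof (cases "\<omega> \<in> C")
    case True
    have "ennreal (capped (S n \<omega>) u) < T \<omega>"
      using capped_bounds[OF that(1), of "S n \<omega>"] that(2) by (meson ennreal_leI le_less_trans)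
    then have "X \<omega> (capped (S n \<omega>) u) \<le> c"
      using bound[OF Csub[OF True]] capped_bounds[OF that(1)] by auto
    then show ?thesis using True by (simp add: N_def ennreal_leI)
  qed simp
  have Nle_s: "indicator C \<omega> * ennreal (N n \<omega> s) \<le> ennreal c" for n \<omega>
    using Nle[of s \<omega> n] s C_after[of \<omega>] by (cases "\<omega> \<in> C") auto
  have int_s: "(\<integral>\<^sup>+\<omega>. indicator C \<omega> * ennreal (N n \<omega> s) \<partial>M) \<le> ennreal c" for n
  proof -
    have "(\<integral>\<^sup>+\<omega>. indicator C \<omega> * ennreal (N n \<omega> s) \<partial>M) \<le> (\<integral>\<^sup>+\<omega>. ennreal c \<partial>M)"
      by (intro nn_integral_mono Nle_s)
    then show ?thesis by (simp add: emeasure_space_1)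
  qed
  \<comment> \<open>The sampled integrals equal those at time \<open>s\<close>, where
    \<open>c\<close> is a bound because \<open>s\<close> lies before \<open>T\<close> on
    \<open>C\<close>.\<close>
  have fin: "(\<integral>\<^sup>+\<omega>. indicator C \<omega> * ennreal (X \<omega> (?\<sigma> \<omega>)) \<partial>M) \<le> ennreal c"
    by (rule nn_integral_limit_le[OF _ lim_t]) (auto simp: Ceq int_s)
  have "(\<lambda>n. \<integral>\<^sup>+\<omega>. indicator C \<omega> * ennreal (N n \<omega> s) \<partial>M) \<longlonglongrightarrow> (\<integral>\<^sup>+\<omega>. indicator C \<omega> * ennreal (X \<omega> s) \<partial>M)"
    using lim_s Nle_s Ns[OF s(1)] Xs[OF s(1)]
    by (intro nn_integral_dominated_convergence[where w="\<lambda>_. ennreal c"])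
       (auto simp: emeasure_space_1)
  moreover have "(\<lambda>n. \<integral>\<^sup>+\<omega>. indicator C \<omega> * ennreal (N n \<omega> (?\<sigma> \<omega>)) \<partial>M)
      \<longlonglongrightarrow> (\<integral>\<^sup>+\<omega>. indicator C \<omega> * ennreal (X \<omega> (?\<sigma> \<omega>)) \<partial>M)"
  \<comment> \<open>The localized process, where it is not zero, evaluates \<open>X\<close> either
    before \<open>T\<close>, giving at most \<open>c\<close>, or exactly at
    \<open>?\<sigma> \<omega>\<close>; the sum covers both cases.\<close>
  proof (rule nn_integral_dominated_convergence[where w="\<lambda>\<omega>. ennreal c + indicator C \<omega> * ennreal (X \<omega> (?\<sigma> \<omega>))"])
    have "(\<integral>\<^sup>+\<omega>. ennreal c + indicator C \<omega> * ennreal (X \<omega> (?\<sigma> \<omega>)) \<partial>M) \<le> ennreal c + ennreal c"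
      using fin by (subst nn_integral_add) (auto simp: emeasure_space_1 intro: add_left_mono)
    also have "\<dots> < \<infinity>" by simp
    finally show "(\<integral>\<^sup>+\<omega>. ennreal c + indicator C \<omega> * ennreal (X \<omega> (?\<sigma> \<omega>)) \<partial>M) < \<infinity>" .
    show "AE \<omega> in M. indicator C \<omega> * ennreal (N n \<omega> (?\<sigma> \<omega>)) \<le> ennreal c + indicator C \<omega> * ennreal (X \<omega> (?\<sigma> \<omega>))" for n
    proof (rule AE_I2)
      fix \<omega> assume "\<omega> \<in> space M"
      show "indicator C \<omega> * ennreal (N n \<omega> (?\<sigma> \<omega>)) \<le> ennreal c + indicator C \<omega> * ennreal (X \<omega> (?\<sigma> \<omega>))"
      proof (cases "ennreal (capped (S n \<omega>) (?\<sigma> \<omega>)) < T \<omega>")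
        case True
        then show ?thesis
          using bound[OF \<open>\<omega> \<in> space M\<close> _ True] \<sigma>[of "T \<omega>"] capped_bounds[of "?\<sigma> \<omega>" "S n \<omega>"]
          by (auto simp: N_def indicator_def intro!: add_increasing2 ennreal_leI)
      next
        case False
        have "capped (S n \<omega>) (?\<sigma> \<omega>) \<le> ?\<sigma> \<omega>"
          using \<sigma>[of "T \<omega>"] capped_bounds by auto
        moreover have "ennreal (?\<sigma> \<omega>) \<le> T \<omega>"
          using ennreal_capped[OF t, of "T \<omega>"] capped_eq[OF t, of "T \<omega>"] by (cases "T \<omega> \<le> ennreal t") auto
        ultimately have "capped (S n \<omega>) (?\<sigma> \<omega>) = ?\<sigma> \<omega>"
          using False \<sigma>[of "T \<omega>"] capped_bounds[of "?\<sigma> \<omega>" "S n \<omega>"]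
          by (metis antisym ennreal_le_iff not_less order_trans)
        then show ?thesis
          by (auto simp: N_def indicator_def intro!: add_increasing)
      qed
    qed
  qed (use lim_t in auto)
  ultimately show ?thesis
    unfolding Ceq by (rule LIMSEQ_unique[symmetric])
qed

text \<open>Optional sampling of \<open>p\<close> moves the weight from \<open>t\<close> to the
  capped time, where it cancels the denominator; where that denominator is zero, \<open>zero\<close>
  makes the numerator vanish as well. The remaining \<open>X\<close> is sampled back to
  \<open>s\<close>, the division by the positive \<open>p \<omega> s\<close> is inserted, and the
  weight returns from \<open>s\<close> to \<open>t\<close>. Both sides thus carry the density of the
  same time \<open>t\<close>.\<close>

lemma sampled_ratio:
  fixes X p :: "'a process"
  assumes "prob_space M" and X: "local_martingale M F X" and p: "martingale M F p"
    and X_nonneg: "\<And>\<omega> u. \<omega> \<in> space M \<Longrightarrow> 0 \<le> u \<Longrightarrow> 0 \<le> X \<omega> u"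
    and X_rc: "\<And>\<omega> u. \<omega> \<in> space M \<Longrightarrow> 0 \<le> u \<Longrightarrow> continuous (at_right u) (X \<omega>)"
    and p_nonneg: "\<And>\<omega> u. \<omega> \<in> space M \<Longrightarrow> 0 \<le> u \<Longrightarrow> 0 \<le> p \<omega> u"
    and p_rc: "\<And>\<omega> u. \<omega> \<in> space M \<Longrightarrow> 0 \<le> u \<Longrightarrow> continuous (at_right u) (p \<omega>)"
    and T: "extended_stopping_time M F T"
    and X_bound: "\<And>\<omega> u. \<omega> \<in> space M \<Longrightarrow> 0 \<le> u \<Longrightarrow> ennreal u < T \<omega> \<Longrightarrow> X \<omega> u \<le> c"
    and p_pos: "\<And>\<omega> u. \<omega> \<in> space M \<Longrightarrow> 0 \<le> u \<Longrightarrow> ennreal u < T \<omega> \<Longrightarrow> 0 < p \<omega> u"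
    and zero: "AE \<omega> in M. 0 < T \<omega> \<longrightarrow> p \<omega> (capped (T \<omega>) t) = 0 \<longrightarrow> X \<omega> (capped (T \<omega>) t) = 0"
    and s: "0 \<le> s" "s < t" and C: "C \<in> sets (F s)"
    and C_after: "\<And>\<omega>. \<omega> \<in> C \<Longrightarrow> ennreal s < T \<omega>"
  shows "(\<integral>\<^sup>+\<omega>. indicator C \<omega> * ennreal (X \<omega> (capped (T \<omega>) t) / p \<omega> (capped (T \<omega>) t)) * ennreal (p \<omega> t) \<partial>M)
    = (\<integral>\<^sup>+\<omega>. indicator C \<omega> * ennreal (X \<omega> s / p \<omega> s) * ennreal (p \<omega> t) \<partial>M)"
proof -
  interpret prob_space M by fact
  have F: "filtration_on M F" and Xad: "adapted F X" and pad: "adapted F p"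
    using X p by (auto simp: local_martingale_def martingale_def)
  let ?\<sigma> = "\<lambda>\<omega>. capped (T \<omega>) t"
  have t: "0 \<le> t" using s by simp
  note \<sigma> = capped_bounds[OF t]
  have Csub: "\<omega> \<in> space M" if "\<omega> \<in> C" for \<omega>
    using that sets.sets_into_space[OF C] space_filtration[OF F s(1)] by auto
  have p_mart: "(\<integral>\<^sup>+\<omega>. V \<omega> * ennreal (p \<omega> v) \<partial>M) = (\<integral>\<^sup>+\<omega>. V \<omega> * ennreal (p \<omega> r) \<partial>M)"
    if "0 \<le> r" "r \<le> v" "V \<in> borel_measurable (F r)" for r v V
    using \<open>prob_space M\<close> p p_nonneg that by (rule martingale_nn_integral)
  have cancel: "ennreal (a / b) * ennreal b = ennreal a" if "0 \<le> b" "b \<noteq> 0" "0 \<le> a" for a b :: real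
    using that by (simp add: ennreal_mult[symmetric])
  have "(\<integral>\<^sup>+\<omega>. indicator C \<omega> * ennreal (X \<omega> (?\<sigma> \<omega>) / p \<omega> (?\<sigma> \<omega>)) * ennreal (p \<omega> t) \<partial>M)
      = (\<integral>\<^sup>+\<omega>. indicator C \<omega> * ennreal (X \<omega> (?\<sigma> \<omega>) / p \<omega> (?\<sigma> \<omega>)) * ennreal (p \<omega> (?\<sigma> \<omega>)) \<partial>M)"
  proof (rule optional_sampling[OF \<open>prob_space M\<close> F pad p_rc p_mart t])
    fix u assume u: "0 \<le> u" "u \<le> t"
    show "{\<omega> \<in> space M. ?\<sigma> \<omega> \<le> u} \<in> sets (F u)"
      using F T u by (rule capped_stopping_time)
    note [measurable] = stopped_weight_measurable[OF F Xad X_rc T s C C_after u]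
      stopped_weight_measurable[OF F pad p_rc T s C C_after u]
    \<comment> \<open>Numerator and denominator are measurable separately; where the indicators
      vanish the quotient is \<open>0 / 0 = 0\<close>, as the weight requires.\<close>
    have "(\<lambda>\<omega>. ennreal ((indicator C \<omega> * X \<omega> (?\<sigma> \<omega>) * indicator {\<omega>. ?\<sigma> \<omega> \<le> u} \<omega>)
        / (indicator C \<omega> * p \<omega> (?\<sigma> \<omega>) * indicator {\<omega>. ?\<sigma> \<omega> \<le> u} \<omega>))) \<in> borel_measurable (F u)"
      by measurable
    then show "(\<lambda>\<omega>. indicator C \<omega> * ennreal (X \<omega> (?\<sigma> \<omega>) / p \<omega> (?\<sigma> \<omega>)) * indicator {\<omega>. ?\<sigma> \<omega> \<le> u} \<omega>)
        \<in> borel_measurable (F u)"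
      by (rule measurable_cong[THEN iffD1, rotated]) (auto simp: indicator_def)
  qed (use \<sigma> in \<open>auto simp: indicator_def\<close>)
  also have "\<dots> = (\<integral>\<^sup>+\<omega>. indicator C \<omega> * ennreal (X \<omega> (?\<sigma> \<omega>)) \<partial>M)"
  proof (rule nn_integral_cong_AE, use zero in eventually_elim)
    case (elim \<omega>)
    show ?case
    proof (cases "\<omega> \<in> C")
      case True
      then have "0 < T \<omega>" using C_after[OF True] by (meson le_less_trans zero_le)
      with elim show ?thesis
        using cancel[of "p \<omega> (?\<sigma> \<omega>)" "X \<omega> (?\<sigma> \<omega>)"] X_nonneg[OF Csub[OF True]] p_nonneg[OF Csub[OF True]] \<sigma>
        by (cases "p \<omega> (?\<sigma> \<omega>) = 0") (auto simp: mult.assoc)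
    qed simp
  qed
  also have "\<dots> = (\<integral>\<^sup>+\<omega>. indicator C \<omega> * ennreal (X \<omega> s) \<partial>M)"
    by (rule local_martingale_sampling[OF \<open>prob_space M\<close> X X_nonneg X_rc T X_bound s C C_after])
  also have "\<dots> = (\<integral>\<^sup>+\<omega>. indicator C \<omega> * ennreal (X \<omega> s / p \<omega> s) * ennreal (p \<omega> s) \<partial>M)"
  proof (rule nn_integral_cong)
    fix \<omega> assume \<omega>: "\<omega> \<in> space M"
    show "indicator C \<omega> * ennreal (X \<omega> s) = indicator C \<omega> * ennreal (X \<omega> s / p \<omega> s) * ennreal (p \<omega> s)"
      using cancel[of "p \<omega> s" "X \<omega> s"] X_nonneg[OF \<omega> s(1)] p_pos[OF \<omega> s(1) C_after]
      by (cases "\<omega> \<in> C") (auto simp: mult.assoc)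
  qed
  also have "\<dots> = (\<integral>\<^sup>+\<omega>. indicator C \<omega> * ennreal (X \<omega> s / p \<omega> s) * ennreal (p \<omega> t) \<partial>M)"
  proof (rule p_mart[symmetric])
    have [measurable]: "(\<lambda>\<omega>. X \<omega> s) \<in> borel_measurable (F s)" "(\<lambda>\<omega>. p \<omega> s) \<in> borel_measurable (F s)"
      using Xad pad s by (auto simp: adapted_def)
    show "(\<lambda>\<omega>. indicator C \<omega> * ennreal (X \<omega> s / p \<omega> s)) \<in> borel_measurable (F s)"
      using C by measurable
  qed (use s in auto)
  finally show ?thesis .
qed

text \<open>On the event \<open>T < t\<close> optional sampling replaces \<open>p\<close> at
  \<open>t\<close> by its value at \<open>T\<close>, which \<open>at_T\<close> bounds by
  \<open>e\<close>. For fixed \<open>x\<close> this is a probability under the measure with density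
  \<open>p\<close>, once it is integrated over \<open>x\<close>.\<close>

lemma martingale_hitting_bound:
  fixes p :: "'a process"
  assumes "prob_space M" and p: "martingale M F p"
    and p_nonneg: "\<And>\<omega> u. \<omega> \<in> space M \<Longrightarrow> 0 \<le> u \<Longrightarrow> 0 \<le> p \<omega> u"
    and p_rc: "\<And>\<omega> u. \<omega> \<in> space M \<Longrightarrow> 0 \<le> u \<Longrightarrow> continuous (at_right u) (p \<omega>)"
    and T: "extended_stopping_time M F T"
    and at_T: "\<And>\<omega> r. \<omega> \<in> space M \<Longrightarrow> 0 \<le> r \<Longrightarrow> T \<omega> = ennreal r \<Longrightarrow> p \<omega> r \<le> e"
    and t: "0 \<le> t"
  shows "(\<integral>\<^sup>+\<omega>. indicator {\<omega>. T \<omega> < ennreal t} \<omega> * ennreal (p \<omega> t) \<partial>M) \<le> ennreal e"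
proof -
  interpret prob_space M by fact
  have F: "filtration_on M F" and pad: "adapted F p"
    using p by (auto simp: martingale_def)
  let ?\<sigma> = "\<lambda>\<omega>. capped (T \<omega>) t"
  note \<sigma> = capped_bounds[OF t]
  have p_mart: "(\<integral>\<^sup>+\<omega>. V \<omega> * ennreal (p \<omega> v) \<partial>M) = (\<integral>\<^sup>+\<omega>. V \<omega> * ennreal (p \<omega> r) \<partial>M)"
    if "0 \<le> r" "r \<le> v" "V \<in> borel_measurable (F r)" for r v V
    using \<open>prob_space M\<close> p p_nonneg that by (rule martingale_nn_integral)
  have "(\<integral>\<^sup>+\<omega>. indicator {\<omega>. T \<omega> < ennreal t} \<omega> * ennreal (p \<omega> t) \<partial>M)
      = (\<integral>\<^sup>+\<omega>. indicator {\<omega>. T \<omega> < ennreal t} \<omega> * ennreal (p \<omega> (?\<sigma> \<omega>)) \<partial>M)"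
  proof (rule optional_sampling[OF \<open>prob_space M\<close> F pad p_rc p_mart t])
    fix u assume u: "0 \<le> u" "u \<le> t"
    show meas: "{\<omega> \<in> space M. ?\<sigma> \<omega> \<le> u} \<in> sets (F u)"
      using F T u by (rule capped_stopping_time)
    \<comment> \<open>For \<open>u < t\<close> the second condition implies the first. For
      \<open>u = t\<close> the second is automatic and the first says that the capped time is below
      \<open>t\<close>.\<close>
    define D where "D = {\<omega> \<in> space M. T \<omega> < ennreal t \<and> ?\<sigma> \<omega> \<le> u}"
    have "D \<in> sets (F u)"
    proof (cases "u < t")
      case True
      have "D = {\<omega> \<in> space M. ?\<sigma> \<omega> \<le> u}"
        unfolding D_def using True u capped_le_iff[OF u(1) True] ennreal_less_iff[OF u(1), of t]
        by (auto intro: le_less_trans)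
      then show ?thesis using meas by simp
    next
      case False
      have [measurable]: "(\<lambda>\<omega>. ?\<sigma> \<omega>) \<in> borel_measurable (F t)"
        using F T t by (rule stopping_time_capped_measurable)
      have "D = {\<omega> \<in> space (F t). ?\<sigma> \<omega> < t}"
        unfolding D_def using False u \<sigma> capped_less_iff[OF t order_refl] space_filtration[OF F t] by auto
      also have "\<dots> \<in> sets (F t)" by measurable
      finally show ?thesis using False u by simp
    qed
    then have "(\<lambda>\<omega>. indicator D \<omega> :: ennreal) \<in> borel_measurable (F u)" by measurable
    then show "(\<lambda>\<omega>. indicator {\<omega>. T \<omega> < ennreal t} \<omega> * indicator {\<omega>. ?\<sigma> \<omega> \<le> u} \<omega> :: ennreal)
        \<in> borel_measurable (F u)"
      by (rule measurable_cong[THEN iffD1, rotated])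
         (auto simp: indicator_def D_def space_filtration[OF F u(1)])
  qed (use \<sigma> in \<open>auto simp: indicator_def\<close>)
  also have "\<dots> \<le> (\<integral>\<^sup>+\<omega>. ennreal e \<partial>M)"
  proof (rule nn_integral_mono)
    fix \<omega> assume \<omega>: "\<omega> \<in> space M"
    have "p \<omega> (?\<sigma> \<omega>) \<le> e" if "T \<omega> < ennreal t"
      using at_T[OF \<omega>, of "?\<sigma> \<omega>"] \<sigma> ennreal_capped[OF t less_imp_le[OF that]] by auto
    then show "indicator {\<omega>. T \<omega> < ennreal t} \<omega> * ennreal (p \<omega> (?\<sigma> \<omega>)) \<le> ennreal e"
      by (auto simp: indicator_def intro: ennreal_leI)
  qed
  also have "\<dots> = ennreal e" by (simp add: emeasure_space_1)
  finally show ?thesis .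
qed

text \<open>Before \<open>T\<close> the path is at least \<open>e\<close>, so a zero at the capped
  time forces that time to be \<open>T\<close> and to be the first zero, with left limit at least
  \<open>e\<close>. The condition \<open>0 < T\<close> makes this a limit of values before
  \<open>T\<close>; at time \<open>0\<close> the left limit is the value itself.\<close>

lemma jump_to_zero_at_time:
  assumes f: "cadlag f" and above: "\<And>u. 0 \<le> u \<Longrightarrow> ennreal u < T \<Longrightarrow> e \<le> f u" and e: "0 < e"
    and T: "0 < T" and t: "0 \<le> t" and zero: "f (capped T t) = 0"
  shows "jump_to_zero f \<le> ennreal (capped T t)"
proof -
  define r where "r = capped T t"
  have r: "0 \<le> r" "r \<le> t" using capped_bounds[OF t] by (auto simp: r_def)
  have "\<not> ennreal r < T" using above[OF r(1)] zero e by (auto simp: r_def)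
  then have "T \<le> ennreal t" using capped_eq[OF t, of T] r by (cases "T \<le> ennreal t") (auto simp: r_def)
  then have Tr: "T = ennreal r" using ennreal_capped[OF t] by (simp add: r_def)
  then have "0 < r" using T by simp
  have "first_zero f = ennreal r"
  proof (rule antisym)
    show "first_zero f \<le> ennreal r"
      unfolding first_zero_def using r zero by (intro INF_lower) (simp add: r_def)
    show "ennreal r \<le> first_zero f"
      unfolding first_zero_eq_hitting_time
    proof (rule hitting_time_geI)
      fix u assume u: "0 \<le> u" "f u = 0"
      then show "ennreal r \<le> ennreal u" using above[OF u(1)] e Tr by (cases "ennreal u < ennreal r") (auto simp: ennreal_less_iff)
    qed
  qed
  moreover obtain l where l: "(f \<longlongrightarrow> l) (at_left r)"
    using f \<open>0 < r\<close> unfolding cadlag_def by blast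
  have "eventually (\<lambda>u. e \<le> f u) (at_left r)"
    unfolding eventually_at_left[OF \<open>0 < r\<close>]
    using above Tr by (intro exI[of _ 0]) (auto simp: \<open>0 < r\<close> ennreal_less_iff)
  then have "e \<le> l" using l by (intro tendsto_lowerbound) auto
  moreover have "left_limit f r = l"
    using \<open>0 < r\<close> l by (simp add: left_limit_def tendsto_Lim)
  ultimately show ?thesis
    using e r by (simp add: jump_to_zero_def r_def[symmetric])
qed

section \<open>Disintegration along the initial enlargement\<close>

lemma space_borel_sets_of: "space (borel_sets_of E) = topspace E"
  by (simp add: borel_sets_of_def space_measure_of_conv)

text \<open>A generator of the optional \<open>\<sigma>\<close>-field, cut at time \<open>t\<close>,
  is an event of an adapted process at that time. Optional measurability enters through such slices;
  random times are reached afterwards by right-continuity of the paths.\<close>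

lemma measurable_optional_section:
  assumes F: "filtration_on M F" and t: "0 \<le> t"
  shows "(\<lambda>\<omega>. (\<omega>, t)) \<in> F t \<rightarrow>\<^sub>M optional_sigma M F"
  unfolding optional_sigma_def
proof (rule measurable_measure_of)
  show "(\<lambda>\<omega>. (\<omega>, t)) \<in> space (F t) \<rightarrow> space M \<times> {0..}"
    using space_filtration[OF F t] t by auto
  fix y assume "y \<in> {{(\<omega>, t) \<in> space M \<times> {0..}. Y \<omega> t \<in> B} | Y B.
        adapted F Y \<and> (\<forall>\<omega>\<in>space M. cadlag (Y \<omega>)) \<and> B \<in> sets (borel :: real measure)}"
  then obtain Y B where y: "y = {(\<omega>, t) \<in> space M \<times> {0..}. Y \<omega> t \<in> B}" "adapted F Y" "B \<in> sets (borel :: real measure)"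
    by blast
  have "(\<lambda>\<omega>. (\<omega>, t)) -` y \<inter> space (F t) = (\<lambda>\<omega>. Y \<omega> t) -` B \<inter> space (F t)"
    using space_filtration[OF F t] t y by auto
  also have "\<dots> \<in> sets (F t)"
    using y t by (intro measurable_sets) (auto simp: adapted_def)
  finally show "(\<lambda>\<omega>. (\<omega>, t)) -` y \<inter> space (F t) \<in> sets (F t)" .
qed auto

lemma measurable_slice:
  fixes Y :: "'e \<Rightarrow> 'a process"
  assumes F: "filtration_on M F" and t: "0 \<le> t"
    and Y: "(\<lambda>(x, \<omega>, t). Y x \<omega> t) \<in> borel_measurable (B \<Otimes>\<^sub>M optional_sigma M F)"
  shows "(\<lambda>(x, \<omega>). Y x \<omega> t) \<in> borel_measurable (B \<Otimes>\<^sub>M F t)"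
proof -
  note [measurable] = measurable_optional_section[OF F t]
  have "(\<lambda>z. (fst z, snd z, t)) \<in> B \<Otimes>\<^sub>M F t \<rightarrow>\<^sub>M B \<Otimes>\<^sub>M optional_sigma M F"
    by (intro measurable_Pair measurable_fst measurable_compose[OF measurable_snd measurable_optional_section[OF F t]])
  from measurable_compose[OF this Y] show ?thesis
    by (simp add: case_prod_beta')
qed

context jacod_enlargement
begin

abbreviation "BE \<equiv> borel_sets_of E"
abbreviation "\<mu> \<equiv> law M E J"

lemma subalg: "0 \<le> t \<Longrightarrow> subalgebra M (F t)"
  using filtration by (simp add: filtration_on_def)

lemma space_F: "0 \<le> t \<Longrightarrow> space (F t) = space M"
  by (rule space_filtration[OF filtration])

lemma J_space: "\<omega> \<in> space M \<Longrightarrow> J \<omega> \<in> topspace E"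
  using measurable_space[OF J_measurable] by (simp add: space_borel_sets_of)

lemma sets_law[measurable_cong, simp]: "sets \<mu> = sets BE"
  by (simp add: law_def)

lemma space_law: "space \<mu> = topspace E"
  by (simp add: law_def space_borel_sets_of)

lemma prob_space_law: "prob_space \<mu>"
  unfolding law_def by (rule prob_space_distr[OF J_measurable])

lemma graph_measurable_M: "0 \<le> t \<Longrightarrow> (\<lambda>\<omega>. (J \<omega>, \<omega>)) \<in> M \<rightarrow>\<^sub>M BE \<Otimes>\<^sub>M F t"
  using J_measurable measurable_from_subalg[OF subalg measurable_ident]
  by (intro measurable_Pair) (auto simp: id_def)

text \<open>Both measures agree on rectangles \<open>B \<times> A\<close>, where the identity says
  that the conditional law of \<open>B\<close>, integrated over \<open>A\<close>, is the probability
  of \<open>A\<close> together with \<open>J\<close> in \<open>B\<close>. The base measure is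
  restricted to \<open>F t\<close> so that both sides live on the same product
  \<open>\<sigma>\<close>-field.\<close>

lemma disintegration_measure:
  assumes t: "0 \<le> t"
  shows "distr M (BE \<Otimes>\<^sub>M F t) (\<lambda>\<omega>. (J \<omega>, \<omega>))
    = density (\<mu> \<Otimes>\<^sub>M restr_to_subalg M (F t)) (\<lambda>(x, \<omega>). ennreal (p x \<omega> t))" (is "?D = ?R")
proof -
  let ?Mt = "restr_to_subalg M (F t)"
  note sub = subalg[OF t]
  have sMt[measurable_cong]: "sets ?Mt = sets (F t)" by (rule sets_restr_to_subalg[OF sub])
  have spMt: "space ?Mt = space M" by (rule space_restr_to_subalg)
  interpret L: prob_space \<mu> by (rule prob_space_law)
  interpret Mt: prob_space ?Mt by (rule prob_space_restr_to_subalg[OF sub]) unfold_locales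
  interpret LM: pair_sigma_finite \<mu> ?Mt ..
  interpret finite_measure_subalgebra M "F t" by unfold_locales (rule sub)
  have [measurable]: "(\<lambda>(x, \<omega>). p x \<omega> t) \<in> borel_measurable (BE \<Otimes>\<^sub>M F t)"
    by (rule measurable_slice[OF filtration t p_measurable])
  have \<gamma>: "\<gamma> t \<in> F t \<rightarrow>\<^sub>M prob_algebra BE"
    using conditional_law[OF t] by (simp add: regular_conditional_law_def)
  let ?E = "{a \<times> b |a b. a \<in> sets BE \<and> b \<in> sets (F t)}"
  let ?\<Omega> = "topspace E \<times> space M"
  show ?thesis
  proof (rule measure_eqI_generator_eq[OF Int_stable_pair_measure_generator[of BE "F t"]])
    show "?E \<subseteq> Pow ?\<Omega>"
      using sets.space_closed[of BE] sets.space_closed[of "F t"] by (auto simp: space_borel_sets_of space_F[OF t])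
    show "sets ?D = sigma_sets ?\<Omega> ?E"
      by (simp add: sets_pair_measure space_borel_sets_of space_F[OF t])
    have "sets ?R = sets (BE \<Otimes>\<^sub>M F t)"
      by (simp, rule sets_pair_measure_cong) (simp_all add: sMt)
    then show "sets ?R = sigma_sets ?\<Omega> ?E"
      by (simp add: sets_pair_measure space_borel_sets_of space_F[OF t])
    show "range (\<lambda>_::nat. ?\<Omega>) \<subseteq> ?E"
      using sets.top[of BE] sets.top[of "F t"] by (auto simp: space_borel_sets_of space_F[OF t])
    show "(\<Union>i::nat. ?\<Omega>) = ?\<Omega>" by simp
    interpret D: prob_space ?D
      by (rule prob_space_distr[OF graph_measurable_M[OF t]])
    show "emeasure ?D ?\<Omega> \<noteq> \<infinity>"
      by simp
  next
    fix Z assume "Z \<in> ?E"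
    then obtain B A where Z: "Z = B \<times> A" and B[measurable]: "B \<in> sets BE" and A[measurable]: "A \<in> sets (F t)"
      by blast
    have AM[measurable]: "A \<in> sets M" using A sub by (auto simp: subalgebra_def)
    note [measurable] = J_measurable
    let ?c = "real_cond_exp M (F t) (\<lambda>\<omega>. indicator B (J \<omega>))"
    have intB: "integrable M (\<lambda>\<omega>. indicator B (J \<omega>) :: real)"
      by (rule integrable_const_bound[of _ 1]) auto
    have "emeasure ?R Z = (\<integral>\<^sup>+z. (case z of (x, \<omega>) \<Rightarrow> ennreal (p x \<omega> t)) * indicator (B \<times> A) z \<partial>(\<mu> \<Otimes>\<^sub>M ?Mt))"
      unfolding Z by (intro emeasure_density) measurable
    also have "\<dots> = (\<integral>\<^sup>+\<omega>. \<integral>\<^sup>+x. ennreal (p x \<omega> t) * indicator (B \<times> A) (x, \<omega>) \<partial>\<mu> \<partial>?Mt)"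
      by (subst LM.nn_integral_snd[symmetric]) (simp_all, measurable)
    also have "\<dots> = (\<integral>\<^sup>+\<omega>. indicator A \<omega> * (\<integral>\<^sup>+x. ennreal (p x \<omega> t) * indicator B x \<partial>\<mu>) \<partial>?Mt)"
      by (intro nn_integral_cong) (auto simp: indicator_def)
    also have "\<dots> = (\<integral>\<^sup>+\<omega>. indicator A \<omega> * (\<integral>\<^sup>+x. ennreal (p x \<omega> t) * indicator B x \<partial>\<mu>) \<partial>M)"
      by (rule nn_integral_subalgebra2[OF sub]) measurable
    also have "\<dots> = (\<integral>\<^sup>+\<omega>. ennreal (indicator A \<omega> *\<^sub>R ?c \<omega>) \<partial>M)"
    \<comment> \<open>For almost every \<open>\<omega>\<close> the inner integral is the mass that
      \<open>\<gamma> t \<omega>\<close> gives to \<open>B\<close>, and this is the conditional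
      expectation \<open>?c \<omega>\<close>.\<close>
    proof (rule nn_integral_cong_AE)
      have "AE \<omega> in M. measure (\<gamma> t \<omega>) B = ?c \<omega>"
        using conditional_law[OF t] B by (simp add: regular_conditional_law_def)
      with p_density[OF t] AE_space
      show "AE \<omega> in M. indicator A \<omega> * (\<integral>\<^sup>+x. ennreal (p x \<omega> t) * indicator B x \<partial>\<mu>) = ennreal (indicator A \<omega> *\<^sub>R ?c \<omega>)"
      proof eventually_elim
        case (elim \<omega>)
        have [measurable]: "(\<lambda>x. p x \<omega> t) \<in> borel_measurable BE"
          using measurable_Pair1[OF measurable_slice[OF filtration t p_measurable], of \<omega>] elim
          by (simp add: space_F[OF t])
        have "prob_space (\<gamma> t \<omega>)"
          using measurable_space[OF \<gamma>, of \<omega>] elim by (simp add: space_prob_algebra space_F[OF t])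
        then interpret G: prob_space "\<gamma> t \<omega>" .
        have "(\<integral>\<^sup>+x. ennreal (p x \<omega> t) * indicator B x \<partial>\<mu>) = emeasure (\<gamma> t \<omega>) B"
          by (subst elim(1), subst emeasure_density) simp_all
        also have "\<dots> = ennreal (?c \<omega>)"
          unfolding G.emeasure_eq_measure elim(3) ..
        finally show ?case by (auto simp: indicator_def)
      qed
    qed
    also have "\<dots> = ennreal (\<integral>\<omega>\<in>A. ?c \<omega> \<partial>M)"
      unfolding set_lebesgue_integral_def
    proof (rule nn_integral_eq_integral)
      show "integrable M (\<lambda>\<omega>. indicator A \<omega> *\<^sub>R ?c \<omega>)"
        using intB by (intro integrable_mult_indicator AM real_cond_exp_int)
      have "AE \<omega> in M. 0 \<le> ?c \<omega>"
        by (rule real_cond_exp_pos) auto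
      then show "AE \<omega> in M. 0 \<le> indicator A \<omega> *\<^sub>R ?c \<omega>"
        by eventually_elim (auto simp: indicator_def)
    qed
    also have "\<dots> = ennreal (\<integral>\<omega>\<in>A. indicator B (J \<omega>) \<partial>M)"
      using real_cond_exp_intA[OF intB A] by simp
    also have "\<dots> = (\<integral>\<^sup>+\<omega>. ennreal (indicator A \<omega> *\<^sub>R indicator B (J \<omega>)) \<partial>M)"
      unfolding set_lebesgue_integral_def
      using integrable_mult_indicator[OF AM intB] by (intro nn_integral_eq_integral[symmetric]) auto
    also have "\<dots> = (\<integral>\<^sup>+\<omega>. indicator ((\<lambda>\<omega>. (J \<omega>, \<omega>)) -` (B \<times> A) \<inter> space M) \<omega> \<partial>M)"
      by (intro nn_integral_cong) (auto simp: indicator_def)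
    also have "\<dots> = emeasure M ((\<lambda>\<omega>. (J \<omega>, \<omega>)) -` (B \<times> A) \<inter> space M)"
      using measurable_sets[OF graph_measurable_M[OF t], of "B \<times> A"] by (intro nn_integral_indicator) auto
    also have "\<dots> = emeasure ?D Z"
      unfolding Z by (intro emeasure_distr[symmetric] graph_measurable_M t) auto
    finally show "emeasure ?D Z = emeasure ?R Z" by simp
  qed
qed

lemma disintegration:
  assumes t: "0 \<le> t" and H: "H \<in> borel_measurable (BE \<Otimes>\<^sub>M F t)"
  shows "(\<integral>\<^sup>+\<omega>. H (J \<omega>, \<omega>) \<partial>M) = (\<integral>\<^sup>+x. \<integral>\<^sup>+\<omega>. H (x, \<omega>) * ennreal (p x \<omega> t) \<partial>M \<partial>\<mu>)"
proof -
  let ?Mt = "restr_to_subalg M (F t)"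
  note sub = subalg[OF t]
  have sMt[measurable_cong]: "sets ?Mt = sets (F t)" by (rule sets_restr_to_subalg[OF sub])
  interpret L: prob_space \<mu> by (rule prob_space_law)
  interpret Mt: prob_space ?Mt by (rule prob_space_restr_to_subalg[OF sub]) unfold_locales
  note [measurable] = H measurable_slice[OF filtration t p_measurable]
  have "(\<integral>\<^sup>+\<omega>. H (J \<omega>, \<omega>) \<partial>M) = (\<integral>\<^sup>+z. H z \<partial>distr M (BE \<Otimes>\<^sub>M F t) (\<lambda>\<omega>. (J \<omega>, \<omega>)))"
    by (rule nn_integral_distr[symmetric, OF graph_measurable_M[OF t]]) (simp add: H)
  also have "\<dots> = (\<integral>\<^sup>+z. (case z of (x, \<omega>) \<Rightarrow> ennreal (p x \<omega> t)) * H z \<partial>(\<mu> \<Otimes>\<^sub>M ?Mt))"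
    unfolding disintegration_measure[OF t] by (intro nn_integral_density) measurable
  also have "\<dots> = (\<integral>\<^sup>+x. \<integral>\<^sup>+\<omega>. ennreal (p x \<omega> t) * H (x, \<omega>) \<partial>?Mt \<partial>\<mu>)"
    by (subst Mt.nn_integral_fst[symmetric]) (simp_all, measurable)
  also have "\<dots> = (\<integral>\<^sup>+x. \<integral>\<^sup>+\<omega>. H (x, \<omega>) * ennreal (p x \<omega> t) \<partial>M \<partial>\<mu>)"
  proof (rule nn_integral_cong)
    fix x assume "x \<in> space \<mu>"
    then have x: "x \<in> space BE" by (simp add: space_law space_borel_sets_of)
    have [measurable]: "(\<lambda>\<omega>. p x \<omega> t) \<in> borel_measurable (F t)"
      using measurable_Pair2[OF measurable_slice[OF filtration t p_measurable] x] by simp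
    have [measurable]: "(\<lambda>\<omega>. H (x, \<omega>)) \<in> borel_measurable (F t)"
      using measurable_Pair2[OF H x] by simp
    have "(\<integral>\<^sup>+\<omega>. ennreal (p x \<omega> t) * H (x, \<omega>) \<partial>?Mt) = (\<integral>\<^sup>+\<omega>. ennreal (p x \<omega> t) * H (x, \<omega>) \<partial>M)"
      by (rule nn_integral_subalgebra2[OF sub]) measurable
    then show "(\<integral>\<^sup>+\<omega>. ennreal (p x \<omega> t) * H (x, \<omega>) \<partial>?Mt) = (\<integral>\<^sup>+\<omega>. H (x, \<omega>) * ennreal (p x \<omega> t) \<partial>M)"
      by (simp add: mult.commute)
  qed
  finally show ?thesis .
qed

end

text \<open>\<open>T \<le> t\<close> is the intersection of strict events along times decreasing to
  \<open>t\<close> within \<open>(t, s]\<close>. So it belongs to the \<open>\<sigma>\<close>-field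
  of every later time, and right-continuity, where available, brings it down to
  \<open>t\<close>.\<close>

lemma ennreal_le_limit_sets:
  assumes t: "0 \<le> t" "t < s"
    and less: "\<And>u. t < u \<Longrightarrow> u \<le> s \<Longrightarrow> {\<omega> \<in> space A. T \<omega> < ennreal u} \<in> sets A"
  shows "{\<omega> \<in> space A. T \<omega> \<le> ennreal t} \<in> sets A"
proof -
  define u where "u m = t + (s - t) * inverse (real (Suc m))" for m
  have u: "t < u m" "u m \<le> s" for m
  proof -
    show "t < u m" using t by (simp add: u_def)
    have "(s - t) * inverse (real (Suc m)) \<le> (s - t) * 1"
      using t by (intro mult_left_mono) (auto simp: inverse_le_1_iff)
    then show "u m \<le> s" by (simp add: u_def)
  qed
  have "u \<longlonglongrightarrow> t + (s - t) * 0"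
    unfolding u_def by (intro tendsto_intros LIMSEQ_inverse_real_of_nat)
  then have lim: "(\<lambda>m. ennreal (u m)) \<longlonglongrightarrow> ennreal t"
    by (intro tendsto_ennrealI) simp
  have "T \<omega> \<le> ennreal t \<longleftrightarrow> (\<forall>m. T \<omega> < ennreal (u m))" for \<omega>
  proof
    assume "T \<omega> \<le> ennreal t"
    moreover have "ennreal t < ennreal (u m)" for m
      using u(1)[of m] t by (simp add: ennreal_less_iff)
    ultimately show "\<forall>m. T \<omega> < ennreal (u m)" by (auto intro: le_less_trans)
  next
    assume "\<forall>m. T \<omega> < ennreal (u m)"
    then show "T \<omega> \<le> ennreal t"
      by (intro LIMSEQ_le_const[OF lim]) (auto intro: less_imp_le)
  qed
  then have "{\<omega> \<in> space A. T \<omega> \<le> ennreal t} = (\<Inter>m. {\<omega> \<in> space A. T \<omega> < ennreal (u m)})"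
    by auto
  also have "\<dots> \<in> sets A"
    using less[OF u] by (intro sets.countable_INT) auto
  finally show ?thesis .
qed

lemma ex_right_sequence:
  fixes s t :: real
  assumes "s < t"
  obtains u where "\<And>m. s < u m" "\<And>m. u m < t" "filterlim u (at_right s) sequentially"
proof
  \<comment> \<open>The index starts at \<open>Suc (Suc m)\<close> so that already the first term
    lies strictly before \<open>t\<close>.\<close>
  define u where "u m = s + (t - s) * inverse (real (Suc (Suc m)))" for m
  show u: "s < u m" for m using assms by (simp add: u_def)
  show "u m < t" for m
  proof -
    have "(t - s) * inverse (real (Suc (Suc m))) < (t - s) * 1"
      using assms by (intro mult_strict_left_mono) (auto simp: inverse_less_1_iff)
    then show ?thesis by (simp add: u_def)
  qed
  have "u \<longlonglongrightarrow> s + (t - s) * 0"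
    unfolding u_def by (intro tendsto_intros LIMSEQ_Suc[OF LIMSEQ_inverse_real_of_nat])
  then show "filterlim u (at_right s) sequentially"
    using u by (intro filterlim_at_withinI) (auto simp: less_imp_neq[THEN not_sym])
qed

section \<open>The sigma-fields of the initial enlargement\<close>

context jacod_enlargement
begin

abbreviation "G0 \<equiv> initial_enlargement0 M F E J"
abbreviation "G \<equiv> initial_enlargement M F E J"

lemma space_G0: "space (G0 t) = space M"
  by (simp add: initial_enlargement0_def space_measure_of_conv)

lemma sets_G0:
  assumes "0 \<le> t"
  shows "sets (G0 t) = sigma_sets (space M) (sets (F t) \<union> sets (vimage_algebra (space M) J BE))"
  unfolding initial_enlargement0_def
  using sets.space_closed[of "F t"] sets.space_closed[of "vimage_algebra (space M) J BE"] space_F[OF assms]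
  by (intro sets_measure_of) auto

lemma sets_F_G0: "0 \<le> t \<Longrightarrow> sets (F t) \<subseteq> sets (G0 t)"
  by (auto simp: sets_G0)

lemma J_measurable_G0:
  assumes "0 \<le> t"
  shows "J \<in> G0 t \<rightarrow>\<^sub>M BE"
proof (rule measurableI)
  show "J \<omega> \<in> space BE" if "\<omega> \<in> space (G0 t)" for \<omega>
    using that by (simp add: space_G0 J_space space_borel_sets_of)
  show "J -` A \<inter> space (G0 t) \<in> sets (G0 t)" if "A \<in> sets BE" for A
    unfolding space_G0 sets_G0[OF assms] using in_vimage_algebra[OF that, of J "space M"]
    by (intro sigma_sets.Basic) simp
qed

lemma graph_measurable:
  assumes "0 \<le> t"
  shows "(\<lambda>\<omega>. (J \<omega>, \<omega>)) \<in> G0 t \<rightarrow>\<^sub>M BE \<Otimes>\<^sub>M F t"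
proof -
  have "subalgebra (G0 t) (F t)"
    using sets_F_G0[OF assms] by (simp add: subalgebra_def space_G0 space_F[OF assms])
  from measurable_from_subalg[OF this measurable_ident] show ?thesis
    by (intro measurable_Pair) (simp_all add: J_measurable_G0[OF assms] id_def)
qed

text \<open>Pulling back along the graph map
  \<open>\<omega> \<mapsto> (J \<omega>, \<omega>)\<close> gives a \<open>\<sigma>\<close>-field
  that contains both generating families of \<open>G0 t\<close>. An event of the enlargement thereby
  becomes a parametrised family of events of \<open>F t\<close>, to which the disintegration
  applies.\<close>

lemma sets_G0_graph:
  assumes t: "0 \<le> t" and A: "A \<in> sets (G0 t)"
  obtains C where "C \<in> sets (BE \<Otimes>\<^sub>M F t)" "\<And>\<omega>. \<omega> \<in> space M \<Longrightarrow> \<omega> \<in> A \<longleftrightarrow> (J \<omega>, \<omega>) \<in> C"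
proof -
  let ?V = "vimage_algebra (space M) (\<lambda>\<omega>. (J \<omega>, \<omega>)) (BE \<Otimes>\<^sub>M F t)"
  have graph: "(\<lambda>\<omega>. (J \<omega>, \<omega>)) \<in> space M \<rightarrow> space (BE \<Otimes>\<^sub>M F t)"
    by (auto simp: space_pair_measure space_borel_sets_of J_space space_F[OF t])
  have "sets (F t) \<union> sets (vimage_algebra (space M) J BE) \<subseteq> sets ?V"
  proof safe
    fix B assume B: "B \<in> sets (F t)"
    then have "topspace E \<times> B \<in> sets (BE \<Otimes>\<^sub>M F t)"
      using sets.top[of BE] by (intro pair_measureI) (auto simp: space_borel_sets_of)
    from in_vimage_algebra[OF this, of "\<lambda>\<omega>. (J \<omega>, \<omega>)" "space M"]
    have "(\<lambda>\<omega>. (J \<omega>, \<omega>)) -` (topspace E \<times> B) \<inter> space M \<in> sets ?V" .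
    also have "(\<lambda>\<omega>. (J \<omega>, \<omega>)) -` (topspace E \<times> B) \<inter> space M = B"
      using sets.sets_into_space[OF B] by (auto simp: J_space space_F[OF t])
    finally show "B \<in> sets ?V" .
  next
    fix B assume "B \<in> sets (vimage_algebra (space M) J BE)"
    then obtain B' where B: "B' \<in> sets BE" "B = J -` B' \<inter> space M"
      by (subst (asm) sets_vimage_algebra2) (auto simp: J_space space_borel_sets_of)
    then have "B' \<times> space M \<in> sets (BE \<Otimes>\<^sub>M F t)"
      using sets.top[of "F t"] by (intro pair_measureI) (auto simp: space_F[OF t])
    from in_vimage_algebra[OF this, of "\<lambda>\<omega>. (J \<omega>, \<omega>)" "space M"]
    have "(\<lambda>\<omega>. (J \<omega>, \<omega>)) -` (B' \<times> space M) \<inter> space M \<in> sets ?V" .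
    also have "(\<lambda>\<omega>. (J \<omega>, \<omega>)) -` (B' \<times> space M) \<inter> space M = B"
      using B by auto
    finally show "B \<in> sets ?V" .
  qed
  then have "sets (G0 t) \<subseteq> sets ?V"
    unfolding sets_G0[OF t] using sets.sigma_sets_subset[of _ ?V] by simp
  with A have "A \<in> sets ?V" by auto
  then obtain C where "C \<in> sets (BE \<Otimes>\<^sub>M F t)" "A = (\<lambda>\<omega>. (J \<omega>, \<omega>)) -` C \<inter> space M"
    unfolding sets_vimage_algebra2[OF graph] by blast
  then show ?thesis by (intro that[of C]) auto
qed

lemma subalgebra_G0: "0 \<le> t \<Longrightarrow> subalgebra M (G0 t)"
proof -
  assume t: "0 \<le> t"
  have "sets (vimage_algebra (space M) J BE) \<subseteq> sets M"
    using J_measurable by (intro sets_image_in_sets) auto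
  moreover have "sets (F t) \<subseteq> sets M" using subalg[OF t] by (simp add: subalgebra_def)
  ultimately have "sets (G0 t) \<subseteq> sets M"
    unfolding sets_G0[OF t] by (intro sets.sigma_sets_subset) auto
  then show ?thesis by (simp add: subalgebra_def space_G0)
qed

lemma sets_G0_mono: "0 \<le> s \<Longrightarrow> s \<le> t \<Longrightarrow> sets (G0 s) \<subseteq> sets (G0 t)"
  using sets_filtration_mono[OF filtration, of s t]
  by (simp add: sets_G0) (intro sigma_sets_mono', auto)

lemma space_G: "space (G t) = space M"
  by (simp add: initial_enlargement_def space_measure_of_conv)

text \<open>The intersection is already a \<open>\<sigma>\<close>-field, so generating one from it
  adds nothing.\<close>

lemma sets_G:
  assumes t: "0 \<le> t"
  shows "sets (G t) = (\<Inter>s\<in>{t<..}. sets (G0 s))"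
proof -
  have "sigma_algebra (space M) (\<Inter>s\<in>{t<..}. sets (G0 s))"
  proof -
    show ?thesis
      unfolding sigma_algebra_iff2
    proof (intro conjI ballI allI impI)
      show "(\<Inter>s\<in>{t<..}. sets (G0 s)) \<subseteq> Pow (space M)"
      proof
        fix A assume "A \<in> (\<Inter>s\<in>{t<..}. sets (G0 s))"
        then have "A \<in> sets (G0 (t + 1))" by simp
        then show "A \<in> Pow (space M)" using sets.sets_into_space[of A "G0 (t + 1)"] by (auto simp: space_G0)
      qed
      show "space M - A \<in> (\<Inter>s\<in>{t<..}. sets (G0 s))" if "A \<in> (\<Inter>s\<in>{t<..}. sets (G0 s))" for A
        using that sets.compl_sets by (force simp: space_G0)
    qed auto
  qed
  then show ?thesis
    unfolding initial_enlargement_def by (rule sigma_algebra.sets_measure_of_eq)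
qed

lemma sets_G_G0: "0 \<le> s \<Longrightarrow> s < u \<Longrightarrow> sets (G s) \<subseteq> sets (G0 u)"
  by (auto simp: sets_G)

lemma subalgebra_G: "0 \<le> t \<Longrightarrow> subalgebra M (G t)"
  using sets_G_G0[of t "t + 1"] subalgebra_G0[of "t + 1"] by (auto simp: subalgebra_def space_G)

lemma filtration_G: "filtration_on M G"
  unfolding filtration_on_def using subalgebra_G by (auto simp: sets_G)

lemma measurable_GI:
  assumes t: "0 \<le> t" and f: "\<And>s. t < s \<Longrightarrow> f \<in> G0 s \<rightarrow>\<^sub>M N"
  shows "f \<in> G t \<rightarrow>\<^sub>M N"
proof (rule measurableI)
  show "f \<omega> \<in> space N" if "\<omega> \<in> space (G t)" for \<omega>
    using measurable_space[OF f[of "t + 1"]] that by (simp add: space_G space_G0)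
  show "f -` A \<inter> space (G t) \<in> sets (G t)" if "A \<in> sets N" for A
    using measurable_sets[OF f that] by (auto simp: sets_G[OF t] space_G space_G0)
qed

lemma borel_measurable_G0_M: "0 \<le> t \<Longrightarrow> f \<in> borel_measurable (G0 t) \<Longrightarrow> f \<in> borel_measurable M"
  by (rule measurable_from_subalg[OF subalgebra_G0])

lemma measurable_G0_mono:
  assumes "0 \<le> s" "s \<le> t" "f \<in> G0 s \<rightarrow>\<^sub>M N"
  shows "f \<in> G0 t \<rightarrow>\<^sub>M N"
  using assms sets_G0_mono[OF assms(1,2)] by (auto simp: measurable_def space_G0)

lemma measurable_product_mono:
  assumes "0 \<le> s" "s \<le> t" "f \<in> BE \<Otimes>\<^sub>M F s \<rightarrow>\<^sub>M N"
  shows "f \<in> BE \<Otimes>\<^sub>M F t \<rightarrow>\<^sub>M N"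
proof -
  have "(\<lambda>\<omega>. \<omega>) \<in> F t \<rightarrow>\<^sub>M F s"
    using measurable_filtration_mono[OF filtration assms(1,2) measurable_ident] by (simp add: id_def)
  then have "(\<lambda>z. (fst z, snd z)) \<in> BE \<Otimes>\<^sub>M F t \<rightarrow>\<^sub>M BE \<Otimes>\<^sub>M F s"
    by (intro measurable_Pair measurable_fst measurable_compose[OF measurable_snd])
  then show ?thesis using measurable_compose[OF _ assms(3)] by simp
qed

text \<open>Disintegrate the indicator of \<open>p = 0\<close>: the density factor kills the
  integrand. The exceptional set depends on \<open>t\<close>; a single one for all times comes
  later, from \<open>density_bounded_below_AE\<close>.\<close>

lemma density_positive_AE:
  assumes t: "0 \<le> t"
  shows "AE \<omega> in M. 0 < p (J \<omega>) \<omega> t"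
proof -
  have pt: "(\<lambda>z. p (fst z) (snd z) t) \<in> borel_measurable (BE \<Otimes>\<^sub>M F t)"
    using measurable_slice[OF filtration t p_measurable] by (simp add: case_prod_beta')
  define H :: "'e \<times> 'a \<Rightarrow> ennreal" where "H z = indicator {0} (p (fst z) (snd z) t)" for z
  have H: "H \<in> borel_measurable (BE \<Otimes>\<^sub>M F t)"
    unfolding H_def using pt by measurable
  have "(\<integral>\<^sup>+\<omega>. H (J \<omega>, \<omega>) \<partial>M) = (\<integral>\<^sup>+x. \<integral>\<^sup>+\<omega>. H (x, \<omega>) * ennreal (p x \<omega> t) \<partial>M \<partial>\<mu>)"
    by (rule disintegration[OF t H])
  also have "\<dots> = 0"
  proof -
    have "H (x, \<omega>) * ennreal (p x \<omega> t) = 0" for x \<omega>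
      by (simp add: H_def indicator_def)
    then show ?thesis by (simp only: nn_integral_const mult_zero_left)
  qed
  finally have "AE \<omega> in M. H (J \<omega>, \<omega>) = 0"
    using measurable_compose[OF graph_measurable_M[OF t] H] by (subst (asm) nn_integral_0_iff_AE) auto
  then show ?thesis
    using AE_space
  proof eventually_elim
    case (elim \<omega>)
    then show ?case
      using p_nonneg[OF J_space[OF elim(2)] elim(2) t] by (auto simp: H_def indicator_def split: if_splits)
  qed
qed

section \<open>Hitting times that depend on the parameter\<close>

lemma hitting_time_measurable:
  assumes Q: "\<And>q. 0 \<le> q \<Longrightarrow> {z \<in> space (BE \<Otimes>\<^sub>M F q). Q (fst z) (snd z) q} \<in> sets (BE \<Otimes>\<^sub>M F q)"
    and opn: "\<And>x \<omega> s. x \<in> topspace E \<Longrightarrow> \<omega> \<in> space M \<Longrightarrow> 0 \<le> s \<Longrightarrow> Q x \<omega> s \<Longrightarrow>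
      eventually (Q x \<omega>) (at_right s)"
    and u: "0 \<le> u" "u \<le> t"
  shows "{z \<in> space (BE \<Otimes>\<^sub>M F t). hitting_time (Q (fst z) (snd z)) < ennreal u} \<in> sets (BE \<Otimes>\<^sub>M F t)"
proof -
  have t: "0 \<le> t" using u by simp
  have "hitting_time (Q (fst z) (snd z)) < ennreal u \<longleftrightarrow> (\<exists>q\<in>\<rat> \<inter> {0..<u}. Q (fst z) (snd z) q)"
    if "z \<in> space (BE \<Otimes>\<^sub>M F t)" for z
  proof -
    have "fst z \<in> topspace E" "snd z \<in> space M"
      using that by (auto simp: space_pair_measure space_borel_sets_of space_F[OF t])
    then show ?thesis
      using hitting_time_less_iff[OF opn u(1), of "fst z" "snd z"] by auto
  qed
  then have "{z \<in> space (BE \<Otimes>\<^sub>M F t). hitting_time (Q (fst z) (snd z)) < ennreal u}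
     = (\<Union>q\<in>\<rat> \<inter> {0..<u}. {z \<in> space (BE \<Otimes>\<^sub>M F t). Q (fst z) (snd z) q})"
    by auto
  also have "\<dots> \<in> sets (BE \<Otimes>\<^sub>M F t)"
  proof (intro sets.countable_UN'' countable_Int1 countable_rat)
    fix q assume "q \<in> \<rat> \<inter> {0..<u}"
    then have q: "0 \<le> q" "q \<le> t" using u by auto
    have "Measurable.pred (BE \<Otimes>\<^sub>M F q) (\<lambda>z. Q (fst z) (snd z) q)"
      using Q[OF q(1)] by (simp add: pred_def)
    from measurable_product_mono[OF q this]
    show "{z \<in> space (BE \<Otimes>\<^sub>M F t). Q (fst z) (snd z) q} \<in> sets (BE \<Otimes>\<^sub>M F t)"
      by (simp add: pred_def)
  qed
  finally show ?thesis .
qed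

lemma product_section_sets:
  assumes t: "0 \<le> t" and x: "x \<in> topspace E" and C: "C \<in> sets (BE \<Otimes>\<^sub>M F t)"
  shows "{\<omega> \<in> space M. (x, \<omega>) \<in> C} \<in> sets (F t)"
proof -
  have "Pair x -` C \<in> sets (F t)" using C by (rule sets_Pair1)
  moreover have "{\<omega> \<in> space M. (x, \<omega>) \<in> C} = Pair x -` C"
    using sets.sets_into_space[OF C] by (auto simp: space_pair_measure space_F[OF t])
  ultimately show ?thesis by simp
qed

lemma hitting_time_stopping_F:
  assumes Q: "\<And>q. 0 \<le> q \<Longrightarrow> {z \<in> space (BE \<Otimes>\<^sub>M F q). Q (fst z) (snd z) q} \<in> sets (BE \<Otimes>\<^sub>M F q)"
    and opn: "\<And>x \<omega> s. x \<in> topspace E \<Longrightarrow> \<omega> \<in> space M \<Longrightarrow> 0 \<le> s \<Longrightarrow> Q x \<omega> s \<Longrightarrow>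
      eventually (Q x \<omega>) (at_right s)"
    and x: "x \<in> topspace E"
  shows "extended_stopping_time M F (\<lambda>\<omega>. hitting_time (Q x \<omega>))"
  unfolding extended_stopping_time_def
proof (intro allI impI)
  fix t :: real assume t: "0 \<le> t"
  have "{\<omega> \<in> space M. hitting_time (Q x \<omega>) \<le> ennreal t} \<in> sets (F s)" if s: "t < s" for s
  proof -
    have "{\<omega> \<in> space (F s). hitting_time (Q x \<omega>) \<le> ennreal t} \<in> sets (F s)"
    proof (rule ennreal_le_limit_sets[OF t s])
      fix u assume u: "t < u" "u \<le> s"
      have "{\<omega> \<in> space M. (x, \<omega>) \<in> {z \<in> space (BE \<Otimes>\<^sub>M F s). hitting_time (Q (fst z) (snd z)) < ennreal u}} \<in> sets (F s)"
        using t s u by (intro product_section_sets x hitting_time_measurable Q opn) auto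
      then show "{\<omega> \<in> space (F s). hitting_time (Q x \<omega>) < ennreal u} \<in> sets (F s)"
        using x t s by (simp add: space_pair_measure space_borel_sets_of space_F)
    qed
    then show ?thesis using t s by (simp add: space_F)
  qed
  note all = this
  show "{\<omega> \<in> space M. hitting_time (Q x \<omega>) \<le> ennreal t} \<in> sets (F t)"
  proof -
    have "sets (F t) = (\<Inter>s\<in>{t<..}. sets (F s))"
      using usual t unfolding usual_hypotheses_def by blast
    then show ?thesis using all by simp
  qed
qed

text \<open>The event is taken at a time \<open>s\<close> after \<open>t\<close>, since
  right-continuity is assumed for \<open>F\<close> and not for its product with the parameter space.
  For a fixed \<open>x\<close> the section of the event does lie in \<open>F t\<close>.\<close>

lemma hitting_time_positive_measurable:
  assumes Q: "\<And>q. 0 \<le> q \<Longrightarrow> {z \<in> space (BE \<Otimes>\<^sub>M F q). Q (fst z) (snd z) q} \<in> sets (BE \<Otimes>\<^sub>M F q)"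
    and opn: "\<And>x \<omega> s. x \<in> topspace E \<Longrightarrow> \<omega> \<in> space M \<Longrightarrow> 0 \<le> s \<Longrightarrow> Q x \<omega> s \<Longrightarrow>
      eventually (Q x \<omega>) (at_right s)"
    and t: "0 \<le> t" "t < s"
  shows "{z \<in> space (BE \<Otimes>\<^sub>M F s). ennreal t < hitting_time (Q (fst z) (snd z))} \<in> sets (BE \<Otimes>\<^sub>M F s)"
proof -
  have "{z \<in> space (BE \<Otimes>\<^sub>M F s). hitting_time (Q (fst z) (snd z)) \<le> ennreal t} \<in> sets (BE \<Otimes>\<^sub>M F s)"
    using t by (intro ennreal_le_limit_sets[OF t] hitting_time_measurable Q opn) auto
  then have "space (BE \<Otimes>\<^sub>M F s) - {z \<in> space (BE \<Otimes>\<^sub>M F s). hitting_time (Q (fst z) (snd z)) \<le> ennreal t} \<in> sets (BE \<Otimes>\<^sub>M F s)"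
    by (rule sets.compl_sets)
  also have "space (BE \<Otimes>\<^sub>M F s) - {z \<in> space (BE \<Otimes>\<^sub>M F s). hitting_time (Q (fst z) (snd z)) \<le> ennreal t}
      = {z \<in> space (BE \<Otimes>\<^sub>M F s). ennreal t < hitting_time (Q (fst z) (snd z))}" by auto
  finally show ?thesis .
qed

text \<open>The strict events are pulled back along the graph into \<open>G0 s\<close> for every
  \<open>s > t\<close>; the intersection that defines \<open>G t\<close> absorbs the passage to the
  limit.\<close>

lemma hitting_time_stopping_G:
  assumes Q: "\<And>q. 0 \<le> q \<Longrightarrow> {z \<in> space (BE \<Otimes>\<^sub>M F q). Q (fst z) (snd z) q} \<in> sets (BE \<Otimes>\<^sub>M F q)"
    and opn: "\<And>x \<omega> s. x \<in> topspace E \<Longrightarrow> \<omega> \<in> space M \<Longrightarrow> 0 \<le> s \<Longrightarrow> Q x \<omega> s \<Longrightarrow>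
      eventually (Q x \<omega>) (at_right s)"
  shows "extended_stopping_time M G (\<lambda>\<omega>. hitting_time (Q (J \<omega>) \<omega>))"
  unfolding extended_stopping_time_def
proof (intro allI impI)
  fix t :: real assume t: "0 \<le> t"
  have "{\<omega> \<in> space M. hitting_time (Q (J \<omega>) \<omega>) \<le> ennreal t} \<in> sets (G0 s)" if s: "t < s" for s
  proof -
    have s0: "0 \<le> s" using t s by simp
    have "{\<omega> \<in> space (G0 s). hitting_time (Q (J \<omega>) \<omega>) \<le> ennreal t} \<in> sets (G0 s)"
    proof (rule ennreal_le_limit_sets[OF t s])
      fix u assume u: "t < u" "u \<le> s"
      have "(\<lambda>\<omega>. (J \<omega>, \<omega>)) -` {z \<in> space (BE \<Otimes>\<^sub>M F s). hitting_time (Q (fst z) (snd z)) < ennreal u}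
          \<inter> space (G0 s) \<in> sets (G0 s)"
        using t s u by (intro measurable_sets[OF graph_measurable[OF s0]] hitting_time_measurable Q opn) auto
      also have "(\<lambda>\<omega>. (J \<omega>, \<omega>)) -` {z \<in> space (BE \<Otimes>\<^sub>M F s). hitting_time (Q (fst z) (snd z)) < ennreal u}
          \<inter> space (G0 s) = {\<omega> \<in> space (G0 s). hitting_time (Q (J \<omega>) \<omega>) < ennreal u}"
        by (auto simp: space_pair_measure space_borel_sets_of space_F[OF s0] space_G0 J_space)
      finally show "{\<omega> \<in> space (G0 s). hitting_time (Q (J \<omega>) \<omega>) < ennreal u} \<in> sets (G0 s)" .
    qed
    then show ?thesis by (simp add: space_G0)
  qed
  then show "{\<omega> \<in> space M. hitting_time (Q (J \<omega>) \<omega>) \<le> ennreal t} \<in> sets (G t)"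
    by (simp add: sets_G[OF t])
qed

end

section \<open>The ratio process\<close>

locale enlarged_family = jacod_enlargement M F E J \<gamma> p
  for M :: "'a measure" and F :: "real \<Rightarrow> 'a measure" and E :: "'e topology" and J :: "'a \<Rightarrow> 'e"
    and \<gamma> :: "real \<Rightarrow> 'a \<Rightarrow> 'e measure" and p :: "'e \<Rightarrow> 'a process" +
  fixes X :: "'e \<Rightarrow> 'a process"
  assumes X_measurable: "(\<lambda>(x, \<omega>, t). X x \<omega> t) \<in> borel_measurable (borel_sets_of E \<Otimes>\<^sub>M optional_sigma M F)"
    and X_nonneg: "\<And>x \<omega> t. x \<in> topspace E \<Longrightarrow> \<omega> \<in> space M \<Longrightarrow> 0 \<le> t \<Longrightarrow> 0 \<le> X x \<omega> t"
    and X_cadlag: "\<And>x \<omega>. x \<in> topspace E \<Longrightarrow> \<omega> \<in> space M \<Longrightarrow> cadlag (X x \<omega>)"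
begin

text \<open>Division by zero gives \<open>0\<close>, so this is a nonnegative real process
  everywhere; almost surely \<open>p\<close> has no zero along \<open>J\<close>.\<close>

definition Z :: "'a process" where
  "Z \<omega> t = X (J \<omega>) \<omega> t / p (J \<omega>) \<omega> t"

lemma X_slice: "0 \<le> t \<Longrightarrow> (\<lambda>z. X (fst z) (snd z) t) \<in> borel_measurable (BE \<Otimes>\<^sub>M F t)"
  using measurable_slice[OF filtration _ X_measurable] by (simp add: case_prod_beta')

lemma p_slice: "0 \<le> t \<Longrightarrow> (\<lambda>z. p (fst z) (snd z) t) \<in> borel_measurable (BE \<Otimes>\<^sub>M F t)"
  using measurable_slice[OF filtration _ p_measurable] by (simp add: case_prod_beta')

lemma X_rc: "x \<in> topspace E \<Longrightarrow> \<omega> \<in> space M \<Longrightarrow> 0 \<le> t \<Longrightarrow> continuous (at_right t) (X x \<omega>)"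
  using X_cadlag cadlag_right_continuous by blast

lemma p_rc: "x \<in> topspace E \<Longrightarrow> \<omega> \<in> space M \<Longrightarrow> 0 \<le> t \<Longrightarrow> continuous (at_right t) (p x \<omega>)"
  using p_cadlag cadlag_right_continuous by blast

lemma Z_nonneg: "\<omega> \<in> space M \<Longrightarrow> 0 \<le> t \<Longrightarrow> 0 \<le> Z \<omega> t"
  by (simp add: Z_def X_nonneg p_nonneg J_space)

lemma Z_rc:
  assumes "\<omega> \<in> space M" "0 \<le> t" "0 < p (J \<omega>) \<omega> t"
  shows "continuous (at_right t) (Z \<omega>)"
  unfolding Z_def[abs_def] using assms X_rc[OF J_space] p_rc[OF J_space]
  by (intro continuous_at_within_divide) auto

lemma ratio_measurable: "0 \<le> t \<Longrightarrow> (\<lambda>z. X (fst z) (snd z) t / p (fst z) (snd z) t) \<in> borel_measurable (BE \<Otimes>\<^sub>M F t)"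
  by (intro borel_measurable_divide X_slice p_slice)

lemma Z_measurable_G0: "0 \<le> t \<Longrightarrow> (\<lambda>\<omega>. Z \<omega> t) \<in> borel_measurable (G0 t)"
  using measurable_compose[OF graph_measurable ratio_measurable] by (simp add: Z_def)

lemma Z_measurable_M: "0 \<le> t \<Longrightarrow> (\<lambda>\<omega>. Z \<omega> t) \<in> borel_measurable M"
  by (rule borel_measurable_G0_M[OF _ Z_measurable_G0])

lemma adapted_Z: "adapted G Z"
  unfolding adapted_def
proof (intro allI impI measurable_GI)
  fix t s :: real assume "0 \<le> t" "t < s"
  then show "(\<lambda>\<omega>. Z \<omega> t) \<in> borel_measurable (G0 s)"
    by (intro measurable_G0_mono[OF _ _ Z_measurable_G0]) auto
qed

text \<open>For fixed \<open>x\<close> the density cancels the denominator and leaves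
  \<open>X\<close> on the event that \<open>p\<close> is positive at \<open>t\<close>. Enlarging it
  to positivity at \<open>s\<close>, which is known at time \<open>s\<close>, allows the inequality
  for \<open>X x\<close>; at time \<open>s\<close> the cancellation is undone.\<close>

lemma Z_supermartingale_G0:
  assumes super: "AE x in \<mu>. nonneg_supermartingale M F (X x)"
    and s: "0 \<le> s" "s \<le> t" and D: "D \<in> sets (G0 s)"
  shows "(\<integral>\<^sup>+\<omega>. indicator D \<omega> * ennreal (Z \<omega> t) \<partial>M) \<le> (\<integral>\<^sup>+\<omega>. indicator D \<omega> * ennreal (Z \<omega> s) \<partial>M)"
proof -
  have t: "0 \<le> t" using s by simp
  have pr: "prob_space M" by unfold_locales
  obtain C where C: "C \<in> sets (BE \<Otimes>\<^sub>M F s)" "\<And>\<omega>. \<omega> \<in> space M \<Longrightarrow> \<omega> \<in> D \<longleftrightarrow> (J \<omega>, \<omega>) \<in> C"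
    using sets_G0_graph[OF s(1) D] by metis
  define H where "H u z = indicator C z * ennreal (X (fst z) (snd z) u / p (fst z) (snd z) u)" for u z
  have HZ: "(\<integral>\<^sup>+\<omega>. indicator D \<omega> * ennreal (Z \<omega> u) \<partial>M)
      = (\<integral>\<^sup>+x. \<integral>\<^sup>+\<omega>. H u (x, \<omega>) * ennreal (p x \<omega> u) \<partial>M \<partial>\<mu>)" if "s \<le> u" for u
  proof -
    have u: "0 \<le> u" using that s by simp
    have CU: "(\<lambda>z. indicator C z :: ennreal) \<in> borel_measurable (BE \<Otimes>\<^sub>M F u)"
      by (rule measurable_product_mono[OF s(1) that borel_measurable_indicator[OF C(1)]])
    have H: "H u \<in> borel_measurable (BE \<Otimes>\<^sub>M F u)"
      unfolding H_def
      by (intro borel_measurable_times_ennreal CU measurable_compose[OF ratio_measurable[OF u] measurable_ennreal])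
    have "(\<integral>\<^sup>+\<omega>. indicator D \<omega> * ennreal (Z \<omega> u) \<partial>M) = (\<integral>\<^sup>+\<omega>. H u (J \<omega>, \<omega>) \<partial>M)"
      using C(2) by (intro nn_integral_cong) (auto simp: H_def Z_def indicator_def)
    then show ?thesis unfolding disintegration[OF u H] .
  qed
  have "(\<integral>\<^sup>+x. \<integral>\<^sup>+\<omega>. H t (x, \<omega>) * ennreal (p x \<omega> t) \<partial>M \<partial>\<mu>)
      \<le> (\<integral>\<^sup>+x. \<integral>\<^sup>+\<omega>. H s (x, \<omega>) * ennreal (p x \<omega> s) \<partial>M \<partial>\<mu>)"
  proof (rule nn_integral_mono_AE, use super AE_space in eventually_elim)
    case (elim x)
    then have x: "x \<in> topspace E" by (simp add: space_law)
    define W :: "'a \<Rightarrow> ennreal" where "W \<omega> = indicator {\<omega> \<in> space M. (x, \<omega>) \<in> C} \<omega> * indicator {\<omega>. 0 < p x \<omega> s} \<omega>" for \<omega>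
    have p_mart: "martingale M F (p x)" using p_martingale[OF x] .
    have [measurable]: "(\<lambda>\<omega>. p x \<omega> s) \<in> borel_measurable (F s)"
      using p_mart s by (simp add: martingale_def adapted_def)
    have [measurable]: "{\<omega> \<in> space M. (x, \<omega>) \<in> C} \<in> sets (F s)"
      by (rule product_section_sets[OF s(1) x C(1)])
    have W: "W \<in> borel_measurable (F s)" unfolding W_def by measurable
    have "(\<integral>\<^sup>+\<omega>. indicator {0} (p x \<omega> s) * ennreal (p x \<omega> t) \<partial>M)
        = (\<integral>\<^sup>+\<omega>. indicator {0} (p x \<omega> s) * ennreal (p x \<omega> s) \<partial>M)"
      by (rule martingale_nn_integral[OF pr p_mart p_nonneg[OF x] s]) measurable
    also have "\<dots> = (\<integral>\<^sup>+\<omega>. 0 \<partial>M)"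
      by (intro nn_integral_cong) (simp add: indicator_def)
    finally have "(\<integral>\<^sup>+\<omega>. indicator {0} (p x \<omega> s) * ennreal (p x \<omega> t) \<partial>M) = 0" by simp
    moreover have "(\<lambda>\<omega>. indicator {0} (p x \<omega> s) * ennreal (p x \<omega> t) :: ennreal) \<in> borel_measurable M"
    proof -
      have "integrable M (\<lambda>\<omega>. p x \<omega> v)" if "0 \<le> v" for v
        using p_mart that by (simp add: martingale_def)
      note [measurable] = borel_measurable_integrable[OF this[OF s(1)]] borel_measurable_integrable[OF this[OF t]]
      show ?thesis by measurable
    qed
    ultimately have zero: "AE \<omega> in M. indicator {0} (p x \<omega> s) * ennreal (p x \<omega> t) = (0 :: ennreal)"
      by (subst (asm) nn_integral_0_iff_AE) auto
    have "(\<integral>\<^sup>+\<omega>. H t (x, \<omega>) * ennreal (p x \<omega> t) \<partial>M) \<le> (\<integral>\<^sup>+\<omega>. W \<omega> * ennreal (X x \<omega> t) \<partial>M)"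
    \<comment> \<open>Only an inequality: where \<open>p\<close> is positive at \<open>s\<close> but
      zero at \<open>t\<close>, the left side vanishes while the right side keeps
      \<open>X\<close>.\<close>
    proof (rule nn_integral_mono_AE, use zero AE_space in eventually_elim)
      case (elim \<omega>)
      note n = p_nonneg[OF x elim(2) s(1)] p_nonneg[OF x elim(2) t] X_nonneg[OF x elim(2) t]
      show ?case
      proof (cases "p x \<omega> t = 0")
        case False
        then have "0 < p x \<omega> s" using elim(1) n by (auto simp: indicator_def split: if_splits)
        moreover have "ennreal (X x \<omega> t / p x \<omega> t) * ennreal (p x \<omega> t) = ennreal (X x \<omega> t)"
          using False n by (simp add: ennreal_mult[symmetric])
        ultimately show ?thesis using elim(2) by (auto simp: H_def W_def indicator_def)
      qed simp
    qed
    also have "\<dots> \<le> (\<integral>\<^sup>+\<omega>. W \<omega> * ennreal (X x \<omega> s) \<partial>M)"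
      by (rule nonneg_supermartingale_nn_integral[OF pr elim(1) s W])
    also have "\<dots> = (\<integral>\<^sup>+\<omega>. H s (x, \<omega>) * ennreal (p x \<omega> s) \<partial>M)"
    proof (rule nn_integral_cong)
      fix \<omega> assume \<omega>: "\<omega> \<in> space M"
      note n = p_nonneg[OF x \<omega> s(1)] X_nonneg[OF x \<omega> s(1)]
      have "ennreal (X x \<omega> s / p x \<omega> s) * ennreal (p x \<omega> s) = ennreal (X x \<omega> s)" if "0 < p x \<omega> s"
        using that n by (simp add: ennreal_mult[symmetric])
      then show "W \<omega> * ennreal (X x \<omega> s) = H s (x, \<omega>) * ennreal (p x \<omega> s)"
        using \<omega> n by (auto simp: H_def W_def indicator_def)
    qed
    finally show ?case .
  qed
  then show ?thesis using s by (simp add: HZ)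
qed

text \<open>The limit in \<open>s\<close> is taken in an upper bound, where Fatou's lemma points the
  wrong way and no integrable majorant is at hand. Truncation preserves the inequality, by
  \<open>nn_integral_min_le\<close>, and supplies the constant \<open>K\<close> as majorant.\<close>

lemma Z_supermartingale_G:
  assumes super: "AE x in \<mu>. nonneg_supermartingale M F (X x)"
    and s: "0 \<le> s" "s \<le> t" and D: "D \<in> sets (G s)"
  shows "(\<integral>\<^sup>+\<omega>. indicator D \<omega> * ennreal (Z \<omega> t) \<partial>M) \<le> (\<integral>\<^sup>+\<omega>. indicator D \<omega> * ennreal (Z \<omega> s) \<partial>M)"
proof (cases "s < t")
  case True
  have t: "0 \<le> t" using s by simp
  obtain u where u: "\<And>m. s < u m" "\<And>m. u m < t" and ulim: "filterlim u (at_right s) sequentially"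
    using ex_right_sequence[OF True] by blast
  have u0: "0 \<le> u m" for m using u(1)[of m] s by simp
  have DM[measurable]: "D \<in> sets M" using D subalgebra_G[OF s(1)] by (auto simp: subalgebra_def)
  have ZM[measurable]: "(\<lambda>\<omega>. ennreal (Z \<omega> v)) \<in> borel_measurable M" if "0 \<le> v" for v
    using Z_measurable_M[OF that] by measurable
  have Dg: "D \<in> sets (G0 (u m))" for m
    using D sets_G_G0[OF s(1) u(1)] by auto
  show ?thesis
  proof (rule nn_integral_le_truncated)
    show "(\<lambda>\<omega>. indicator D \<omega> * ennreal (Z \<omega> t)) \<in> borel_measurable M"
      using ZM[OF t] by measurable
    fix K :: nat
    have "(\<integral>\<^sup>+\<omega>. min (of_nat K) (indicator D \<omega> * ennreal (Z \<omega> t)) \<partial>M)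
        \<le> (\<integral>\<^sup>+\<omega>. min (of_nat K) (indicator D \<omega> * ennreal (Z \<omega> (u m))) \<partial>M)" for m
    proof (rule nn_integral_min_le[OF subalgebra_G0[OF u0]])
      show "(\<lambda>\<omega>. indicator D \<omega> * ennreal (Z \<omega> t)) \<in> borel_measurable M"
        using ZM[OF t] by measurable
      show "(\<lambda>\<omega>. indicator D \<omega> * ennreal (Z \<omega> (u m))) \<in> borel_measurable (G0 (u m))"
        using Dg Z_measurable_G0[OF u0] by measurable
      fix D' assume "D' \<in> sets (G0 (u m))"
      then have "D' \<inter> D \<in> sets (G0 (u m))" using Dg by blast
      from Z_supermartingale_G0[OF super u0 less_imp_le[OF u(2)] this]
      show "(\<integral>\<^sup>+\<omega>. indicator D' \<omega> * (indicator D \<omega> * ennreal (Z \<omega> t)) \<partial>M)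
          \<le> (\<integral>\<^sup>+\<omega>. indicator D' \<omega> * (indicator D \<omega> * ennreal (Z \<omega> (u m))) \<partial>M)"
        by (simp add: indicator_inter_arith mult.assoc)
    qed
    moreover have "(\<lambda>m. \<integral>\<^sup>+\<omega>. min (of_nat K) (indicator D \<omega> * ennreal (Z \<omega> (u m))) \<partial>M)
        \<longlonglongrightarrow> (\<integral>\<^sup>+\<omega>. min (of_nat K) (indicator D \<omega> * ennreal (Z \<omega> s)) \<partial>M)"
    proof (rule nn_integral_dominated_convergence[where w="\<lambda>_. of_nat K"])
      show "(\<lambda>\<omega>. min (of_nat K) (indicator D \<omega> * ennreal (Z \<omega> (u m)))) \<in> borel_measurable M" for m
        using ZM[OF u0] by measurable
      show "(\<lambda>\<omega>. min (of_nat K) (indicator D \<omega> * ennreal (Z \<omega> s))) \<in> borel_measurable M"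
        using ZM[OF s(1)] by measurable
      show "AE \<omega> in M. (\<lambda>m. min (of_nat K) (indicator D \<omega> * ennreal (Z \<omega> (u m))))
          \<longlonglongrightarrow> min (of_nat K) (indicator D \<omega> * ennreal (Z \<omega> s))"
        using density_positive_AE[OF s(1)] AE_space
      proof eventually_elim
        case (elim \<omega>)
        have "(Z \<omega> \<longlongrightarrow> Z \<omega> s) (at_right s)"
          using Z_rc[OF elim(2) s(1) elim(1)] by (simp add: continuous_within)
        then have "(\<lambda>m. Z \<omega> (u m)) \<longlonglongrightarrow> Z \<omega> s"
          by (rule filterlim_compose[OF _ ulim])
        then show ?case
          by (intro tendsto_min tendsto_const ennreal_tendsto_cmult tendsto_ennrealI)
             (auto simp: indicator_def)
      qed
    qed (auto simp: emeasure_space_1 of_nat_less_top)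
    ultimately have "(\<integral>\<^sup>+\<omega>. min (of_nat K) (indicator D \<omega> * ennreal (Z \<omega> t)) \<partial>M)
        \<le> (\<integral>\<^sup>+\<omega>. min (of_nat K) (indicator D \<omega> * ennreal (Z \<omega> s)) \<partial>M)"
      by (intro LIMSEQ_le_const) auto
    also have "\<dots> \<le> (\<integral>\<^sup>+\<omega>. indicator D \<omega> * ennreal (Z \<omega> s) \<partial>M)"
      by (intro nn_integral_mono) simp
    finally show "(\<integral>\<^sup>+\<omega>. min (of_nat K) (indicator D \<omega> * ennreal (Z \<omega> t)) \<partial>M)
        \<le> (\<integral>\<^sup>+\<omega>. indicator D \<omega> * ennreal (Z \<omega> s) \<partial>M)" .
  qed
next
  case False
  then show ?thesis using s by simp
qed

lemma Z_supermartingale: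
  assumes super: "AE x in \<mu>. nonneg_supermartingale M F (X x)"
  shows "nonneg_supermartingale M G Z"
  unfolding nonneg_supermartingale_def
proof (intro conjI allI impI ballI filtration_G adapted_Z Z_nonneg)
  fix s t :: real assume s: "0 \<le> s" "s \<le> t"
  show "AE \<omega> in M. nn_cond_exp M (G s) (\<lambda>\<omega>. ennreal (Z \<omega> t)) \<omega> \<le> ennreal (Z \<omega> s)"
  proof (rule nn_cond_exp_leI)
    show "prob_space M" by unfold_locales
    show "subalgebra M (G s)" by (rule subalgebra_G[OF s(1)])
    show "(\<lambda>\<omega>. ennreal (Z \<omega> t)) \<in> borel_measurable M"
      using Z_measurable_M[of t] s by simp
    show "(\<lambda>\<omega>. ennreal (Z \<omega> s)) \<in> borel_measurable (G s)"
      using adapted_Z s by (auto simp: adapted_def)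
  qed (use Z_supermartingale_G[OF super s] in auto)
qed

end

section \<open>The localizing sequence\<close>

context jacod_enlargement
begin

lemma density_hitting_bound:
  assumes t: "0 \<le> t"
  shows "emeasure M {\<omega> \<in> space M. hitting_time (\<lambda>u. p (J \<omega>) \<omega> u < 1 / real (Suc n)) < ennreal t}
    \<le> ennreal (1 / real (Suc n))"
    and "{\<omega> \<in> space M. hitting_time (\<lambda>u. p (J \<omega>) \<omega> u < 1 / real (Suc n)) < ennreal t} \<in> sets M"
proof -
  let ?e = "1 / real (Suc n)"
  let ?Q = "\<lambda>x \<omega> u. p x \<omega> u < ?e"
  let ?T = "\<lambda>x \<omega>. hitting_time (?Q x \<omega>)"
  interpret L: prob_space \<mu> by (rule prob_space_law)
  have Q: "{z \<in> space (BE \<Otimes>\<^sub>M F q). ?Q (fst z) (snd z) q} \<in> sets (BE \<Otimes>\<^sub>M F q)" if "0 \<le> q" for q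
  proof -
    have [measurable]: "(\<lambda>z. p (fst z) (snd z) q) \<in> borel_measurable (BE \<Otimes>\<^sub>M F q)"
      using measurable_slice[OF filtration that p_measurable] by (simp add: case_prod_beta')
    show ?thesis by measurable
  qed
  have rc: "continuous (at_right s) (p x \<omega>)" if "x \<in> topspace E" "\<omega> \<in> space M" "0 \<le> s" for x \<omega> s
    using p_cadlag that cadlag_right_continuous by blast
  have opn: "eventually (?Q x \<omega>) (at_right s)"
    if "x \<in> topspace E" "\<omega> \<in> space M" "0 \<le> s" "?Q x \<omega> s" for x \<omega> s
    using rc[OF that(1-3)] that(4) by (auto simp: continuous_within intro: order_tendstoD)
  define C where "C = {z \<in> space (BE \<Otimes>\<^sub>M F t). ?T (fst z) (snd z) < ennreal t}"
  have C: "C \<in> sets (BE \<Otimes>\<^sub>M F t)"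
    unfolding C_def by (rule hitting_time_measurable[OF Q opn t order_refl])
  have D: "{\<omega> \<in> space M. ?T (J \<omega>) \<omega> < ennreal t} = (\<lambda>\<omega>. (J \<omega>, \<omega>)) -` C \<inter> space M"
    by (auto simp: C_def space_pair_measure space_borel_sets_of J_space space_F[OF t])
  show meas: "{\<omega> \<in> space M. ?T (J \<omega>) \<omega> < ennreal t} \<in> sets M"
    unfolding D by (rule measurable_sets[OF graph_measurable_M[OF t] C])
  have "emeasure M {\<omega> \<in> space M. ?T (J \<omega>) \<omega> < ennreal t}
      = (\<integral>\<^sup>+\<omega>. indicator ((\<lambda>\<omega>. (J \<omega>, \<omega>)) -` C \<inter> space M) \<omega> \<partial>M)"
    unfolding D by (rule nn_integral_indicator[OF measurable_sets[OF graph_measurable_M[OF t] C], symmetric])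
  also have "\<dots> = (\<integral>\<^sup>+\<omega>. indicator C (J \<omega>, \<omega>) \<partial>M)"
    by (intro nn_integral_cong) (simp add: indicator_def)
  also have "\<dots> = (\<integral>\<^sup>+x. \<integral>\<^sup>+\<omega>. indicator C (x, \<omega>) * ennreal (p x \<omega> t) \<partial>M \<partial>\<mu>)"
    by (rule disintegration[OF t borel_measurable_indicator[OF C]])
  also have "\<dots> \<le> (\<integral>\<^sup>+x. ennreal ?e \<partial>\<mu>)"
  proof (rule nn_integral_mono)
    fix x assume "x \<in> space \<mu>"
    then have x: "x \<in> topspace E" by (simp add: space_law)
    have "(\<integral>\<^sup>+\<omega>. indicator C (x, \<omega>) * ennreal (p x \<omega> t) \<partial>M)
        = (\<integral>\<^sup>+\<omega>. indicator {\<omega>. ?T x \<omega> < ennreal t} \<omega> * ennreal (p x \<omega> t) \<partial>M)"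
      using x by (intro nn_integral_cong)
        (auto simp: C_def space_pair_measure space_borel_sets_of space_F[OF t] indicator_def)
    also have "\<dots> \<le> ennreal ?e"
    proof (rule martingale_hitting_bound[OF _ p_martingale[OF x] p_nonneg[OF x] rc[OF x] _ _ t])
      show "prob_space M" by unfold_locales
      show "extended_stopping_time M F (?T x)"
        by (rule hitting_time_stopping_F[OF Q opn x])
      fix \<omega> r assume \<omega>: "\<omega> \<in> space M" and r: "0 \<le> r" "?T x \<omega> = ennreal r"
      show "p x \<omega> r \<le> ?e"
      \<comment> \<open>The level is crossed strictly, so the value at the hitting time may equal
        \<open>?e\<close>; were it larger, right-continuity would keep \<open>p\<close> above the
        level for a while.\<close>
      proof (rule ccontr)
        assume "\<not> p x \<omega> r \<le> ?e"
        moreover have "(p x \<omega> \<longlongrightarrow> p x \<omega> r) (at_right r)"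
          using rc[OF x \<omega> r(1)] by (simp add: continuous_within)
        ultimately have "eventually (\<lambda>u. ?e < p x \<omega> u) (at_right r)"
          by (intro order_tendstoD) auto
        then have "eventually (\<lambda>u. \<not> p x \<omega> u < ?e) (at_right r)"
          by eventually_elim simp
        then show False
          using at_hitting_time[OF r] \<open>\<not> p x \<omega> r \<le> ?e\<close> by auto
      qed
    qed auto
    finally show "(\<integral>\<^sup>+\<omega>. indicator C (x, \<omega>) * ennreal (p x \<omega> t) \<partial>M) \<le> ennreal ?e" .
  qed
  also have "\<dots> = ennreal ?e" by (simp add: L.emeasure_space_1)
  finally show "emeasure M {\<omega> \<in> space M. ?T (J \<omega>) \<omega> < ennreal t} \<le> ennreal ?e" .
qed

text \<open>The events that \<open>p\<close> along \<open>J\<close> falls below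
  \<open>1 / Suc n\<close> before \<open>k\<close> have probability at most
  \<open>1 / Suc n\<close>, so their intersection is null. A lower bound on \<open>[0, k)\<close>,
  unlike mere positivity, also keeps the left limits away from zero.\<close>

lemma density_bounded_below_AE:
  "AE \<omega> in M. \<forall>k::nat. \<exists>n. \<forall>u. 0 \<le> u \<longrightarrow> u < real k \<longrightarrow> 1 / real (Suc n) \<le> p (J \<omega>) \<omega> u"
proof (subst AE_all_countable, intro allI)
  fix k :: nat
  let ?D = "\<lambda>n. {\<omega> \<in> space M. hitting_time (\<lambda>u. p (J \<omega>) \<omega> u < 1 / real (Suc n)) < ennreal (real k)}"
  have D: "?D n \<in> sets M" for n by (rule density_hitting_bound) simp
  then have "(\<Inter>n. ?D n) \<in> sets M" by auto
  moreover have "emeasure M (\<Inter>n. ?D n) = 0"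
  proof -
    have "emeasure M (\<Inter>n. ?D n) \<le> ennreal (1 / real (Suc m))" for m
    proof -
      have "emeasure M (\<Inter>n. ?D n) \<le> emeasure M (?D m)"
        by (intro emeasure_mono D) auto
      also have "\<dots> \<le> ennreal (1 / real (Suc m))"
        by (rule density_hitting_bound) simp
      finally show ?thesis .
    qed
    moreover have "(\<lambda>m. ennreal (1 / real (Suc m))) \<longlonglongrightarrow> ennreal 0"
      by (intro tendsto_ennrealI LIMSEQ_Suc[OF lim_1_over_n])
    ultimately have "emeasure M (\<Inter>n. ?D n) \<le> ennreal 0"
      by (intro LIMSEQ_le_const[where X="\<lambda>m. ennreal (1 / real (Suc m))"]) auto
    then show ?thesis by simp
  qed
  ultimately have "(\<Inter>n. ?D n) \<in> null_sets M" by auto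
  then have "AE \<omega> in M. \<omega> \<notin> (\<Inter>n. ?D n)" by (rule AE_not_in)
  then show "AE \<omega> in M. \<exists>n. \<forall>u. 0 \<le> u \<longrightarrow> u < real k \<longrightarrow> 1 / real (Suc n) \<le> p (J \<omega>) \<omega> u"
    using AE_space
  proof eventually_elim
    case (elim \<omega>)
    then obtain n where n: "ennreal (real k) \<le> hitting_time (\<lambda>u. p (J \<omega>) \<omega> u < 1 / real (Suc n))"
      by (auto simp: not_less)
    show ?case
    proof (intro exI allI impI)
      fix u :: real assume u: "0 \<le> u" "u < real k"
      then have "ennreal u < ennreal (real k)" by (simp add: ennreal_less_iff)
      then have "ennreal u < hitting_time (\<lambda>u. p (J \<omega>) \<omega> u < 1 / real (Suc n))"
        using n by (rule less_le_trans)
      then show "1 / real (Suc n) \<le> p (J \<omega>) \<omega> u"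
        using not_before_hitting_time[OF u(1)] by (meson not_less)
    qed
  qed
qed

lemma density_positive_everywhere_AE: "AE \<omega> in M. \<forall>t\<ge>0. 0 < p (J \<omega>) \<omega> t"
  using density_bounded_below_AE
proof eventually_elim
  case (elim \<omega>)
  show ?case
  proof (intro allI impI)
    fix t :: real assume t: "0 \<le> t"
    obtain k :: nat where "t < real k" using reals_Archimedean2 by blast
    with elim t obtain n where "1 / real (Suc n) \<le> p (J \<omega>) \<omega> t" by blast
    then show "0 < p (J \<omega>) \<omega> t" by (rule less_le_trans[rotated]) simp
  qed
qed

end

context enlarged_family
begin

text \<open>Both conditions are strict, so by right-continuity they persist for a while and rational
  times detect them. \<open>Suc n\<close> avoids a division by zero at \<open>n = 0\<close>.\<close>

definition crossing :: "nat \<Rightarrow> 'e \<Rightarrow> 'a \<Rightarrow> real \<Rightarrow> bool" where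
  "crossing n x \<omega> u \<longleftrightarrow> real (Suc n) < X x \<omega> u \<or> p x \<omega> u < 1 / real (Suc n)"

definition T :: "nat \<Rightarrow> 'e \<Rightarrow> 'a \<Rightarrow> ennreal" where
  "T n x \<omega> = hitting_time (crossing n x \<omega>)"

lemma crossing_sets:
  assumes "0 \<le> q"
  shows "{z \<in> space (BE \<Otimes>\<^sub>M F q). crossing n (fst z) (snd z) q} \<in> sets (BE \<Otimes>\<^sub>M F q)"
proof -
  note [measurable] = X_slice[OF assms] p_slice[OF assms]
  show ?thesis unfolding crossing_def by measurable
qed

lemma crossing_open:
  assumes "x \<in> topspace E" "\<omega> \<in> space M" "0 \<le> s" "crossing n x \<omega> s"
  shows "eventually (crossing n x \<omega>) (at_right s)"
proof -
  have X: "(X x \<omega> \<longlongrightarrow> X x \<omega> s) (at_right s)" and p: "(p x \<omega> \<longlongrightarrow> p x \<omega> s) (at_right s)"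
    using X_rc[OF assms(1-3)] p_rc[OF assms(1-3)] by (simp_all add: continuous_within)
  from assms(4) show ?thesis
    unfolding crossing_def
  proof
    assume "real (Suc n) < X x \<omega> s"
    from order_tendstoD(1)[OF X this] show "eventually (\<lambda>u. real (Suc n) < X x \<omega> u \<or> p x \<omega> u < 1 / real (Suc n)) (at_right s)"
      by (rule eventually_mono) simp
  next
    assume "p x \<omega> s < 1 / real (Suc n)"
    from order_tendstoD(2)[OF p this] show "eventually (\<lambda>u. real (Suc n) < X x \<omega> u \<or> p x \<omega> u < 1 / real (Suc n)) (at_right s)"
      by (rule eventually_mono) simp
  qed
qed

lemma T_stopping_F: "x \<in> topspace E \<Longrightarrow> extended_stopping_time M F (T n x)"
  unfolding T_def[abs_def] by (rule hitting_time_stopping_F[where Q="crossing n", OF crossing_sets crossing_open])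

lemma T_stopping_G: "extended_stopping_time M G (\<lambda>\<omega>. T n (J \<omega>) \<omega>)"
  unfolding T_def by (rule hitting_time_stopping_G[where Q="crossing n", OF crossing_sets crossing_open])

lemma before_T:
  assumes "0 \<le> u" "ennreal u < T n x \<omega>"
  shows "X x \<omega> u \<le> real (Suc n)" "1 / real (Suc n) \<le> p x \<omega> u"
  using not_before_hitting_time[of u "crossing n x \<omega>"] assms
  by (simp_all add: T_def crossing_def not_less del: of_nat_Suc)

lemma T_geI:
  assumes "\<And>u. 0 \<le> u \<Longrightarrow> ennreal u < c \<Longrightarrow> X x \<omega> u \<le> real (Suc n) \<and> 1 / real (Suc n) \<le> p x \<omega> u"
  shows "c \<le> T n x \<omega>"
  unfolding T_def
proof (rule hitting_time_geI)
  fix u assume "0 \<le> u" "crossing n x \<omega> u"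
  then show "c \<le> ennreal u"
    using assms[of u] by (auto simp: crossing_def not_less[symmetric])
qed

lemma T_incseq: "incseq (\<lambda>n. T n x \<omega>)"
proof (rule incseq_SucI)
  fix n
  show "T n x \<omega> \<le> T (Suc n) x \<omega>"
  proof (rule T_geI)
    fix u assume u: "0 \<le> u" "ennreal u < T n x \<omega>"
    have "1 / real (Suc (Suc n)) \<le> 1 / real (Suc n)"
      by (intro divide_left_mono) auto
    then show "X x \<omega> u \<le> real (Suc (Suc n)) \<and> 1 / real (Suc (Suc n)) \<le> p x \<omega> u"
      using before_T[OF u] by linarith
  qed
qed

text \<open>Up to time \<open>k\<close> the path of \<open>X\<close> along \<open>J\<close> is
  bounded because it is cadlag, and \<open>p\<close> is bounded away from zero. A level beyond both
  pathwise bounds delays \<open>T\<close> until \<open>k\<close>.\<close>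

lemma T_tendsto_AE: "AE \<omega> in M. (\<lambda>n. T n (J \<omega>) \<omega>) \<longlonglongrightarrow> \<infinity>"
  using density_bounded_below_AE AE_space
proof eventually_elim
  case (elim \<omega>)
  have "(SUP n. T n (J \<omega>) \<omega>) = top"
  proof (rule ennreal_SUP_eq_top)
    fix k :: nat
    obtain n where n: "\<And>u. 0 \<le> u \<Longrightarrow> u < real k \<Longrightarrow> 1 / real (Suc n) \<le> p (J \<omega>) \<omega> u"
      using elim(1) by blast
    obtain c where c: "\<And>u. 0 \<le> u \<Longrightarrow> u \<le> real k \<Longrightarrow> X (J \<omega>) \<omega> u \<le> c"
      using cadlag_bounded[OF X_cadlag[OF J_space[OF elim(2)] elim(2)], of "real k"] by auto
    obtain l :: nat where l: "c < real l" using reals_Archimedean2 by blast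
    have "ennreal (real k) \<le> T (max n l) (J \<omega>) \<omega>"
    proof (rule T_geI)
      fix u assume u: "0 \<le> u" "ennreal u < ennreal (real k)"
      then have uk: "u < real k" by (simp add: ennreal_less_iff)
      have "1 / real (Suc (max n l)) \<le> 1 / real (Suc n)"
        by (intro divide_left_mono) auto
      then show "X (J \<omega>) \<omega> u \<le> real (Suc (max n l)) \<and> 1 / real (Suc (max n l)) \<le> p (J \<omega>) \<omega> u"
        using n[OF u(1) uk] c[OF u(1) less_imp_le[OF uk]] l by auto
    qed
    then show "\<exists>i\<in>UNIV. of_nat k \<le> T i (J \<omega>) \<omega>"
      by (auto simp: ennreal_of_nat_eq_real_of_nat)
  qed
  with LIMSEQ_SUP[OF T_incseq[of "J \<omega>" \<omega>]] show ?case by simp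
qed

text \<open>The quotient of the left limits makes sense because the lower bound on \<open>p\<close>
  along \<open>J\<close> passes to its left limit.\<close>

lemma Z_cadlag_AE: "AE \<omega> in M. cadlag (Z \<omega>)"
  using density_bounded_below_AE density_positive_everywhere_AE AE_space
proof eventually_elim
  case (elim \<omega>)
  note J = J_space[OF elim(3)]
  show ?case
    unfolding cadlag_def
  proof (intro conjI allI impI)
    fix t :: real assume "0 \<le> t"
    then show "continuous (at_right t) (Z \<omega>)" using elim by (intro Z_rc) auto
  next
    fix t :: real assume t: "0 < t"
    obtain k :: nat where k: "t < real k" using reals_Archimedean2 by blast
    obtain n where n: "\<And>u. 0 \<le> u \<Longrightarrow> u < real k \<Longrightarrow> 1 / real (Suc n) \<le> p (J \<omega>) \<omega> u"
      using elim(1) by blast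
    obtain a b where a: "(X (J \<omega>) \<omega> \<longlongrightarrow> a) (at_left t)" and b: "(p (J \<omega>) \<omega> \<longlongrightarrow> b) (at_left t)"
      using X_cadlag[OF J elim(3)] p_cadlag[OF J elim(3)] t unfolding cadlag_def by blast
    have "eventually (\<lambda>u. 1 / real (Suc n) \<le> p (J \<omega>) \<omega> u) (at_left t)"
      unfolding eventually_at_left[OF t] using n k t by (intro exI[of _ 0]) auto
    then have "1 / real (Suc n) \<le> b" using b by (intro tendsto_lowerbound) auto
    then have "b \<noteq> 0" by (auto simp del: of_nat_Suc)
    then have "(Z \<omega> \<longlongrightarrow> a / b) (at_left t)"
      unfolding Z_def[abs_def] by (intro tendsto_divide a b)
    then show "\<exists>l. (Z \<omega> \<longlongrightarrow> l) (at_left t)" by blast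
  qed
qed

section \<open>The stopped ratio\<close>

text \<open>\<open>Z\<close> stopped at \<open>T n\<close> along \<open>J\<close>, in the form that
  \<open>local_martingale\<close> demands. Where \<open>T n\<close> is positive the level bounds
  hold already at time \<open>0\<close>.\<close>

definition Y :: "nat \<Rightarrow> 'a process" where
  "Y n \<omega> t = (if 0 < T n (J \<omega>) \<omega> then Z \<omega> (capped (T n (J \<omega>) \<omega>) t) else 0)"

lemma Y_nonneg: "\<omega> \<in> space M \<Longrightarrow> 0 \<le> t \<Longrightarrow> 0 \<le> Y n \<omega> t"
  using Z_nonneg capped_bounds by (simp add: Y_def)

lemma T_less_sets:
  assumes "0 \<le> u" "u \<le> t"
  shows "{z \<in> space (BE \<Otimes>\<^sub>M F t). T n (fst z) (snd z) < ennreal u} \<in> sets (BE \<Otimes>\<^sub>M F t)"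
  unfolding T_def by (rule hitting_time_measurable[where Q="crossing n", OF crossing_sets crossing_open assms])

lemma T_after_sets:
  assumes "0 \<le> t" "t < s"
  shows "{z \<in> space (BE \<Otimes>\<^sub>M F s). ennreal t < T n (fst z) (snd z)} \<in> sets (BE \<Otimes>\<^sub>M F s)"
  unfolding T_def by (rule hitting_time_positive_measurable[where Q="crossing n", OF crossing_sets crossing_open assms])

lemma stopped_slice_measurable:
  fixes V :: "'e \<Rightarrow> 'a process"
  assumes V: "\<And>u. 0 \<le> u \<Longrightarrow> (\<lambda>z. V (fst z) (snd z) u) \<in> borel_measurable (BE \<Otimes>\<^sub>M F u)"
    and rc: "\<And>x \<omega> u. x \<in> topspace E \<Longrightarrow> \<omega> \<in> space M \<Longrightarrow> 0 \<le> u \<Longrightarrow> continuous (at_right u) (V x \<omega>)"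
    and t: "0 \<le> t" "t \<le> s"
  shows "(\<lambda>z. V (fst z) (snd z) (capped (T n (fst z) (snd z)) t)) \<in> borel_measurable (BE \<Otimes>\<^sub>M F s)"
proof (rule measurable_product_mono[OF t])
  show "(\<lambda>z. V (fst z) (snd z) (capped (T n (fst z) (snd z)) t)) \<in> borel_measurable (BE \<Otimes>\<^sub>M F t)"
  proof (rule borel_measurable_at_time[OF t(1), where f="\<lambda>z. V (fst z) (snd z)"])
    show "(\<lambda>z. V (fst z) (snd z) u) \<in> borel_measurable (BE \<Otimes>\<^sub>M F t)" if "0 \<le> u" "u \<le> t" for u
      using that by (intro measurable_product_mono[OF that] V)
    show "(\<lambda>z. capped (T n (fst z) (snd z)) t) \<in> borel_measurable (BE \<Otimes>\<^sub>M F t)"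
      by (rule capped_borel_measurable[OF T_less_sets t(1)])
    show "continuous (at_right u) (V (fst z) (snd z))"
      if "z \<in> space (BE \<Otimes>\<^sub>M F t)" "0 \<le> u" "u < t" for z u
      using that t by (intro rc) (auto simp: space_pair_measure space_borel_sets_of space_F)
  qed (use capped_bounds[OF t(1)] in auto)
qed

lemma stopped_ratio_measurable:
  assumes "0 \<le> t" "t \<le> s"
  shows "(\<lambda>z. X (fst z) (snd z) (capped (T n (fst z) (snd z)) t) / p (fst z) (snd z) (capped (T n (fst z) (snd z)) t))
    \<in> borel_measurable (BE \<Otimes>\<^sub>M F s)"
  by (rule borel_measurable_divide[OF stopped_slice_measurable[where V=X, OF X_slice X_rc assms]
    stopped_slice_measurable[where V=p, OF p_slice p_rc assms]])

text \<open>\<open>s\<close> lies strictly after \<open>t\<close> because, for \<open>t = 0\<close>,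
  the event \<open>0 < T n\<close> is provided by \<open>T_after_sets\<close> at later
  times.\<close>

lemma Y_measurable_G0:
  assumes t: "0 \<le> t" "t < s"
  shows "(\<lambda>\<omega>. Y n \<omega> t) \<in> borel_measurable (G0 s)"
proof -
  have s: "0 \<le> s" using t by simp
  define f where "f z = (if z \<in> {z \<in> space (BE \<Otimes>\<^sub>M F s). ennreal 0 < T n (fst z) (snd z)}
    then X (fst z) (snd z) (capped (T n (fst z) (snd z)) t) / p (fst z) (snd z) (capped (T n (fst z) (snd z)) t) else 0)" for z
  have "f \<in> borel_measurable (BE \<Otimes>\<^sub>M F s)"
    unfolding f_def using s t
    by (intro measurable_If_set stopped_ratio_measurable measurable_const sets.Int T_after_sets) auto
  from measurable_compose[OF graph_measurable[OF s] this]
  show ?thesis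
    by (rule measurable_cong[THEN iffD1, rotated])
       (auto simp: f_def Y_def Z_def space_G0 space_pair_measure space_borel_sets_of space_F[OF s] J_space)
qed

lemma adapted_Y: "adapted G (Y n)"
  unfolding adapted_def by (intro allI impI measurable_GI Y_measurable_G0)

lemma Y_measurable_M: "0 \<le> t \<Longrightarrow> (\<lambda>\<omega>. Y n \<omega> t) \<in> borel_measurable M"
  using borel_measurable_G0_M[OF _ Y_measurable_G0[of t "t + 1"]] by simp

lemma Y_rc_AE: "AE \<omega> in M. \<forall>s\<ge>0. continuous (at_right s) (Y n \<omega>)"
  using density_positive_everywhere_AE AE_space
proof eventually_elim
  case (elim \<omega>)
  show ?case
  proof (intro allI impI)
    fix s :: real assume "0 \<le> s"
    then have "continuous (at_right s) (\<lambda>v. Z \<omega> (capped (T n (J \<omega>) \<omega>) v))"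
      using elim Z_rc by (intro right_continuous_stopped_path) auto
    then show "continuous (at_right s) (Y n \<omega>)"
      by (cases "0 < T n (J \<omega>) \<omega>") (simp_all add: Y_def[abs_def])
  qed
qed

end

section \<open>Martingale property of the stopped ratio\<close>

context enlarged_family
begin

text \<open>The hypotheses of the second statement at a single \<open>x\<close>:
  \<open>jump_to_zero (p x \<omega>)\<close> is the time \<open>\<eta>\<close>, and one null set for
  all \<open>t\<close> expresses inclusion up to evanescence.\<close>

definition localizable :: "'e \<Rightarrow> bool" where
  "localizable x \<longleftrightarrow> local_martingale M F (X x) \<and>
    (AE \<omega> in M. \<forall>t\<ge>0. jump_to_zero (p x \<omega>) \<le> ennreal t \<longrightarrow> X x \<omega> t = 0)"

text \<open>The case of \<open>sampled_ratio\<close> that the disintegration calls for: the section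
  of a product event, cut down to \<open>s < T\<close>. Cutting down costs no measurability, since
  for fixed \<open>x\<close> this is an event of \<open>F s\<close>.\<close>

lemma sampled_ratio_section:
  assumes x: "x \<in> topspace E" and loc: "localizable x"
    and s: "0 \<le> s" "s < t" and C: "C \<in> sets (BE \<Otimes>\<^sub>M F s)"
  shows "(\<integral>\<^sup>+\<omega>. indicator {\<omega> \<in> space M. (x, \<omega>) \<in> C \<and> ennreal s < T n x \<omega>} \<omega>
        * ennreal (X x \<omega> (capped (T n x \<omega>) t) / p x \<omega> (capped (T n x \<omega>) t)) * ennreal (p x \<omega> t) \<partial>M)
    = (\<integral>\<^sup>+\<omega>. indicator {\<omega> \<in> space M. (x, \<omega>) \<in> C \<and> ennreal s < T n x \<omega>} \<omega>
        * ennreal (X x \<omega> s / p x \<omega> s) * ennreal (p x \<omega> t) \<partial>M)"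
proof (rule sampled_ratio[where c="real (Suc n)" and F=F])
  show "prob_space M" by unfold_locales
  show "local_martingale M F (X x)" using loc by (simp add: localizable_def)
  show "martingale M F (p x)" by (rule p_martingale[OF x])
  show "extended_stopping_time M F (T n x)" by (rule T_stopping_F[OF x])
  show "0 < p x \<omega> u" if "0 \<le> u" "ennreal u < T n x \<omega>" for \<omega> u
    using before_T(2)[OF that] by (rule less_le_trans[rotated]) simp
  have "{\<omega> \<in> space M. (x, \<omega>) \<in> C} \<inter> {\<omega> \<in> space M. ennreal s < T n x \<omega>} \<in> sets (F s)"
    using product_section_sets[OF s(1) x C] stopping_time_after_sets[OF filtration T_stopping_F[OF x] s(1)]
    by (rule sets.Int)
  then show "{\<omega> \<in> space M. (x, \<omega>) \<in> C \<and> ennreal s < T n x \<omega>} \<in> sets (F s)"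
    by (rule back_subst[where P="\<lambda>A. A \<in> sets (F s)"]) auto
  have "AE \<omega> in M. \<forall>t\<ge>0. jump_to_zero (p x \<omega>) \<le> ennreal t \<longrightarrow> X x \<omega> t = 0"
    using loc by (simp add: localizable_def)
  then show "AE \<omega> in M. 0 < T n x \<omega> \<longrightarrow> p x \<omega> (capped (T n x \<omega>) t) = 0 \<longrightarrow> X x \<omega> (capped (T n x \<omega>) t) = 0"
    using AE_space
  proof eventually_elim
    case (elim \<omega>)
    have t: "0 \<le> t" using s by simp
    show ?case
    proof (intro impI)
      assume "0 < T n x \<omega>" "p x \<omega> (capped (T n x \<omega>) t) = 0"
      then have "jump_to_zero (p x \<omega>) \<le> ennreal (capped (T n x \<omega>) t)"
        using before_T(2)
        by (intro jump_to_zero_at_time[OF p_cadlag[OF x elim(2)], where e="1 / real (Suc n)"] t) auto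
      then show "X x \<omega> (capped (T n x \<omega>) t) = 0"
        using elim(1) capped_bounds[OF t] by auto
    qed
  qed
qed (use x s X_nonneg X_rc p_nonneg p_rc before_T(1) in auto)

text \<open>Split \<open>D\<close> by whether \<open>s < T\<close> along \<open>J\<close>. Where
  \<open>T\<close> is at most \<open>s\<close> the process is frozen. On the other part both
  integrals are disintegrated at the same time \<open>t\<close>, because \<open>T_after_sets\<close>
  gives the event \<open>s < T\<close> in the product at times after \<open>s\<close>; the sections
  are then compared at fixed \<open>x\<close>.\<close>

lemma Y_martingale_G0:
  assumes loc: "AE x in \<mu>. localizable x"
    and s: "0 \<le> s" "s < t" and D: "D \<in> sets (G0 s)"
  shows "(\<integral>\<^sup>+\<omega>. indicator D \<omega> * ennreal (Y n \<omega> t) \<partial>M) = (\<integral>\<^sup>+\<omega>. indicator D \<omega> * ennreal (Y n \<omega> s) \<partial>M)"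
proof -
  have t: "0 \<le> t" using s by simp
  obtain C where C: "C \<in> sets (BE \<Otimes>\<^sub>M F s)" "\<And>\<omega>. \<omega> \<in> space M \<Longrightarrow> \<omega> \<in> D \<longleftrightarrow> (J \<omega>, \<omega>) \<in> C"
    using sets_G0_graph[OF s(1) D] by metis
  define C' where "C' = C \<inter> {z \<in> space (BE \<Otimes>\<^sub>M F t). ennreal s < T n (fst z) (snd z)}"
  have "(\<lambda>z. z) -` C \<inter> space (BE \<Otimes>\<^sub>M F t) \<in> sets (BE \<Otimes>\<^sub>M F t)"
    by (rule measurable_sets[OF measurable_product_mono[OF s(1) less_imp_le[OF s(2)]] C(1)]) simp
  moreover have "C \<subseteq> space (BE \<Otimes>\<^sub>M F t)"
    using sets.sets_into_space[OF C(1)] by (simp add: space_pair_measure space_F[OF s(1)] space_F[OF t])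
  ultimately have "C \<in> sets (BE \<Otimes>\<^sub>M F t)"
    by (simp add: Int_absorb2)
  then have C': "C' \<in> sets (BE \<Otimes>\<^sub>M F t)"
    unfolding C'_def by (rule sets.Int[OF _ T_after_sets[OF s]])
  define A where "A = {\<omega> \<in> space M. ennreal s < T n (J \<omega>) \<omega>}"
  have A: "A \<in> sets M"
  proof -
    have "A = (\<lambda>\<omega>. (J \<omega>, \<omega>)) -` {z \<in> space (BE \<Otimes>\<^sub>M F t). ennreal s < T n (fst z) (snd z)} \<inter> space M"
      by (auto simp: A_def space_pair_measure space_borel_sets_of J_space space_F[OF t])
    also have "\<dots> \<in> sets M"
      by (rule measurable_sets[OF graph_measurable_M[OF t] T_after_sets[OF s]])
    finally show ?thesis .
  qed
  have DM: "D \<in> sets M" using D subalgebra_G0[OF s(1)] by (auto simp: subalgebra_def)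
  note YM[measurable] = Y_measurable_M[OF t, of n] Y_measurable_M[OF s(1), of n]
  define Ht where "Ht z = indicator C' z * ennreal (X (fst z) (snd z) (capped (T n (fst z) (snd z)) t)
      / p (fst z) (snd z) (capped (T n (fst z) (snd z)) t))" for z
  define Hs where "Hs z = indicator C' z * ennreal (X (fst z) (snd z) s / p (fst z) (snd z) s)" for z
  have Ht: "Ht \<in> borel_measurable (BE \<Otimes>\<^sub>M F t)"
    unfolding Ht_def
    by (intro borel_measurable_times_ennreal borel_measurable_indicator C'
      measurable_compose[OF stopped_ratio_measurable[OF t order_refl] measurable_ennreal])
  have Hs: "Hs \<in> borel_measurable (BE \<Otimes>\<^sub>M F t)"
    unfolding Hs_def
    by (intro borel_measurable_times_ennreal borel_measurable_indicator C'
      measurable_compose[OF measurable_product_mono[OF s(1) less_imp_le[OF s(2)] ratio_measurable[OF s(1)]] measurable_ennreal])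
  have pos: "0 < T n x \<omega>" if "ennreal s < T n x \<omega>" for x \<omega>
    using that by (meson le_less_trans zero_le)
  have C'_iff: "(J \<omega>, \<omega>) \<in> C' \<longleftrightarrow> \<omega> \<in> D \<and> \<omega> \<in> A" if "\<omega> \<in> space M" for \<omega>
    using C(2)[OF that] that
    by (auto simp: C'_def A_def space_pair_measure space_borel_sets_of J_space space_F[OF t])
  have "(\<integral>\<^sup>+\<omega>. indicator (D \<inter> A) \<omega> * ennreal (Y n \<omega> t) \<partial>M) = (\<integral>\<^sup>+\<omega>. Ht (J \<omega>, \<omega>) \<partial>M)"
    using pos by (intro nn_integral_cong) (auto simp: Ht_def C'_iff Y_def Z_def A_def indicator_def)
  also have "\<dots> = (\<integral>\<^sup>+x. \<integral>\<^sup>+\<omega>. Ht (x, \<omega>) * ennreal (p x \<omega> t) \<partial>M \<partial>\<mu>)"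
    by (rule disintegration[OF t Ht])
  also have "\<dots> = (\<integral>\<^sup>+x. \<integral>\<^sup>+\<omega>. Hs (x, \<omega>) * ennreal (p x \<omega> t) \<partial>M \<partial>\<mu>)"
  proof (rule nn_integral_cong_AE, use loc AE_space in eventually_elim)
    case (elim x)
    then have x: "x \<in> topspace E" by (simp add: space_law)
    have sec: "indicator C' (x, \<omega>) = (indicator {\<omega> \<in> space M. (x, \<omega>) \<in> C \<and> ennreal s < T n x \<omega>} \<omega> :: ennreal)"
      if "\<omega> \<in> space M" for \<omega>
      using that x by (auto simp: C'_def indicator_def space_pair_measure space_borel_sets_of space_F[OF t])
    have "(\<integral>\<^sup>+\<omega>. Ht (x, \<omega>) * ennreal (p x \<omega> t) \<partial>M)
      = (\<integral>\<^sup>+\<omega>. indicator {\<omega> \<in> space M. (x, \<omega>) \<in> C \<and> ennreal s < T n x \<omega>} \<omega>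
        * ennreal (X x \<omega> (capped (T n x \<omega>) t) / p x \<omega> (capped (T n x \<omega>) t)) * ennreal (p x \<omega> t) \<partial>M)"
      by (intro nn_integral_cong) (simp add: Ht_def sec)
    also have "\<dots> = (\<integral>\<^sup>+\<omega>. indicator {\<omega> \<in> space M. (x, \<omega>) \<in> C \<and> ennreal s < T n x \<omega>} \<omega>
        * ennreal (X x \<omega> s / p x \<omega> s) * ennreal (p x \<omega> t) \<partial>M)"
      by (rule sampled_ratio_section[OF x elim(1) s C(1)])
    also have "\<dots> = (\<integral>\<^sup>+\<omega>. Hs (x, \<omega>) * ennreal (p x \<omega> t) \<partial>M)"
      by (intro nn_integral_cong) (simp add: Hs_def sec)
    finally show ?case .
  qed
  also have "\<dots> = (\<integral>\<^sup>+\<omega>. Hs (J \<omega>, \<omega>) \<partial>M)"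
    by (rule disintegration[OF t Hs, symmetric])
  also have "\<dots> = (\<integral>\<^sup>+\<omega>. indicator (D \<inter> A) \<omega> * ennreal (Y n \<omega> s) \<partial>M)"
    using pos s by (intro nn_integral_cong)
      (auto simp: Hs_def C'_iff Y_def Z_def A_def indicator_def capped_eq)
  finally have after: "(\<integral>\<^sup>+\<omega>. indicator (D \<inter> A) \<omega> * ennreal (Y n \<omega> t) \<partial>M)
      = (\<integral>\<^sup>+\<omega>. indicator (D \<inter> A) \<omega> * ennreal (Y n \<omega> s) \<partial>M)" .
  have before: "(\<integral>\<^sup>+\<omega>. indicator (D - A) \<omega> * ennreal (Y n \<omega> t) \<partial>M)
      = (\<integral>\<^sup>+\<omega>. indicator (D - A) \<omega> * ennreal (Y n \<omega> s) \<partial>M)"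
  proof (rule nn_integral_cong)
    fix \<omega> assume "\<omega> \<in> space M"
    then show "indicator (D - A) \<omega> * ennreal (Y n \<omega> t) = indicator (D - A) \<omega> * ennreal (Y n \<omega> s)"
      using capped_stops[OF s(1) less_imp_le[OF s(2)], of "T n (J \<omega>) \<omega>"]
      by (auto simp: A_def indicator_def Y_def)
  qed
  have split: "(\<integral>\<^sup>+\<omega>. indicator D \<omega> * ennreal (Y n \<omega> u) \<partial>M)
      = (\<integral>\<^sup>+\<omega>. indicator (D \<inter> A) \<omega> * ennreal (Y n \<omega> u) \<partial>M)
        + (\<integral>\<^sup>+\<omega>. indicator (D - A) \<omega> * ennreal (Y n \<omega> u) \<partial>M)" if "0 \<le> u" for u
  proof -
    have Yu: "(\<lambda>\<omega>. ennreal (Y n \<omega> u)) \<in> borel_measurable M"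
      by (rule measurable_compose[OF Y_measurable_M[OF that] measurable_ennreal])
    have "(\<integral>\<^sup>+\<omega>. indicator D \<omega> * ennreal (Y n \<omega> u) \<partial>M)
      = (\<integral>\<^sup>+\<omega>. indicator (D \<inter> A) \<omega> * ennreal (Y n \<omega> u) + indicator (D - A) \<omega> * ennreal (Y n \<omega> u) \<partial>M)"
      by (intro nn_integral_cong) (auto simp: indicator_def)
    also have "\<dots> = (\<integral>\<^sup>+\<omega>. indicator (D \<inter> A) \<omega> * ennreal (Y n \<omega> u) \<partial>M)
        + (\<integral>\<^sup>+\<omega>. indicator (D - A) \<omega> * ennreal (Y n \<omega> u) \<partial>M)"
      by (intro nn_integral_add borel_measurable_times_ennreal borel_measurable_indicator Yu sets.Int sets.Diff DM A)
    finally show ?thesis .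
  qed
  show ?thesis
    unfolding split[OF t] split[OF s(1)] after before ..
qed

text \<open>Where \<open>T n\<close> is positive, the numerator at time \<open>0\<close> is at most
  \<open>Suc n\<close> and the denominator at least \<open>1 / Suc n\<close>, hence the square;
  elsewhere \<open>Y\<close> is zero.\<close>

lemma Y_initial_finite: "(\<integral>\<^sup>+\<omega>. ennreal (Y n \<omega> 0) \<partial>M) < \<infinity>"
proof -
  have "Y n \<omega> 0 \<le> real (Suc n) * real (Suc n)" if "\<omega> \<in> space M" for \<omega>
  proof (cases "0 < T n (J \<omega>) \<omega>")
    case True
    then have b: "X (J \<omega>) \<omega> 0 \<le> real (Suc n)" "1 / real (Suc n) \<le> p (J \<omega>) \<omega> 0"
      using before_T[of 0 n "J \<omega>" \<omega>] by auto
    have "X (J \<omega>) \<omega> 0 / p (J \<omega>) \<omega> 0 \<le> real (Suc n) / (1 / real (Suc n))"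
      using b X_nonneg[OF J_space[OF that] that] by (intro frac_le) auto
    then show ?thesis
      using True by (simp add: Y_def Z_def capped_eq del: of_nat_Suc)
  qed (simp add: Y_def)
  then have "(\<integral>\<^sup>+\<omega>. ennreal (Y n \<omega> 0) \<partial>M) \<le> (\<integral>\<^sup>+\<omega>. ennreal (real (Suc n) * real (Suc n)) \<partial>M)"
    by (intro nn_integral_mono ennreal_leI)
  also have "\<dots> < \<infinity>" by (simp add: emeasure_space_1 ennreal_less_top del: of_nat_Suc)
  finally show ?thesis .
qed

lemma Y_expectation:
  assumes loc: "AE x in \<mu>. localizable x" and t: "0 \<le> t"
  shows "(\<integral>\<^sup>+\<omega>. ennreal (Y n \<omega> t) \<partial>M) = (\<integral>\<^sup>+\<omega>. ennreal (Y n \<omega> 0) \<partial>M)"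
proof (cases "t = 0")
  case False
  have "(\<integral>\<^sup>+\<omega>. indicator (space M) \<omega> * ennreal (Y n \<omega> t) \<partial>M)
      = (\<integral>\<^sup>+\<omega>. indicator (space M) \<omega> * ennreal (Y n \<omega> 0) \<partial>M)"
    using False t sets.top[of "G0 0"] by (intro Y_martingale_G0 loc) (auto simp: space_G0)
  moreover have "(\<integral>\<^sup>+\<omega>. indicator (space M) \<omega> * ennreal (Y n \<omega> u) \<partial>M) = (\<integral>\<^sup>+\<omega>. ennreal (Y n \<omega> u) \<partial>M)" for u
    by (intro nn_integral_cong) simp
  ultimately show ?thesis by simp
qed simp

text \<open>
  Passing to the right limit in \<open>s\<close> costs an inequality by Fatou's lemma; as the total masses agree, applying it to
  an event and to its complement gives equality.
\<close>

lemma Y_martingale_G: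
  assumes loc: "AE x in \<mu>. localizable x"
    and s: "0 \<le> s" "s \<le> t" and D: "D \<in> sets (G s)"
  shows "(\<integral>\<^sup>+\<omega>. indicator D \<omega> * ennreal (Y n \<omega> t) \<partial>M) = (\<integral>\<^sup>+\<omega>. indicator D \<omega> * ennreal (Y n \<omega> s) \<partial>M)"
proof (cases "s < t")
  case True
  have t: "0 \<le> t" using s by simp
  obtain u where u: "\<And>m. s < u m" "\<And>m. u m < t" and ulim: "filterlim u (at_right s) sequentially"
    using ex_right_sequence[OF True] by blast
  have u0: "0 \<le> u m" for m using u(1)[of m] s by simp
  have YM: "(\<lambda>\<omega>. ennreal (Y n \<omega> v)) \<in> borel_measurable M" if "0 \<le> v" for v
    by (rule measurable_compose[OF Y_measurable_M[OF that] measurable_ennreal])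
  have sM: "B \<in> sets M" if "B \<in> sets (G s)" for B
    using that subalgebra_G[OF s(1)] by (auto simp: subalgebra_def)
  have le: "(\<integral>\<^sup>+\<omega>. indicator B \<omega> * ennreal (Y n \<omega> s) \<partial>M) \<le> (\<integral>\<^sup>+\<omega>. indicator B \<omega> * ennreal (Y n \<omega> t) \<partial>M)"
    if B: "B \<in> sets (G s)" for B
  proof (rule nn_integral_limit_le[where f="\<lambda>m \<omega>. indicator B \<omega> * ennreal (Y n \<omega> (u m))"])
    show "(\<lambda>\<omega>. indicator B \<omega> * ennreal (Y n \<omega> (u m))) \<in> borel_measurable M" for m
      by (intro borel_measurable_times_ennreal borel_measurable_indicator sM B YM u0)
    have "B \<in> sets (G0 (u m))" for m
      using B sets_G_G0[OF s(1) u(1)] by auto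
    then show "(\<integral>\<^sup>+\<omega>. indicator B \<omega> * ennreal (Y n \<omega> (u m)) \<partial>M) \<le> (\<integral>\<^sup>+\<omega>. indicator B \<omega> * ennreal (Y n \<omega> t) \<partial>M)" for m
      by (intro eq_refl Y_martingale_G0[symmetric] loc u0 u(2))
    show "AE \<omega> in M. (\<lambda>m. indicator B \<omega> * ennreal (Y n \<omega> (u m))) \<longlonglongrightarrow> indicator B \<omega> * ennreal (Y n \<omega> s)"
      using Y_rc_AE[of n]
    proof eventually_elim
      case (elim \<omega>)
      then have "(Y n \<omega> \<longlongrightarrow> Y n \<omega> s) (at_right s)"
        using s by (simp add: continuous_within)
      then have "(\<lambda>m. Y n \<omega> (u m)) \<longlonglongrightarrow> Y n \<omega> s"
        by (rule filterlim_compose[OF _ ulim])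
      then show ?case
        by (intro ennreal_tendsto_cmult tendsto_ennrealI) (auto simp: indicator_def)
    qed
  qed
  let ?I = "\<lambda>B v. \<integral>\<^sup>+\<omega>. indicator B \<omega> * ennreal (Y n \<omega> v) \<partial>M"
  have Dc: "space M - D \<in> sets (G s)"
    using sets.compl_sets[OF D] by (simp add: space_G)
  have total: "?I D v + ?I (space M - D) v = (\<integral>\<^sup>+\<omega>. ennreal (Y n \<omega> 0) \<partial>M)" if v: "0 \<le> v" for v
  proof -
    have "?I D v + ?I (space M - D) v
        = (\<integral>\<^sup>+\<omega>. indicator D \<omega> * ennreal (Y n \<omega> v) + indicator (space M - D) \<omega> * ennreal (Y n \<omega> v) \<partial>M)"
      by (intro nn_integral_add[symmetric] borel_measurable_times_ennreal borel_measurable_indicator sM D Dc YM v)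
    also have "\<dots> = (\<integral>\<^sup>+\<omega>. ennreal (Y n \<omega> v) \<partial>M)"
      by (intro nn_integral_cong) (auto simp: indicator_def)
    finally show ?thesis using Y_expectation[OF loc v] by simp
  qed
  have "?I (space M - D) s + ?I D t \<le> ?I (space M - D) t + ?I D t"
    using le[OF Dc] by (rule add_right_mono)
  also have "\<dots> = ?I (space M - D) s + ?I D s"
    using total[OF t] total[OF s(1)] by (simp add: add.commute)
  \<comment> \<open>The integral over the complement at time \<open>s\<close> may be cancelled in
    \<open>ennreal\<close> because it is at most the finite initial mass.\<close>
  finally have "?I D t \<le> ?I D s"
    using total[OF s(1)] Y_initial_finite[of n]
    by (subst (asm) ennreal_add_left_cancel_le) auto
  then show ?thesis using le[OF D] by simp
next
  case False
  then show ?thesis using s by simp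
qed

text \<open>Integrability at every time follows from the constant expectation and its finiteness at
  \<open>0\<close>; the equality of nonnegative integrals over events then characterises the real
  conditional expectation.\<close>

lemma Y_martingale:
  assumes loc: "AE x in \<mu>. localizable x"
  shows "martingale M G (Y n)"
proof -
  have int: "integrable M (\<lambda>\<omega>. Y n \<omega> t)" if t: "0 \<le> t" for t
  proof (rule integrableI_nonneg)
    show "AE \<omega> in M. 0 \<le> Y n \<omega> t" using Y_nonneg t by (intro AE_I2)
    show "(\<integral>\<^sup>+\<omega>. ennreal (Y n \<omega> t) \<partial>M) < \<infinity>"
      unfolding Y_expectation[OF loc t] by (rule Y_initial_finite)
  qed (rule Y_measurable_M[OF t])
  show ?thesis
    unfolding martingale_def
  proof (intro conjI allI impI filtration_G adapted_Y int)
    fix s t :: real assume s: "0 \<le> s" "s \<le> t"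
    then have t: "0 \<le> t" by simp
    interpret finite_measure_subalgebra M "G s" by unfold_locales (rule subalgebra_G[OF s(1)])
    show "AE \<omega> in M. real_cond_exp M (G s) (\<lambda>\<omega>. Y n \<omega> t) \<omega> = Y n \<omega> s"
    proof (rule real_cond_exp_charact[OF _ int[OF t] int[OF s(1)]])
      show "(\<lambda>\<omega>. Y n \<omega> s) \<in> borel_measurable (G s)"
        using adapted_Y s by (simp add: adapted_def)
      fix D assume D: "D \<in> sets (G s)"
      then have DM: "D \<in> sets M" using subalgebra_G[OF s(1)] by (auto simp: subalgebra_def)
      have "(\<integral>\<omega>\<in>D. Y n \<omega> v \<partial>M) = enn2real (\<integral>\<^sup>+\<omega>. indicator D \<omega> * ennreal (Y n \<omega> v) \<partial>M)" if v: "0 \<le> v" for v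
      proof -
        have "(\<integral>\<omega>\<in>D. Y n \<omega> v \<partial>M) = enn2real (\<integral>\<^sup>+\<omega>. ennreal (indicator D \<omega> *\<^sub>R Y n \<omega> v) \<partial>M)"
          unfolding set_lebesgue_integral_def
        proof (rule integral_eq_nn_integral)
          show "(\<lambda>\<omega>. indicator D \<omega> *\<^sub>R Y n \<omega> v) \<in> borel_measurable M"
            using integrable_mult_indicator[OF DM int[OF v]] by (rule borel_measurable_integrable)
          show "AE \<omega> in M. 0 \<le> indicator D \<omega> *\<^sub>R Y n \<omega> v"
            using Y_nonneg v by (intro AE_I2) (simp add: indicator_def)
        qed
        also have "(\<integral>\<^sup>+\<omega>. ennreal (indicator D \<omega> *\<^sub>R Y n \<omega> v) \<partial>M) = (\<integral>\<^sup>+\<omega>. indicator D \<omega> * ennreal (Y n \<omega> v) \<partial>M)"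
          by (intro nn_integral_cong) (auto simp: indicator_def)
        finally show ?thesis .
      qed
      then show "(\<integral>\<omega>\<in>D. Y n \<omega> t \<partial>M) = (\<integral>\<omega>\<in>D. Y n \<omega> s \<partial>M)"
        using Y_martingale_G[OF loc s D] s t by simp
    qed
  qed
qed

lemma Z_local_martingale:
  assumes loc: "AE x in \<mu>. localizable x"
  shows "local_martingale M G Z"
  unfolding local_martingale_def
proof (intro conjI exI[of _ "\<lambda>n \<omega>. T n (J \<omega>) \<omega>"] allI filtration_G adapted_Z Z_cadlag_AE T_stopping_G)
  show "AE \<omega> in M. incseq (\<lambda>n. T n (J \<omega>) \<omega>) \<and> (\<lambda>n. T n (J \<omega>) \<omega>) \<longlonglongrightarrow> \<infinity>"
    using T_tendsto_AE by eventually_elim (simp add: T_incseq)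
  show "martingale M G (\<lambda>\<omega> t. if 0 < T n (J \<omega>) \<omega> then stopped Z (\<lambda>\<omega>. T n (J \<omega>) \<omega>) \<omega> t else 0)" for n
    using Y_martingale[OF loc, of n] by (simp add: Y_def[abs_def] stopped_eq[abs_def] cong: if_cong)
qed

end

theorem proposition3p4:
  fixes M :: "'a measure" and F :: "real \<Rightarrow> 'a measure" and E :: "'e topology"
    and J :: "'a \<Rightarrow> 'e" and \<gamma> :: "real \<Rightarrow> 'a \<Rightarrow> 'e measure" and p X :: "'e \<Rightarrow> 'a process"
  assumes "jacod_enlargement M F E J \<gamma> p"
    and "(\<lambda>(x, \<omega>, t). X x \<omega> t) \<in> borel_measurable (borel_sets_of E \<Otimes>\<^sub>M optional_sigma M F)"
    and "\<And>x \<omega> t. x \<in> topspace E \<Longrightarrow> \<omega> \<in> space M \<Longrightarrow> 0 \<le> t \<Longrightarrow> 0 \<le> X x \<omega> t"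
    and "\<And>x \<omega>. x \<in> topspace E \<Longrightarrow> \<omega> \<in> space M \<Longrightarrow> cadlag (X x \<omega>)"
  shows "((AE x in law M E J. nonneg_supermartingale M F (X x)) \<longrightarrow>
            nonneg_supermartingale M (initial_enlargement M F E J)
              (\<lambda>\<omega> t. X (J \<omega>) \<omega> t / p (J \<omega>) \<omega> t)) \<and>
         ((AE x in law M E J. local_martingale M F (X x) \<and>
              (AE \<omega> in M. \<forall>t\<ge>0. jump_to_zero (p x \<omega>) \<le> ennreal t \<longrightarrow> X x \<omega> t = 0)) \<longrightarrow>
            local_martingale M (initial_enlargement M F E J)
              (\<lambda>\<omega> t. X (J \<omega>) \<omega> t / p (J \<omega>) \<omega> t))"
proof -
  interpret jacod_enlargement M F E J \<gamma> p by fact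
  interpret enlarged_family M F E J \<gamma> p X
    by unfold_locales (fact assms)+
  have "Z = (\<lambda>\<omega> t. X (J \<omega>) \<omega> t / p (J \<omega>) \<omega> t)"
    by (simp add: fun_eq_iff Z_def)
  then show ?thesis
    using Z_supermartingale Z_local_martingale unfolding localizable_def by simp
qed

end
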